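(* Let $\mu$ be an almost symmetric probability measure on $2^{[n]}$ (i.e., its generating polynomial is symmetric in all but possibly one variable). Then (1) $\mu$ is Rayleigh (equivalently h-NLC+) if and only if $\mu$ is CNA+; (2) $\mu$ is h-NLC if and only if $\mu$ is CNA.
   Context: Notation: $[n]=\{1,\dots,n\}$; the generating polynomial of a probability measure $\mu$ on $2^{[n]}$ is $g_\mu(z_1,\dots,z_n)=\sum_{S\subseteq[n]}\mu(S)\prod_{i\in S}z_i$. Operations: the projection of $\mu$ onto $2^{S}$ has generating polynomial obtained from $g_\mu$ by setting $z_i=1$ for $i\notin S$; conditioning means passing to the conditional measure given the values of some coordinate functions $X_i$ ($X_i(S)=1$ if $i\in S$, else $0$), on events of positive probability, viewed as a measure on the power set of the remaining indices; imposing the external field $(a_1,\dots,a_n)$, $a_i\ge0$, gives the measure with generating polynomial $g_\mu(a_1z_1,\dots,a_nz_n)/g_\mu(a_1,\dots,a_n)$ when the denominator is nonzero. Rayleigh: $\frac{\partial g_\mu}{\partial z_i}(x)\frac{\partial g_\mu}{\partial z_j}(x)\ge\frac{\partial^2g_\mu}{\partial z_i\partial z_j}(x)\,g_\mu(x)$ for all $x\in(0,\infty)^n$ and $1\le i,j\le n$. NLC: $\mu(S)\mu(T)\ge\mu(S\cup T)\mu(S\cap T)$ for all $S,T\subseteq[n]$. h-NLC: every projection of $\mu$ satisfies NLC. h-NLC+: every measure obtained from $\mu$ by imposing an external field satisfies h-NLC. NA: $\int F\,d\mu\int G\,d\mu\ge\int FG\,d\mu$ for all increasing functions $F,G$ on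 $2^{[n]}$ depending on disjoint sets of coordinates. CNA: each measure obtained from $\mu$ by conditioning on some (or none) of the values of the variables is NA. CNA+: each measure obtained from $\mu$ by imposing external fields and projections is CNA. *)

theory Defs
  imports "HOL-Probability.Probability" "HOL-Combinatorics.Permutations"
begin

text \<open>
  A probability measure on the power set of a finite index set \<open>I\<close> is a value \<open>\<mu> :: nat set pmf\<close>
  with \<open>set_pmf \<mu> \<subseteq> Pow I\<close>.  Projection and conditioning change the index set, so the notions
  below carry \<open>I\<close> as an explicit argument.  Points of \<open>\<real>\<^sup>I\<close> are functions \<open>nat \<Rightarrow> real\<close>, of which only
  the values on \<open>I\<close> matter.
\<close>

definition gen_poly :: "nat set \<Rightarrow> nat set pmf \<Rightarrow> (nat \<Rightarrow> real) \<Rightarrow> real" where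
  "gen_poly I \<mu> z = (\<Sum>S\<in>Pow I. pmf \<mu> S * (\<Prod>i\<in>S. z i))"

text \<open>Symmetry of a real polynomial is the same as symmetry of its polynomial function.
  The case of a polynomial symmetric in all its variables is included: any \<open>k\<close> then works.\<close>

definition almost_symmetric :: "nat set \<Rightarrow> nat set pmf \<Rightarrow> bool" where
  "almost_symmetric I \<mu> \<longleftrightarrow>
     (\<exists>k. \<forall>\<pi>. \<pi> permutes (I - {k}) \<longrightarrow> (\<forall>z. gen_poly I \<mu> (z \<circ> \<pi>) = gen_poly I \<mu> z))"

definition projection :: "nat set \<Rightarrow> nat set pmf \<Rightarrow> nat set pmf" where
  "projection A \<mu> = map_pmf (\<lambda>S. S \<inter> A) \<mu>"

text \<open>Conditioning on the values of the \<open>X\<^sub>i\<close>, \<open>i \<in> C\<close>: the prescribed values are 1 on \<open>B\<close> and 0 on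
  \<open>C - B\<close>.  The result is a measure on the power set of \<open>I - C\<close>.\<close>

definition cond_event :: "nat set \<Rightarrow> nat set \<Rightarrow> nat set set" where
  "cond_event C B = {S. S \<inter> C = B}"

definition conditioning :: "nat set \<Rightarrow> nat set \<Rightarrow> nat set pmf \<Rightarrow> nat set pmf" where
  "conditioning C B \<mu> = map_pmf (\<lambda>S. S - C) (cond_pmf \<mu> (cond_event C B))"

text \<open>Meaningful when \<open>a\<close> is nonnegative on \<open>I\<close> and \<open>gen_poly I \<mu> a \<noteq> 0\<close>;
  see \<open>gen_poly_external_field\<close>.\<close>

definition external_field :: "nat set \<Rightarrow> (nat \<Rightarrow> real) \<Rightarrow> nat set pmf \<Rightarrow> nat set pmf" where
  "external_field I a \<mu> = embed_pmf (\<lambda>S. pmf \<mu> S * (\<Prod>i\<in>S. a i) / gen_poly I \<mu> a)"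

definition partial_deriv :: "nat \<Rightarrow> ((nat \<Rightarrow> real) \<Rightarrow> real) \<Rightarrow> (nat \<Rightarrow> real) \<Rightarrow> real" where
  "partial_deriv i f x = deriv (\<lambda>t. f (x(i := t))) (x i)"

definition Rayleigh :: "nat set \<Rightarrow> nat set pmf \<Rightarrow> bool" where
  "Rayleigh I \<mu> \<longleftrightarrow>
     (\<forall>x. (\<forall>i\<in>I. 0 < x i) \<longrightarrow> (\<forall>i\<in>I. \<forall>j\<in>I.
        partial_deriv i (gen_poly I \<mu>) x * partial_deriv j (gen_poly I \<mu>) x
          \<ge> partial_deriv i (partial_deriv j (gen_poly I \<mu>)) x * gen_poly I \<mu> x))"

definition NLC :: "nat set \<Rightarrow> nat set pmf \<Rightarrow> bool" where
  "NLC I \<mu> \<longleftrightarrow>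
     (\<forall>S\<in>Pow I. \<forall>T\<in>Pow I. pmf \<mu> S * pmf \<mu> T \<ge> pmf \<mu> (S \<union> T) * pmf \<mu> (S \<inter> T))"

definition h_NLC :: "nat set \<Rightarrow> nat set pmf \<Rightarrow> bool" where
  "h_NLC I \<mu> \<longleftrightarrow> (\<forall>A\<subseteq>I. NLC A (projection A \<mu>))"

definition h_NLC_plus :: "nat set \<Rightarrow> nat set pmf \<Rightarrow> bool" where
  "h_NLC_plus I \<mu> \<longleftrightarrow>
     (\<forall>a. (\<forall>i\<in>I. 0 \<le> a i) \<and> gen_poly I \<mu> a \<noteq> 0 \<longrightarrow> h_NLC I (external_field I a \<mu>))"

definition depends_only_on :: "nat set \<Rightarrow> (nat set \<Rightarrow> real) \<Rightarrow> nat set \<Rightarrow> bool" where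
  "depends_only_on I F A \<longleftrightarrow> (\<forall>S\<in>Pow I. \<forall>T\<in>Pow I. S \<inter> A = T \<inter> A \<longrightarrow> F S = F T)"

definition NA :: "nat set \<Rightarrow> nat set pmf \<Rightarrow> bool" where
  "NA I \<mu> \<longleftrightarrow>
     (\<forall>F G A B. A \<subseteq> I \<and> B \<subseteq> I \<and> A \<inter> B = {}
        \<and> mono_on (Pow I) F \<and> mono_on (Pow I) G
        \<and> depends_only_on I F A \<and> depends_only_on I G B
      \<longrightarrow> measure_pmf.expectation \<mu> F * measure_pmf.expectation \<mu> G
            \<ge> measure_pmf.expectation \<mu> (\<lambda>S. F S * G S))"

definition CNA :: "nat set \<Rightarrow> nat set pmf \<Rightarrow> bool" where
  "CNA I \<mu> \<longleftrightarrow>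
     (\<forall>C B. C \<subseteq> I \<and> B \<subseteq> C \<and> measure_pmf.prob \<mu> (cond_event C B) > 0
        \<longrightarrow> NA (I - C) (conditioning C B \<mu>))"

text \<open>\<open>field_proj I \<mu> J \<nu>\<close>: the measure \<open>\<nu>\<close> on \<open>Pow J\<close> arises from the measure \<open>\<mu>\<close> on \<open>Pow I\<close> by
  finitely many impositions of external fields and projections, in any order.\<close>

inductive field_proj :: "nat set \<Rightarrow> nat set pmf \<Rightarrow> nat set \<Rightarrow> nat set pmf \<Rightarrow> bool"
  for I :: "nat set" and \<mu> :: "nat set pmf" where
  base: "field_proj I \<mu> I \<mu>"
| proj: "field_proj I \<mu> J \<nu> \<Longrightarrow> A \<subseteq> J \<Longrightarrow> field_proj I \<mu> A (projection A \<nu>)"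
| field: "field_proj I \<mu> J \<nu> \<Longrightarrow> (\<And>i. i \<in> J \<Longrightarrow> 0 \<le> a i) \<Longrightarrow> gen_poly J \<nu> a \<noteq> 0
            \<Longrightarrow> field_proj I \<mu> J (external_field J a \<nu>)"

definition CNA_plus :: "nat set \<Rightarrow> nat set pmf \<Rightarrow> bool" where
  "CNA_plus I \<mu> \<longleftrightarrow> (\<forall>J \<nu>. field_proj I \<mu> J \<nu> \<longrightarrow> CNA J \<nu>)"


text \<open>Projections and external fields have the intended generating polynomials.\<close>

lemma gen_poly_projection:
  assumes "finite I" "set_pmf \<mu> \<subseteq> Pow I" "A \<subseteq> I"
  shows "gen_poly A (projection A \<mu>) z = gen_poly I \<mu> (\<lambda>i. if i \<in> A then z i else 1)"
proof -
  have *: "pmf (projection A \<mu>) T = (\<Sum>S | S \<in> Pow I \<and> S \<inter> A = T. pmf \<mu> S)" for T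
  proof -
    have "pmf (projection A \<mu>) T = measure_pmf.prob \<mu> ((\<lambda>S. S \<inter> A) -` {T})"
      unfolding projection_def by (rule pmf_map)
    also have "\<dots> = measure_pmf.prob \<mu> {S. S \<in> Pow I \<and> S \<inter> A = T}"
      using assms(2) by (intro measure_prob_cong_0) (auto simp: set_pmf_iff)
    also have "\<dots> = (\<Sum>S | S \<in> Pow I \<and> S \<inter> A = T. pmf \<mu> S)"
      using assms(1) by (intro measure_measure_pmf_finite) auto
    finally show ?thesis .
  qed
  have "gen_poly I \<mu> (\<lambda>i. if i \<in> A then z i else 1) =
          (\<Sum>S\<in>Pow I. pmf \<mu> S * (\<Prod>i\<in>S \<inter> A. z i))"
    unfolding gen_poly_def
  proof (intro sum.cong refl)
    fix S assume "S \<in> Pow I"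
    then have "finite S" using assms(1) finite_subset by auto
    then show "pmf \<mu> S * (\<Prod>i\<in>S. if i \<in> A then z i else 1) = pmf \<mu> S * (\<Prod>i\<in>S \<inter> A. z i)"
      by (simp add: prod.inter_restrict)
  qed
  also have "\<dots> = (\<Sum>T\<in>Pow A. \<Sum>S | S \<in> Pow I \<and> S \<inter> A = T. pmf \<mu> S * (\<Prod>i\<in>S \<inter> A. z i))"
    by (rule sum.group [symmetric]) (use assms finite_subset in auto)
  also have "\<dots> = gen_poly A (projection A \<mu>) z"
    unfolding gen_poly_def * sum_distrib_right by (intro sum.cong refl) auto
  finally show ?thesis ..
qed

lemma pmf_external_field:
  assumes "finite I" "set_pmf \<mu> \<subseteq> Pow I" "\<And>i. i \<in> I \<Longrightarrow> 0 \<le> a i" "gen_poly I \<mu> a \<noteq> 0"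
  shows "pmf (external_field I a \<mu>) S = pmf \<mu> S * (\<Prod>i\<in>S. a i) / gen_poly I \<mu> a"
proof -
  let ?f = "\<lambda>S. pmf \<mu> S * (\<Prod>i\<in>S. a i) / gen_poly I \<mu> a"
  have out: "pmf \<mu> T = 0" if "T \<notin> Pow I" for T
    using that assms(2) by (auto simp: set_pmf_iff)
  have pos: "0 \<le> pmf \<mu> T * (\<Prod>i\<in>T. a i)" for T
    by (cases "T \<in> Pow I") (use assms(3) in \<open>auto simp: out intro!: mult_nonneg_nonneg prod_nonneg\<close>)
  then have g: "0 \<le> gen_poly I \<mu> a"
    unfolding gen_poly_def by (intro sum_nonneg)
  have nn: "0 \<le> ?f T" for T
    using pos g by simp
  have "(\<integral>\<^sup>+T. ennreal (?f T) \<partial>count_space UNIV) = (\<Sum>T\<in>Pow I. ennreal (?f T))"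
    using assms(1) by (intro nn_integral_count_space') (auto simp: out)
  also have "\<dots> = ennreal (\<Sum>T\<in>Pow I. ?f T)"
    using nn by (simp add: sum_ennreal)
  also have "(\<Sum>T\<in>Pow I. ?f T) = 1"
    using assms(4) by (simp add: gen_poly_def flip: sum_divide_distrib)
  finally have "(\<integral>\<^sup>+T. ennreal (?f T) \<partial>count_space UNIV) = 1"
    by simp
  with nn show ?thesis
    unfolding external_field_def by (intro pmf_embed_pmf) auto
qed

lemma gen_poly_external_field:
  assumes "finite I" "set_pmf \<mu> \<subseteq> Pow I" "\<And>i. i \<in> I \<Longrightarrow> 0 \<le> a i" "gen_poly I \<mu> a \<noteq> 0"
  shows "gen_poly I (external_field I a \<mu>) z = gen_poly I \<mu> (\<lambda>i. a i * z i) / gen_poly I \<mu> a"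
proof -
  have *: "pmf (external_field I a \<mu>) S = pmf \<mu> S * (\<Prod>i\<in>S. a i) / gen_poly I \<mu> a" for S
    using assms by (rule pmf_external_field)
  show ?thesis
    unfolding gen_poly_def[of I "external_field I a \<mu>"] *
    by (simp add: gen_poly_def[of I \<mu> "\<lambda>i. a i * z i"] sum_divide_distrib prod.distrib mult.assoc)
qed

end

theory Submission
  imports Defs
begin

text \<open>
  Everything is phrased for unnormalised weights \<open>w\<close> on \<open>Pow I\<close>. An almost symmetric measure has weight
  \<open>a j\<close> or \<open>b j\<close> at a set with \<open>j\<close> elements besides the distinguished index \<open>k\<close>, according to
  whether \<open>k\<close> is absent or present. The negative lattice condition for it and its projections forces
  \<open>a\<close>, \<open>b\<close> and \<open>a + b\<close> to be log-concave and \<open>b / a\<close> to be decreasing, and these conditions imply negative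
  association, even after arbitrary external fields on the exchangeable indices: for \<open>F\<close> on the side of
  \<open>k\<close> and \<open>G\<close> on the other side, averaging over the level sets of the exchangeable coordinates on
  both sides turns \<open>F\<close> into an increasing function \<open>\<phi>(\<epsilon>, i)\<close> of the indicator \<open>\<epsilon>\<close> of \<open>k\<close> and of the number
  \<open>i\<close> of other points on its side, and \<open>G\<close> into an increasing function \<open>\<gamma>\<close> of the number of points on the
  other side. By the layer-cake formula \<open>\<phi>\<close> may be taken to be an indicator. It is then \<open>0\<close>, \<open>\<epsilon>\<close> or \<open>1\<close>
  on three consecutive ranges of \<open>i\<close>, and the conditional means of \<open>\<gamma>\<close> on the resulting four pieces compare
  as required: between different ranges because \<open>a + b\<close> is log-concave, within the middle range because
  \<open>b / a\<close> decreases.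

  A field at \<open>k\<close> merely replaces \<open>b\<close> by \<open>z b\<close>, so h-NLC+ gives the conditions for all \<open>z\<close> and hence CNA+.
  The remaining implications hold for every measure.
\<close>

subsection \<open>Log-concave sequences\<close>

text \<open>The gaps \<open>r\<close> and \<open>s\<close> are arbitrary. For nonnegative sequences
  this is stronger than the inequality for consecutive terms, because it also forbids internal
  zeros.\<close>

definition log_concave :: "(nat \<Rightarrow> real) \<Rightarrow> bool" where
  "log_concave c \<longleftrightarrow> (\<forall>i r s. c (i + r + s) * c i \<le> c (i + r) * c (i + s))"

lemma log_concaveD: "log_concave c \<Longrightarrow> c (i + r + s) * c i \<le> c (i + r) * c (i + s)"
  by (simp add: log_concave_def)

lemma log_concave_shift_scale:
  assumes "log_concave c"
  shows "log_concave (\<lambda>j. x * c (j + d))"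
proof -
  have "(x * c (i + r + s + d)) * (x * c (i + d)) \<le> (x * c (i + r + d)) * (x * c (i + s + d))" for i r s
  proof -
    have "c (i + r + s + d) * c (i + d) \<le> c (i + r + d) * c (i + s + d)"
      using log_concaveD[OF assms, of "i + d" r s] by (simp add: ac_simps)
    then have "x^2 * (c (i + r + s + d) * c (i + d)) \<le> x^2 * (c (i + r + d) * c (i + s + d))"
      by (rule mult_left_mono) simp
    then show ?thesis by (simp add: power2_eq_square algebra_simps)
  qed
  then show ?thesis by (simp add: log_concave_def)
qed

section \<open>Correlation inequalities by symmetrisation\<close>

text \<open>Adding the double sum to its transpose leaves only the terms
  \<open>h p q + h q p\<close>. This turns the Chebyshev-type inequalities below into a sign check
  for each pair.\<close>

lemma sum_antisym_nonpos:
  fixes h :: "'a \<Rightarrow> 'a \<Rightarrow> real"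
  assumes "\<And>p q. p \<in> X \<Longrightarrow> q \<in> X \<Longrightarrow> h p q + h q p \<le> 0"
  shows "(\<Sum>p\<in>X. \<Sum>q\<in>X. h p q) \<le> 0"
proof -
  have "(\<Sum>p\<in>X. \<Sum>q\<in>X. h p q) + (\<Sum>p\<in>X. \<Sum>q\<in>X. h p q)
      = (\<Sum>p\<in>X. \<Sum>q\<in>X. h p q) + (\<Sum>p\<in>X. \<Sum>q\<in>X. h q p)"
    by (subst (2) sum.swap) simp
  also have "\<dots> = (\<Sum>p\<in>X. \<Sum>q\<in>X. h p q + h q p)"
    by (simp add: sum.distrib)
  also have "\<dots> \<le> 0"
    using assms by (intro sum_nonpos) auto
  finally show ?thesis by simp
qed

text \<open>Read \<open>u\<close> and \<open>v\<close> as densities: by \<open>ratio\<close> the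
  quotient \<open>v / u\<close> decreases, so \<open>v\<close> favours small arguments and gives the
  increasing \<open>\<gamma>\<close> a smaller mean. The cross-multiplied form also covers zeros of
  the densities. For \<open>p < q\<close> the symmetrised term is minus the gap in
  \<open>ratio\<close> times the increment of \<open>\<gamma>\<close>.\<close>

lemma likelihood_ratio_mean_le:
  fixes u v \<gamma> :: "nat \<Rightarrow> real"
  assumes ratio: "\<And>l l'. l < l' \<Longrightarrow> l' \<le> m \<Longrightarrow> v l' * u l \<le> v l * u l'"
    and mono: "\<And>l l'. l \<le> l' \<Longrightarrow> l' \<le> m \<Longrightarrow> \<gamma> l \<le> \<gamma> l'"
  shows "(\<Sum>l\<le>m. v l * \<gamma> l) * (\<Sum>l\<le>m. u l) \<le> (\<Sum>l\<le>m. u l * \<gamma> l) * (\<Sum>l\<le>m. v l)"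
proof -
  have aux: "(v p * \<gamma> p * u q - u p * \<gamma> p * v q) + (v q * \<gamma> q * u p - u q * \<gamma> q * v p) \<le> 0"
    if "p \<le> q" "q \<le> m" for p q
  proof (cases "p = q")
    case False
    then have "v q * u p \<le> v p * u q" using ratio that by auto
    moreover have "\<gamma> p \<le> \<gamma> q" using mono that by auto
    ultimately have "0 \<le> (v p * u q - v q * u p) * (\<gamma> q - \<gamma> p)" by simp
    then show ?thesis by (simp add: algebra_simps)
  qed simp
  have "(v p * \<gamma> p * u q - u p * \<gamma> p * v q) + (v q * \<gamma> q * u p - u q * \<gamma> q * v p) \<le> 0"
    if "p \<in> {..m}" "q \<in> {..m}" for p q
    using aux[of p q] aux[of q p] that by (cases "p \<le> q") auto
  then have "(\<Sum>p\<le>m. \<Sum>q\<le>m. v p * \<gamma> p * u q - u p * \<gamma> p * v q) \<le> 0"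
    by (rule sum_antisym_nonpos)
  then show ?thesis
    by (simp add: sum_subtractf sum_product)
qed

text \<open>Averaging against log-concave weights preserves the monotonicity of
  \<open>b / a\<close>: the shifted copy of \<open>E\<close> has an increasing ratio to
  \<open>E\<close>, while \<open>b / a\<close> decreases, so each symmetrised pair is minus a
  product of two nonnegative 2 by 2 minors.\<close>

lemma ratio_decreasing_correlation:
  fixes a b E :: "nat \<Rightarrow> real"
  assumes ratio: "\<And>i r. b (i + r) * a i \<le> b i * a (i + r)"
    and lc: "log_concave E" and nonneg: "\<And>i. 0 \<le> E i" and supp: "\<And>i. m < i \<Longrightarrow> E i = 0"
  shows "(\<Sum>k\<le>m. E k * b (k + d)) * (\<Sum>k\<le>m. E k * a k)
       \<le> (\<Sum>k\<le>m. E k * b k) * (\<Sum>k\<le>m. E k * a (k + d))"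
proof -
  \<comment> \<open>Moving the shift from \<open>a\<close> and \<open>b\<close> onto
    \<open>E\<close> lets all four sums run over one range with the same argument.\<close>
  define E' where "E' p = (if p < d then 0 else E (p - d))" for p
  have shift: "(\<Sum>k\<le>m. E k * c (k + d)) = (\<Sum>p\<le>m+d. E' p * c p)" for c :: "nat \<Rightarrow> real"
  proof -
    have "(\<Sum>p\<le>m+d. E' p * c p) = (\<Sum>p\<in>{0+d..m+d}. E' p * c p)"
      by (intro sum.mono_neutral_right) (auto simp: E'_def)
    also have "\<dots> = (\<Sum>k\<in>{0..m}. E' (k + d) * c (k + d))"
      by (rule sum.shift_bounds_cl_nat_ivl)
    also have "\<dots> = (\<Sum>k\<le>m. E k * c (k + d))"
      by (intro sum.cong) (auto simp: E'_def)
    finally show ?thesis ..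
  qed
  have ext: "(\<Sum>k\<le>m. E k * c k) = (\<Sum>p\<le>m+d. E p * c p)" for c :: "nat \<Rightarrow> real"
    by (intro sum.mono_neutral_left) (auto simp: supp)
  \<comment> \<open>The ratio \<open>E' / E\<close> increases: this is log-concavity at
    \<open>q - d\<close> with gaps \<open>d\<close> and \<open>p - q\<close>. Below \<open>d\<close>
    the weight \<open>E'\<close> is zero.\<close>
  have K: "0 \<le> E' p * E q - E p * E' q" if "q \<le> p" for p q
  proof (cases "q < d")
    case True then show ?thesis using nonneg by (simp add: E'_def)
  next
    case False
    then have "q - d + d + (p - q) = p" "q - d + d = q" "q - d + (p - q) = p - d" "\<not> p < d"
      using that by auto
    then show ?thesis using log_concaveD[OF lc, of "q - d" d "p - q"] False
      by (simp add: E'_def mult.commute)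
  qed
  have aux: "(E' p * E q - E p * E' q) * (b p * a q) + (E' q * E p - E q * E' p) * (b q * a p) \<le> 0"
    if "q \<le> p" for p q
  proof -
    have "b p * a q \<le> b q * a p" using ratio[of q "p - q"] that by simp
    then have "0 \<le> (E' p * E q - E p * E' q) * (b q * a p - b p * a q)"
      using K[OF that] by simp
    then show ?thesis by (simp add: algebra_simps)
  qed
  have "(\<Sum>p\<le>m+d. \<Sum>q\<le>m+d. (E' p * E q - E p * E' q) * (b p * a q)) \<le> 0"
  proof (rule sum_antisym_nonpos)
    fix p q
    show "(E' p * E q - E p * E' q) * (b p * a q) + (E' q * E p - E q * E' p) * (b q * a p) \<le> 0"
    proof (cases "q \<le> p")
      case True
      then show ?thesis by (rule aux)
    next
      case False
      then have "p \<le> q" by simp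
      from aux[OF this] show ?thesis by (simp only: add.commute)
    qed
  qed
  then have "(\<Sum>p\<le>m+d. E' p * b p) * (\<Sum>q\<le>m+d. E q * a q)
      \<le> (\<Sum>p\<le>m+d. E p * b p) * (\<Sum>q\<le>m+d. E' q * a q)"
    unfolding sum_product sum_subtractf left_diff_distrib by (simp only: ac_simps diff_le_0_iff_le)
  then show ?thesis
    unfolding shift[of b] shift[of a] ext[of b] ext[of a] .
qed

section \<open>Layer-cake reduction to superlevel sets\<close>

text \<open>\<open>X\<close> is a constant plus a positive combination of indicators of its
  superlevel sets, and the constant contributes nothing because \<open>u\<close> has total 0. The
  induction, on the number of values of \<open>X\<close>, peels off one layer at a time.\<close>

lemma sum_mult_nonpos_if_superlevel:
  fixes u X :: "'a \<Rightarrow> real"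
  assumes fin: "finite \<Omega>" and tot: "sum u \<Omega> = 0"
    and lev: "\<And>v. (\<Sum>x | x \<in> \<Omega> \<and> v \<le> X x. u x) \<le> 0"
  shows "(\<Sum>x\<in>\<Omega>. u x * X x) \<le> 0"
proof -
  have "(\<And>v. (\<Sum>x | x \<in> \<Omega> \<and> v \<le> X x. u x) \<le> 0) \<Longrightarrow> card (X ` \<Omega>) = n
      \<Longrightarrow> (\<Sum>x\<in>\<Omega>. u x * X x) \<le> 0" for n X
  proof (induction n arbitrary: X rule: less_induct)
    case (less n X)
    show ?case
    proof (cases "card (X ` \<Omega>) \<le> 1")
      case True
      obtain c where c: "\<And>x. x \<in> \<Omega> \<Longrightarrow> X x = c"
      proof (cases "\<Omega> = {}")
        case False
        then have "card (X ` \<Omega>) = 1" using True fin by (simp add: le_Suc_eq)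
        then obtain c where "X ` \<Omega> = {c}" by (rule card_1_singletonE)
        then show ?thesis by (intro that) blast
      qed (use that in simp)
      have "(\<Sum>x\<in>\<Omega>. u x * X x) = (\<Sum>x\<in>\<Omega>. u x * c)"
        by (intro sum.cong refl) (simp add: c)
      then have "(\<Sum>x\<in>\<Omega>. u x * X x) = sum u \<Omega> * c" by (simp only: sum_distrib_right)
      then show ?thesis using tot by simp
    next
      case False
      define M where "M = Max (X ` \<Omega>)"
      define V where "V = X ` \<Omega> - {M}"
      define M' where "M' = Max V"
      have finX: "finite (X ` \<Omega>)" using fin by simp
      have ne: "X ` \<Omega> \<noteq> {}" using False by auto
      have MX: "M \<in> X ` \<Omega>" unfolding M_def using finX ne by (rule Max_in)
      have cardV: "card V = card (X ` \<Omega>) - 1" unfolding V_def using MX finX by simp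
      then have "card V \<noteq> 0" using False by simp
      then have V: "V \<noteq> {}" "finite V" using finX by (auto simp: V_def)
      have M'V: "M' \<in> V" unfolding M'_def using V by simp
      have leM: "X x \<le> M" if "x \<in> \<Omega>" for x unfolding M_def using that finX by simp
      have leM': "X x \<le> M'" if "x \<in> \<Omega>" "X x \<noteq> M" for x
        unfolding M'_def using that V by (intro Max_ge) (auto simp: V_def)
      have M'M: "M' < M" using M'V leM by (force simp: V_def)
      \<comment> \<open>Lowering the top value to the next one removes exactly \<open>M - M'\<close>
        times the indicator of the top level. Every superlevel set of \<open>Y\<close> is one of
        \<open>X\<close> or empty.\<close>
      define Y where "Y x = min (X x) M'" for x
      have "Y x \<in> V" if "x \<in> \<Omega>" for x
      proof (cases "X x = M")
        case True
        then show ?thesis using M'V M'M by (simp add: Y_def)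
      next
        case False
        then show ?thesis using leM'[OF that False] that by (simp add: Y_def V_def)
      qed
      then have Yim: "Y ` \<Omega> \<subseteq> V" by blast
      have "(\<Sum>x\<in>\<Omega>. u x * Y x) \<le> 0"
      proof (rule less.IH)
        have "card (Y ` \<Omega>) \<le> card V" using Yim V by (simp add: card_mono)
        then show "card (Y ` \<Omega>) < n" using cardV False less.prems(2) by simp
        show "card (Y ` \<Omega>) = card (Y ` \<Omega>)" ..
        show "(\<Sum>x | x \<in> \<Omega> \<and> v \<le> Y x. u x) \<le> 0" for v
        proof (cases "v \<le> M'")
          case True
          then show ?thesis using less.prems(1)[of v] by (simp add: Y_def)
        qed (simp add: Y_def)
      qed
      moreover have "(\<Sum>x\<in>\<Omega>. u x * X x) - (\<Sum>x\<in>\<Omega>. u x * Y x) = (M - M') * (\<Sum>x | x \<in> \<Omega> \<and> M \<le> X x. u x)"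
      proof -
        have "(\<Sum>x\<in>\<Omega>. u x * X x) - (\<Sum>x\<in>\<Omega>. u x * Y x) = (\<Sum>x\<in>\<Omega>. u x * (X x - Y x))"
          by (simp add: sum_subtractf right_diff_distrib)
        also have "\<dots> = (\<Sum>x | x \<in> \<Omega> \<and> M \<le> X x. u x * (X x - Y x))"
        proof (intro sum.mono_neutral_right ballI)
          fix x assume "x \<in> \<Omega> - {x \<in> \<Omega>. M \<le> X x}"
          then show "u x * (X x - Y x) = 0" using leM'[of x] by (auto simp: Y_def)
        qed (use fin in auto)
        also have "\<dots> = (\<Sum>x | x \<in> \<Omega> \<and> M \<le> X x. (M - M') * u x)"
        proof (intro sum.cong refl)
          fix x assume "x \<in> {x \<in> \<Omega>. M \<le> X x}"
          then have "X x = M" using leM[of x] by auto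
          then show "u x * (X x - Y x) = (M - M') * u x" using M'M by (simp add: Y_def)
        qed
        finally show ?thesis by (simp add: sum_distrib_left)
      qed
      moreover have "(M - M') * (\<Sum>x | x \<in> \<Omega> \<and> M \<le> X x. u x) \<le> 0"
        using less.prems(1)[of M] M'M by (intro mult_nonneg_nonpos) auto
      ultimately show ?thesis by linarith
    qed
  qed
  from this[OF lev refl] show ?thesis .
qed

text \<open>In the intended use a cell is given by a row (absence or presence of the distinguished
  point) and a column \<open>k\<close>; \<open>P\<close> is its mass and \<open>M\<close> the
  integral of an increasing function over it, so that \<open>M / P\<close> is a mean. Then
  \<open>col\<close> says that column means decrease, \<open>row\<close> that over an interval of
  columns row 1 has at most the mean of row 0, and \<open>null\<close> deals with empty cells. The
  claim is linear in the pair \<open>\<phi>0\<close>, \<open>\<phi>1\<close>, hence it suffices to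
  check it on superlevel sets.\<close>

lemma two_row_superlevel:
  fixes P0 P1 M0 M1 \<phi>0 \<phi>1 :: "nat \<Rightarrow> real"
  assumes P0: "\<And>k. 0 \<le> P0 k" and P1: "\<And>k. 0 \<le> P1 k"
    and null: "\<And>k. P0 k = 0 \<Longrightarrow> M0 k = 0"
    and col: "\<And>k k'. k < k' \<Longrightarrow> k' \<le> m \<Longrightarrow>
       (M0 k' + M1 k') * (P0 k + P1 k) \<le> (M0 k + M1 k) * (P0 k' + P1 k')"
    and row: "\<And>Z. Z \<subseteq> {..m} \<Longrightarrow> (\<And>i j k. i \<in> Z \<Longrightarrow> k \<in> Z \<Longrightarrow> i \<le> j \<Longrightarrow> j \<le> k \<Longrightarrow> j \<in> Z) \<Longrightarrow>
       sum M1 Z * sum P0 Z \<le> sum M0 Z * sum P1 Z"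
    and mono0: "\<And>k k'. k \<le> k' \<Longrightarrow> k' \<le> m \<Longrightarrow> \<phi>0 k \<le> \<phi>0 k'"
    and mono1: "\<And>k k'. k \<le> k' \<Longrightarrow> k' \<le> m \<Longrightarrow> \<phi>1 k \<le> \<phi>1 k'"
    and le: "\<And>k. k \<le> m \<Longrightarrow> \<phi>0 k \<le> \<phi>1 k"
  shows "(\<Sum>k\<le>m. M0 k * \<phi>0 k + M1 k * \<phi>1 k) * (\<Sum>k\<le>m. P0 k + P1 k)
       \<le> (\<Sum>k\<le>m. P0 k * \<phi>0 k + P1 k * \<phi>1 k) * (\<Sum>k\<le>m. M0 k + M1 k)"
proof -
  define PT where "PT = (\<Sum>k\<le>m. P0 k + P1 k)"
  define MT where "MT = (\<Sum>k\<le>m. M0 k + M1 k)"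
  \<comment> \<open>The sum of \<open>u x * \<phi> x\<close> is the left side minus the right side
    of the claim, and \<open>u\<close> itself sums to zero.\<close>
  define u where "u = (\<lambda>(\<epsilon>, k). if \<epsilon> then M1 k * PT - MT * P1 k else M0 k * PT - MT * P0 k)"
  define \<phi> where "\<phi> = (\<lambda>(\<epsilon>, k). if \<epsilon> then \<phi>1 k else \<phi>0 k)"
  define \<Omega> where "\<Omega> = (UNIV :: bool set) \<times> {..m}"
  have sum_\<Omega>: "sum h \<Omega> = (\<Sum>k\<le>m. h (False, k)) + (\<Sum>k\<le>m. h (True, k))" for h :: "bool \<times> nat \<Rightarrow> real"
  proof -
    have "\<Omega> = Pair False ` {..m} \<union> Pair True ` {..m}"
      by (auto simp: \<Omega>_def)
    then have "sum h \<Omega> = sum h (Pair False ` {..m}) + sum h (Pair True ` {..m})"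
      by (simp only:) (rule sum.union_disjoint; auto)
    then show ?thesis by (simp add: sum.reindex inj_on_def)
  qed
  have "(\<Sum>x\<in>\<Omega>. u x * \<phi> x) \<le> 0"
  proof (rule sum_mult_nonpos_if_superlevel)
    show "finite \<Omega>" by (simp add: \<Omega>_def)
    show "sum u \<Omega> = 0"
      by (simp add: sum_\<Omega> u_def sum_subtractf PT_def MT_def sum.distrib algebra_simps
          flip: sum_distrib_left sum_distrib_right)
    fix v
    \<comment> \<open>\<open>Z1\<close>, \<open>Z2\<close>, \<open>Z3\<close> are the columns in
      which no cell, only the cell of row 1, or both cells lie in the superlevel set. By
      monotonicity they are consecutive ranges.\<close>
    define Z1 where "Z1 = {k\<in>{..m}. \<phi>1 k < v}"
    define Z2 where "Z2 = {k\<in>{..m}. \<phi>0 k < v \<and> v \<le> \<phi>1 k}"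
    define Z3 where "Z3 = {k\<in>{..m}. v \<le> \<phi>0 k}"
    have part: "sum h {..m} = sum h Z1 + sum h Z2 + sum h Z3" for h :: "nat \<Rightarrow> real"
    proof -
      have "{..m} = (Z1 \<union> Z2) \<union> Z3" using le by (force simp: Z1_def Z2_def Z3_def)
      moreover have "sum h ((Z1 \<union> Z2) \<union> Z3) = sum h (Z1 \<union> Z2) + sum h Z3"
        by (rule sum.union_disjoint) (use le in \<open>force simp: Z1_def Z2_def Z3_def\<close>)+
      moreover have "sum h (Z1 \<union> Z2) = sum h Z1 + sum h Z2"
        by (rule sum.union_disjoint) (auto simp: Z1_def Z2_def)
      ultimately show ?thesis by simp
    qed
    have cmp: "sum (\<lambda>k. M0 k + M1 k) Z' * sum (\<lambda>k. P0 k + P1 k) Z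
        \<le> sum (\<lambda>k. M0 k + M1 k) Z * sum (\<lambda>k. P0 k + P1 k) Z'"
      if "Z' \<subseteq> {..m}" "\<And>k k'. k \<in> Z \<Longrightarrow> k' \<in> Z' \<Longrightarrow> k < k'" for Z Z'
    proof -
      have "(\<Sum>k'\<in>Z'. \<Sum>k\<in>Z. (M0 k' + M1 k') * (P0 k + P1 k))
          \<le> (\<Sum>k'\<in>Z'. \<Sum>k\<in>Z. (M0 k + M1 k) * (P0 k' + P1 k'))"
        using that by (intro sum_mono col) auto
      then show ?thesis
        by (subst (asm) (2) sum.swap) (simp only: sum_product)
    qed
    have lt12: "k < k'" if "k \<in> Z1" "k' \<in> Z2" for k k'
      using that mono1[of k' k] by (force simp: Z1_def Z2_def not_less[symmetric])
    have lt23: "k < k'" if "k \<in> Z2" "k' \<in> Z3" for k k'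
      using that mono0[of k' k] by (force simp: Z3_def Z2_def not_less[symmetric])
    have lt13: "k < k'" if "k \<in> Z1" "k' \<in> Z3" for k k'
      using that mono1[of k' k] le[of k'] by (force simp: Z3_def Z1_def not_less[symmetric])
    have sub: "Z2 \<subseteq> {..m}" "Z3 \<subseteq> {..m}" by (auto simp: Z2_def Z3_def)
    define M3 where "M3 = sum (\<lambda>k. M0 k + M1 k) Z3"
    define p3 where "p3 = sum (\<lambda>k. P0 k + P1 k) Z3"
    define m1 where "m1 = sum (\<lambda>k. M0 k + M1 k) Z1"
    define p1 where "p1 = sum (\<lambda>k. P0 k + P1 k) Z1"
    define M20 where "M20 = sum M0 Z2"
    define p20 where "p20 = sum P0 Z2"
    define M21 where "M21 = sum M1 Z2"
    define p21 where "p21 = sum P1 Z2"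
    have nn: "0 \<le> p3" "0 \<le> p1" "0 \<le> p20" "0 \<le> p21"
      using P0 P1 by (auto simp: p3_def p1_def p20_def p21_def intro!: sum_nonneg add_nonneg_nonneg)
    \<comment> \<open>The superlevel set consists of both rows over \<open>Z3\<close> and the row of \<open>\<phi>1\<close> over \<open>Z2\<close>; each of these two
      pieces has a smaller \<open>M\<close>-mean than each of the two pieces of the complement.\<close>
    have c31: "M3 * p1 \<le> m1 * p3"
      unfolding M3_def p1_def m1_def p3_def by (rule cmp) (use lt13 in \<open>auto simp: Z3_def\<close>)
    have c32: "M3 * (p20 + p21) \<le> (M20 + M21) * p3"
      using cmp[OF sub(2) lt23] by (simp add: M3_def p20_def p21_def M20_def M21_def p3_def sum.distrib)
    have c21: "(M20 + M21) * p1 \<le> m1 * (p20 + p21)"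
      using cmp[OF sub(1) lt12] by (simp add: m1_def p20_def p21_def M20_def M21_def p1_def sum.distrib)
    have c22: "M21 * p20 \<le> M20 * p21"
      unfolding M21_def p20_def M20_def p21_def
    proof (rule row)
      show "j \<in> Z2" if "i \<in> Z2" "k \<in> Z2" "i \<le> j" "j \<le> k" for i j k
        using that mono0[of j k] mono1[of i j] by (force simp: Z2_def)
    qed (auto simp: Z2_def)
    have null0: "M20 = 0" if "p20 = 0"
    proof -
      have "P0 k = 0" if "k \<in> Z2" for k
        using \<open>p20 = 0\<close> that P0 unfolding p20_def
        by (subst (asm) sum_nonneg_eq_0_iff) (auto simp: Z2_def)
      then show ?thesis by (auto simp: M20_def null intro!: sum.neutral)
    qed
    \<comment> \<open>In terms of means: \<open>Z3\<close> lies below \<open>Z2\<close> by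
      \<open>c32\<close>, and by \<open>c22\<close> the mean over \<open>Z2\<close> lies below that
      of its row 0. The estimate \<open>d2\<close> is the mirror image: row 1 of \<open>Z2\<close>
      lies below \<open>Z2\<close>, which lies below \<open>Z1\<close>.\<close>
    have d1: "M3 * p20 \<le> M20 * p3"
    proof (cases "p20 = 0")
      case False
      then have pos: "0 < p20 + p21" using nn by simp
      have "(M20 + M21) * p20 \<le> M20 * (p20 + p21)" using c22 by (simp add: algebra_simps)
      then have "((M20 + M21) * p20) * p3 \<le> (M20 * (p20 + p21)) * p3"
        using nn by (intro mult_right_mono) auto
      moreover have "(M3 * (p20 + p21)) * p20 \<le> ((M20 + M21) * p3) * p20"
        using c32 nn by (intro mult_right_mono) auto
      ultimately have "(p20 + p21) * (M3 * p20) \<le> (p20 + p21) * (M20 * p3)"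
        by (simp add: algebra_simps)
      then show ?thesis using pos by (simp add: mult_le_cancel_left_pos)
    qed (use null0 in simp)
    have d2: "M21 * p1 \<le> m1 * p21"
    proof (cases "p20 + p21 = 0")
      case False
      then have pos: "0 < p20 + p21" using nn by simp
      have "M21 * (p20 + p21) \<le> (M20 + M21) * p21" using c22 by (simp add: algebra_simps)
      then have "(M21 * (p20 + p21)) * p1 \<le> ((M20 + M21) * p21) * p1"
        using nn by (intro mult_right_mono) auto
      moreover have "((M20 + M21) * p1) * p21 \<le> (m1 * (p20 + p21)) * p21"
        using c21 nn by (intro mult_right_mono) auto
      ultimately have "(p20 + p21) * (M21 * p1) \<le> (p20 + p21) * (m1 * p21)"
        by (simp add: algebra_simps)
      then show ?thesis using pos by (simp add: mult_le_cancel_left_pos)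
    next
      case True
      then have z: "p20 = 0" "p21 = 0" using nn by linarith+
      then show ?thesis using c21 null0 by simp
    qed
    have fin: "finite Z2" "finite Z3" by (auto simp: Z2_def Z3_def)
    have dis: "Z2 \<inter> Z3 = {}" by (auto simp: Z2_def Z3_def)
    have PT: "PT = p1 + (p20 + p21) + p3"
      unfolding PT_def part by (simp add: p1_def p20_def p21_def p3_def sum.distrib)
    have MT: "MT = m1 + (M20 + M21) + M3"
      unfolding MT_def part by (simp add: m1_def M20_def M21_def M3_def sum.distrib)
    have "{x \<in> \<Omega>. v \<le> \<phi> x} = Pair False ` Z3 \<union> Pair True ` (Z2 \<union> Z3)"
    proof (rule set_eqI)
      fix x :: "bool \<times> nat"
      obtain \<epsilon> k where x: "x = (\<epsilon>, k)" by (cases x)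
      show "x \<in> {x \<in> \<Omega>. v \<le> \<phi> x} \<longleftrightarrow> x \<in> Pair False ` Z3 \<union> Pair True ` (Z2 \<union> Z3)"
        using le[of k] unfolding x by (cases \<epsilon>) (auto simp: \<Omega>_def \<phi>_def Z2_def Z3_def)
    qed
    then have "(\<Sum>x | x \<in> \<Omega> \<and> v \<le> \<phi> x. u x) = sum u (Pair False ` Z3 \<union> Pair True ` (Z2 \<union> Z3))"
      by simp
    also have "\<dots> = sum u (Pair False ` Z3) + sum u (Pair True ` (Z2 \<union> Z3))"
      using fin by (intro sum.union_disjoint) auto
    also have "\<dots> = (\<Sum>k\<in>Z3. u (False, k)) + (\<Sum>k\<in>Z2 \<union> Z3. u (True, k))"
      by (simp add: sum.reindex inj_on_def)
    also have "\<dots> = (\<Sum>k\<in>Z3. u (False, k)) + ((\<Sum>k\<in>Z2. u (True, k)) + (\<Sum>k\<in>Z3. u (True, k)))"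
      using fin dis by (simp add: sum.union_disjoint)
    also have "\<dots> = (M3 + M21) * PT - MT * (p3 + p21)"
      by (simp add: u_def M3_def M21_def p3_def p21_def sum_subtractf sum.distrib algebra_simps
          flip: sum_distrib_left sum_distrib_right)
    \<comment> \<open>After cancellation the expression is the sum of the four differences in
      \<open>c31\<close>, \<open>d1\<close>, \<open>d2\<close> and \<open>c22\<close>, one for each
      pair of a piece inside and a piece outside the superlevel set.\<close>
    also have "\<dots> \<le> 0"
      using c31 d1 d2 c22 unfolding PT MT by (simp add: algebra_simps)
    finally show "(\<Sum>x | x \<in> \<Omega> \<and> v \<le> \<phi> x. u x) \<le> 0" .
  qed
  also have "(\<Sum>x\<in>\<Omega>. u x * \<phi> x) = (\<Sum>k\<le>m. M0 k * \<phi>0 k + M1 k * \<phi>1 k) * PT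
      - (\<Sum>k\<le>m. P0 k * \<phi>0 k + P1 k * \<phi>1 k) * MT"
    by (simp add: sum_\<Omega> u_def \<phi>_def left_diff_distrib sum_subtractf sum.distrib sum_distrib_right
        sum_distrib_left algebra_simps)
  finally show ?thesis by (simp add: PT_def MT_def)
qed

text \<open>\<open>e k\<close> and \<open>f l\<close> are the weights of the level sets of the two groups of exchangeable
  coordinates, and \<open>a\<close>, \<open>b\<close> the values of the measure without and with the distinguished one.\<close>

lemma two_row_neg_correlation:
  fixes a b e f \<gamma> \<phi>0 \<phi>1 :: "nat \<Rightarrow> real"
  assumes a: "\<And>j. 0 \<le> a j" and b: "\<And>j. 0 \<le> b j"
    and lc: "log_concave (\<lambda>j. a j + b j)"
    and ratio: "\<And>i r. b (i + r) * a i \<le> b i * a (i + r)"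
    and e: "\<And>k. 0 \<le> e k" and lce: "log_concave e" and f: "\<And>l. 0 \<le> f l"
    and mono0: "\<And>k k'. k \<le> k' \<Longrightarrow> k' \<le> m \<Longrightarrow> \<phi>0 k \<le> \<phi>0 k'"
    and mono1: "\<And>k k'. k \<le> k' \<Longrightarrow> k' \<le> m \<Longrightarrow> \<phi>1 k \<le> \<phi>1 k'"
    and le: "\<And>k. k \<le> m \<Longrightarrow> \<phi>0 k \<le> \<phi>1 k"
    and mono\<gamma>: "\<And>l l'. l \<le> l' \<Longrightarrow> l' \<le> n \<Longrightarrow> \<gamma> l \<le> \<gamma> l'"
  defines "P c k \<equiv> e k * (\<Sum>l\<le>n. f l * c (k + l))"
    and "M c k \<equiv> e k * (\<Sum>l\<le>n. f l * c (k + l) * \<gamma> l)"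
  shows "(\<Sum>k\<le>m. M a k * \<phi>0 k + M b k * \<phi>1 k) * (\<Sum>k\<le>m. P a k + P b k)
       \<le> (\<Sum>k\<le>m. P a k * \<phi>0 k + P b k * \<phi>1 k) * (\<Sum>k\<le>m. M a k + M b k)"
proof (rule two_row_superlevel)
  show "0 \<le> P a k" "0 \<le> P b k" for k
    using a b e f by (auto simp: P_def intro!: mult_nonneg_nonneg sum_nonneg)
  show "M a k = 0" if "P a k = 0" for k
  proof (cases "e k = 0")
    case False
    then have "(\<Sum>l\<le>n. f l * a (k + l)) = 0" using that by (simp add: P_def)
    then have "\<forall>l\<in>{..n}. f l * a (k + l) = 0"
      using a f by (subst (asm) sum_nonneg_eq_0_iff) auto
    then have "(\<Sum>l\<le>n. f l * a (k + l) * \<gamma> l) = 0"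
      by (intro sum.neutral ballI) simp
    then show ?thesis by (simp add: M_def)
  qed (simp add: M_def)
  \<comment> \<open>By log-concavity of \<open>a + b\<close> the ratio of column \<open>k'\<close>
    to column \<open>k\<close> decreases in \<open>l\<close>, so the column further right has the
    smaller mean of \<open>\<gamma>\<close>. The factor \<open>e k * e k'\<close> is common to both
    sides.\<close>
  show "(M a k' + M b k') * (P a k + P b k) \<le> (M a k + M b k) * (P a k' + P b k')"
    if "k < k'" "k' \<le> m" for k k'
  proof -
    define c where "c j = a j + b j" for j
    have "(\<Sum>l\<le>n. (f l * c (k' + l)) * \<gamma> l) * (\<Sum>l\<le>n. f l * c (k + l))
        \<le> (\<Sum>l\<le>n. (f l * c (k + l)) * \<gamma> l) * (\<Sum>l\<le>n. f l * c (k' + l))"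
    proof (rule likelihood_ratio_mean_le)
      fix l l' :: nat assume "l < l'"
      then have "c (k' + l') * c (k + l) \<le> c (k' + l) * c (k + l')"
        using log_concaveD[OF lc, of "k + l" "k' - k" "l' - l"] \<open>k < k'\<close> by (simp add: c_def ac_simps)
      then have "(f l * f l') * (c (k' + l') * c (k + l)) \<le> (f l * f l') * (c (k' + l) * c (k + l'))"
        using f by (intro mult_left_mono) auto
      then show "f l' * c (k' + l') * (f l * c (k + l)) \<le> f l * c (k' + l) * (f l' * c (k + l'))"
        by (simp add: ac_simps)
    qed (use mono\<gamma> in auto)
    then have "(e k * e k') * ((\<Sum>l\<le>n. (f l * c (k' + l)) * \<gamma> l) * (\<Sum>l\<le>n. f l * c (k + l)))
        \<le> (e k * e k') * ((\<Sum>l\<le>n. (f l * c (k + l)) * \<gamma> l) * (\<Sum>l\<le>n. f l * c (k' + l)))"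
      using e by (intro mult_left_mono) auto
    moreover have "M a j + M b j = e j * (\<Sum>l\<le>n. f l * c (j + l) * \<gamma> l)"
      "P a j + P b j = e j * (\<Sum>l\<le>n. f l * c (j + l))" for j
      by (simp_all add: M_def P_def c_def algebra_simps sum.distrib)
    ultimately show ?thesis by (simp add: ac_simps)
  qed
  show "sum (M b) Z * sum (P a) Z \<le> sum (M a) Z * sum (P b) Z"
    if Z: "Z \<subseteq> {..m}" "\<And>i j k. i \<in> Z \<Longrightarrow> k \<in> Z \<Longrightarrow> i \<le> j \<Longrightarrow> j \<le> k \<Longrightarrow> j \<in> Z" for Z
  proof -
    \<comment> \<open>Cutting \<open>e\<close> down to the interval \<open>Z\<close> keeps it
      log-concave, since indices between two points of \<open>Z\<close> are again in
      \<open>Z\<close>. Hence \<open>W b / W a\<close> decreases in \<open>l\<close>, and the two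
      rows compare by their likelihood ratio.\<close>
    define E where "E k = (if k \<in> Z then e k else 0)" for k
    define W where "W c l = (\<Sum>k\<le>m. E k * c (k + l))" for c :: "nat \<Rightarrow> real" and l
    have sumE: "(\<Sum>k\<in>Z. e k * h k) = (\<Sum>k\<le>m. E k * h k)" for h :: "nat \<Rightarrow> real"
      using Z(1) by (intro sum.mono_neutral_cong_left) (auto simp: E_def)
    have sumP: "sum (P c) Z = (\<Sum>l\<le>n. f l * W c l)" for c
    proof -
      have "sum (P c) Z = (\<Sum>k\<le>m. \<Sum>l\<le>n. E k * (f l * c (k + l)))"
        unfolding P_def sumE by (simp only: sum_distrib_left)
      also have "\<dots> = (\<Sum>l\<le>n. \<Sum>k\<le>m. f l * (E k * c (k + l)))"
        by (subst sum.swap) (simp only: mult.left_commute)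
      finally show ?thesis by (simp only: W_def sum_distrib_left)
    qed
    have sumM: "sum (M c) Z = (\<Sum>l\<le>n. f l * W c l * \<gamma> l)" for c
    proof -
      have "sum (M c) Z = (\<Sum>k\<le>m. \<Sum>l\<le>n. E k * (f l * c (k + l) * \<gamma> l))"
        unfolding M_def sumE by (simp only: sum_distrib_left)
      also have "\<dots> = (\<Sum>l\<le>n. \<Sum>k\<le>m. f l * (E k * c (k + l)) * \<gamma> l)"
        by (subst sum.swap) (simp only: ac_simps)
      finally show ?thesis by (simp only: W_def sum_distrib_left sum_distrib_right)
    qed
    have lcE: "log_concave E"
      unfolding log_concave_def
    proof (intro allI)
      fix i r s
      show "E (i + r + s) * E i \<le> E (i + r) * E (i + s)"
      proof (cases "i \<in> Z \<and> i + r + s \<in> Z")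
        case True
        then have "i + r \<in> Z" "i + s \<in> Z"
          using Z(2)[of i "i + r + s" "i + r"] Z(2)[of i "i + r + s" "i + s"] by auto
        then show ?thesis using True log_concaveD[OF lce] by (simp add: E_def)
      next
        case False
        then show ?thesis using e by (auto simp: E_def)
      qed
    qed
    show ?thesis
      unfolding sumP sumM
    proof (rule likelihood_ratio_mean_le)
      fix l l' :: nat assume "l < l'"
      define d where "d = l' - l"
      have l': "l' = l + d" using \<open>l < l'\<close> by (simp add: d_def)
      have "(\<Sum>k\<le>m. E k * b (k + d + l)) * (\<Sum>k\<le>m. E k * a (k + l))
          \<le> (\<Sum>k\<le>m. E k * b (k + l)) * (\<Sum>k\<le>m. E k * a (k + d + l))"
      proof (rule ratio_decreasing_correlation[where a = "\<lambda>j. a (j + l)" and b = "\<lambda>j. b (j + l)"])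
        show "b (i + r + l) * a (i + l) \<le> b (i + l) * a (i + r + l)" for i r
          using ratio[of "i + l" r] by (simp add: ac_simps)
        show "0 \<le> E i" for i using e by (simp add: E_def)
        show "E i = 0" if "m < i" for i using Z(1) that by (auto simp: E_def)
      qed (rule lcE)
      then have "W b l' * W a l \<le> W b l * W a l'"
        by (simp add: W_def l' ac_simps)
      then have "(f l * f l') * (W b l' * W a l) \<le> (f l * f l') * (W b l * W a l')"
        using f by (intro mult_left_mono) auto
      then show "f l' * W b l' * (f l * W a l) \<le> f l * W b l * (f l' * W a l')"
        by (simp add: ac_simps)
    qed (use mono\<gamma> in auto)
  qed
qed (use mono0 mono1 le in auto)

subsection \<open>Level sets of exchangeable coordinates\<close>

text \<open>With \<open>F = 1\<close> this is the elementary symmetric polynomial of degree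
  \<open>k\<close>. For positive \<open>\<kappa>\<close> and \<open>k\<close> at most
  \<open>card A\<close>, \<open>level_sum \<kappa> F A k / esym \<kappa> A k\<close> is the mean of
  \<open>F\<close> when independent points of \<open>A\<close> with odds \<open>\<kappa>\<close> are
  conditioned to have exactly \<open>k\<close> present.\<close>

definition level_sum :: "(nat \<Rightarrow> real) \<Rightarrow> (nat set \<Rightarrow> real) \<Rightarrow> nat set \<Rightarrow> nat \<Rightarrow> real" where
  "level_sum \<kappa> F A k = (\<Sum>U | U \<subseteq> A \<and> card U = k. prod \<kappa> U * F U)"

abbreviation esym :: "(nat \<Rightarrow> real) \<Rightarrow> nat set \<Rightarrow> nat \<Rightarrow> real" where
  "esym \<kappa> A \<equiv> level_sum \<kappa> (\<lambda>_. 1) A"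

lemma level_sum_0:
  assumes "finite A"
  shows "level_sum \<kappa> F A 0 = F {}"
proof -
  have "{U. U \<subseteq> A \<and> card U = 0} = {{}}"
    using finite_subset[OF _ assms] by auto
  then show ?thesis by (simp add: level_sum_def)
qed

lemma level_sum_insert_Suc:
  assumes "finite A" "i \<notin> A"
  shows "level_sum \<kappa> F (insert i A) (Suc k)
    = level_sum \<kappa> F A (Suc k) + \<kappa> i * level_sum \<kappa> (\<lambda>U. F (insert i U)) A k"
proof -
  let ?X = "{U. U \<subseteq> A \<and> card U = Suc k}" and ?Y = "{U. U \<subseteq> A \<and> card U = k}"
  have *: "finite U" "i \<notin> U" if "U \<subseteq> A" for U
    using assms that finite_subset by auto
  have split: "{U. U \<subseteq> insert i A \<and> card U = Suc k} = ?X \<union> insert i ` ?Y"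
  proof (intro set_eqI iffI)
    fix U assume U: "U \<in> {U. U \<subseteq> insert i A \<and> card U = Suc k}"
    show "U \<in> ?X \<union> insert i ` ?Y"
    proof (cases "i \<in> U")
      case True
      then have "U = insert i (U - {i})" by blast
      moreover have "card (U - {i}) = k" using U True by (simp add: card_Diff_singleton)
      moreover have "U - {i} \<subseteq> A" using U by blast
      ultimately show ?thesis by blast
    qed (use U in auto)
  next
    fix U assume "U \<in> ?X \<union> insert i ` ?Y"
    then show "U \<in> {U. U \<subseteq> insert i A \<and> card U = Suc k}" using * by auto
  qed
  have inj: "inj_on (insert i) ?Y"
    using * by (intro inj_onI) (simp add: insert_ident)
  have "level_sum \<kappa> F (insert i A) (Suc k) = (\<Sum>U\<in>?X. prod \<kappa> U * F U) + (\<Sum>U\<in>insert i ` ?Y. prod \<kappa> U * F U)"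
    unfolding level_sum_def split using assms by (intro sum.union_disjoint) auto
  also have "(\<Sum>U\<in>insert i ` ?Y. prod \<kappa> U * F U) = (\<Sum>U\<in>?Y. \<kappa> i * (prod \<kappa> U * F (insert i U)))"
    using * by (simp add: sum.reindex[OF inj] mult.assoc)
  finally show ?thesis by (simp add: level_sum_def sum_distrib_left)
qed

lemma level_sum_eq_0:
  assumes "finite A" "card A < k"
  shows "level_sum \<kappa> F A k = 0"
proof -
  have "{U. U \<subseteq> A \<and> card U = k} = {}"
    using assms(2) card_mono[OF assms(1)] by (auto simp: not_less[symmetric])
  then show ?thesis unfolding level_sum_def by (simp only: sum.empty)
qed

lemma level_sum_mono:
  assumes "\<And>i. i \<in> A \<Longrightarrow> 0 \<le> \<kappa> i" "\<And>U. U \<subseteq> A \<Longrightarrow> F U \<le> G U"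
  shows "level_sum \<kappa> F A k \<le> level_sum \<kappa> G A k"
  unfolding level_sum_def using assms by (intro sum_mono mult_left_mono prod_nonneg) auto

lemma esym_nonneg:
  assumes "\<And>i. i \<in> A \<Longrightarrow> 0 \<le> \<kappa> i"
  shows "0 \<le> esym \<kappa> A k"
  unfolding level_sum_def using assms by (intro sum_nonneg mult_nonneg_nonneg prod_nonneg) auto

lemma esym_pos:
  assumes "finite A" "\<And>i. i \<in> A \<Longrightarrow> 0 < \<kappa> i" "k \<le> card A"
  shows "0 < esym \<kappa> A k"
proof -
  obtain U where "U \<subseteq> A" "card U = k"
    using obtain_subset_with_card_n[OF assms(3)] by metis
  then show ?thesis
    unfolding level_sum_def using assms
    by (intro sum_pos mult_pos_pos prod_pos) auto
qed

lemma sum_Pow_by_level: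
  assumes "finite A"
  shows "(\<Sum>U\<in>Pow A. prod \<kappa> U * F U * c (card U)) = (\<Sum>k\<le>card A. level_sum \<kappa> F A k * c k)"
proof -
  have "(\<Sum>U\<in>Pow A. prod \<kappa> U * F U * c (card U))
      = (\<Sum>k\<le>card A. \<Sum>U | U \<in> Pow A \<and> card U = k. prod \<kappa> U * F U * c (card U))"
    using assms by (intro sum.group[symmetric]) (auto intro: card_mono)
  also have "\<dots> = (\<Sum>k\<le>card A. level_sum \<kappa> F A k * c k)"
    unfolding level_sum_def sum_distrib_right by (intro sum.cong refl) auto
  finally show ?thesis .
qed

section \<open>Log-concavity of elementary symmetric polynomials and monotone level means\<close>

text \<open>A new point multiplies the generating polynomial by \<open>1 + l * t\<close>. The
  expanded products are compared power by power in \<open>l\<close>; in the linear power the two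
  cross terms need the gap pairs \<open>(r, s - 1)\<close> at \<open>i\<close> and
  \<open>(r, s + 1)\<close> at \<open>i - 1\<close>.\<close>

lemma log_concave_esym:
  assumes "finite A" "\<And>i. i \<in> A \<Longrightarrow> 0 \<le> \<kappa> i"
  shows "log_concave (esym \<kappa> A)"
  using assms
proof (induction A)
  case empty
  have "esym \<kappa> {} k = (if k = 0 then 1 else 0)" for k
    by (simp add: level_sum_0 level_sum_eq_0)
  then show ?case by (simp add: log_concave_def)
next
  case (insert x A)
  define e where "e = esym \<kappa> A"
  define l where "l = \<kappa> x"
  define e' where "e' = esym \<kappa> (insert x A)"
  have e0: "e' 0 = e 0"
    using insert.hyps by (simp add: level_sum_0 e_def e'_def)
  have eS: "e' (Suc k) = e (Suc k) + l * e k" for k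
    using level_sum_insert_Suc[OF insert.hyps] by (simp add: e_def e'_def l_def)
  have l: "0 \<le> l" using insert.prems by (simp add: l_def)
  have lc: "e (i + r + s) * e i \<le> e (i + r) * e (i + s)" for i r s
    using insert by (intro log_concaveD) (simp add: e_def)
  have nn: "0 \<le> e k" for k using insert.prems by (simp add: e_def esym_nonneg)
  have "e' (i + r + s) * e' i \<le> e' (i + r) * e' (i + s)" for i r s
  proof (cases "r = 0 \<or> s = 0")
    case False
    then obtain r' s' where rs: "r = Suc r'" "s = Suc s'" by (meson not0_implies_Suc)
    show ?thesis
    proof (cases i)
      case 0
      have 1: "e (Suc (Suc (r' + s'))) * e 0 \<le> e (Suc r') * e (Suc s')" using lc[of 0 r s] by (simp add: rs)
      have "e (Suc (r' + s')) * e 0 \<le> e (Suc r') * e s'" using lc[of 0 r s'] by (simp add: rs)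
      then have 2: "l * (e (Suc (r' + s')) * e 0) \<le> l * (e (Suc r') * e s')" using l by (rule mult_left_mono)
      have 3: "0 \<le> l * (e r' * e (Suc s'))" "0 \<le> l * l * (e r' * e s')" using l nn by simp_all
      show ?thesis using 1 2 3 by (simp add: 0 rs e0 eS algebra_simps)
    next
      case (Suc j)
      have 1: "e (Suc (Suc (Suc (j + r' + s')))) * e (Suc j) \<le> e (Suc (Suc (j + r'))) * e (Suc (Suc (j + s')))"
        using lc[of i r s] by (simp add: rs Suc)
      have "e (Suc (Suc (j + r' + s'))) * e j \<le> e (Suc (j + r')) * e (Suc (j + s'))"
        using lc[of j r s] by (simp add: rs)
      then have 2: "(l * l) * (e (Suc (Suc (j + r' + s'))) * e j) \<le> (l * l) * (e (Suc (j + r')) * e (Suc (j + s')))"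
        using l by (intro mult_left_mono) auto
      have "e (Suc (Suc (j + r' + s'))) * e (Suc j) \<le> e (Suc (Suc (j + r'))) * e (Suc (j + s'))"
        using lc[of i r s'] by (simp add: rs Suc)
      then have 3: "l * (e (Suc (Suc (j + r' + s'))) * e (Suc j)) \<le> l * (e (Suc (Suc (j + r'))) * e (Suc (j + s')))"
        using l by (rule mult_left_mono)
      have "e (Suc (Suc (Suc (j + r' + s')))) * e j \<le> e (Suc (j + r')) * e (Suc (Suc (j + s')))"
        using lc[of j r "Suc s"] by (simp add: rs)
      then have 4: "l * (e (Suc (Suc (Suc (j + r' + s')))) * e j) \<le> l * (e (Suc (j + r')) * e (Suc (Suc (j + s'))))"
        using l by (rule mult_left_mono)
      show ?thesis using 1 2 3 4 by (simp add: rs Suc eS algebra_simps)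
    qed
  qed auto
  then show ?case by (simp add: log_concave_def e'_def)
qed

text \<open>This is Efron's monotonicity for independent Bernoulli points: the mean of an increasing
  function, given how many points are present, grows with that number. It is multiplied out so that
  \<open>\<kappa>\<close> may vanish. The induction splits by the presence of a new point; the
  constant and quadratic coefficients in \<open>l\<close> come from the induction hypothesis, the
  linear one is \<open>mixed\<close>.\<close>

lemma level_sum_mean_step:
  assumes "finite A" "\<And>i. i \<in> A \<Longrightarrow> 0 \<le> \<kappa> i" "mono_on (Pow A) F"
  shows "level_sum \<kappa> F A k * esym \<kappa> A (Suc k) \<le> level_sum \<kappa> F A (Suc k) * esym \<kappa> A k"
  using assms
proof (induction A arbitrary: F k)
  case empty
  then show ?case by (simp add: level_sum_eq_0)
next
  case (insert x A)
  define e where "e = esym \<kappa> A"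
  define l where "l = \<kappa> x"
  define N0 where "N0 = level_sum \<kappa> F A"
  define N1 where "N1 = level_sum \<kappa> (\<lambda>U. F (insert x U)) A"
  have l: "0 \<le> l" and \<kappa>: "\<And>i. i \<in> A \<Longrightarrow> 0 \<le> \<kappa> i"
    using insert.prems by (simp_all add: l_def)
  have e: "0 \<le> e j" for j using \<kappa> by (simp add: e_def esym_nonneg)
  have "mono_on (Pow A) F" "mono_on (Pow A) (\<lambda>U. F (insert x U))"
    using insert.prems(2) by (auto intro!: mono_onI elim!: mono_onD)
  then have IH: "N0 j * e (Suc j) \<le> N0 (Suc j) * e j" "N1 j * e (Suc j) \<le> N1 (Suc j) * e j" for j
    using insert.IH \<kappa> by (auto simp: N0_def N1_def e_def)
  have N01: "N0 j \<le> N1 j" for j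
    unfolding N0_def N1_def using \<kappa> insert.prems(2)
    by (intro level_sum_mono) (auto elim!: mono_onD)
  have abs: "N0 j = 0" "N1 j = 0" if "e j = 0" for j
  proof -
    have "prod \<kappa> U = 0" if "U \<in> {U. U \<subseteq> A \<and> card U = j}" for U
    proof (rule sum_nonneg_0[of "{U. U \<subseteq> A \<and> card U = j}" "prod \<kappa>" U])
      show "(\<Sum>U | U \<subseteq> A \<and> card U = j. prod \<kappa> U) = 0"
        using \<open>e j = 0\<close> by (simp add: e_def level_sum_def)
    qed (use that \<kappa> insert.hyps in \<open>auto intro!: prod_nonneg\<close>)
    then show "N0 j = 0" "N1 j = 0"
      unfolding N0_def N1_def level_sum_def by (auto intro!: sum.neutral)
  qed
  have eS: "esym \<kappa> (insert x A) (Suc k) = e (Suc k) + l * e k" for k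
    using level_sum_insert_Suc[OF insert.hyps] by (simp add: e_def l_def)
  have NS: "level_sum \<kappa> F (insert x A) (Suc k) = N0 (Suc k) + l * N1 k" for k
    using level_sum_insert_Suc[OF insert.hyps] by (simp add: N0_def N1_def l_def)
  have z: "esym \<kappa> (insert x A) 0 = e 0" "level_sum \<kappa> F (insert x A) 0 = N0 0" "e 0 = 1"
    using insert.hyps by (simp_all add: level_sum_0 e_def N0_def)
  show ?case
  proof (cases k)
    case 0
    have "l * N0 0 \<le> l * N1 0" using N01 l by (rule mult_left_mono)
    then show ?thesis using IH(1)[of 0] by (simp add: 0 eS NS z(1,2) z(3) algebra_simps)
  next
    case (Suc j)
    have mixed: "N0 (Suc j) * e (Suc j) + N1 j * e (Suc (Suc j))
        \<le> N0 (Suc (Suc j)) * e j + N1 (Suc j) * e (Suc j)"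
    proof (cases "e j = 0 \<or> e (Suc (Suc j)) = 0")
      case True
      have "N0 (Suc j) * e (Suc j) \<le> N1 (Suc j) * e (Suc j)" using N01 e by (rule mult_right_mono)
      then show ?thesis using True abs by auto
    next
      case False
      \<comment> \<open>Written with the means \<open>p\<close>, \<open>q\<close>,
        \<open>p'\<close>, \<open>q'\<close> of the four level sums, the claim is
        \<open>w * x * (q - p') \<le> y * y * (q' - p)\<close>. It follows from
        \<open>w * x \<le> y * y\<close>, \<open>q - p' \<le> q' - p\<close> and
        \<open>p \<le> q'\<close>.\<close>
      define x where "x = e j" define y where "y = e (Suc j)" define w where "w = e (Suc (Suc j))"
      have xw: "0 < x" "0 < w" using False e by (auto simp: x_def w_def order_less_le)
      have "log_concave e"
        unfolding e_def using insert.hyps(1) \<kappa> by (rule log_concave_esym)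
      then have lc: "w * x \<le> y * y"
        using log_concaveD[of e j 1 1] by (simp add: x_def y_def w_def)
      have "0 < w * x" using xw by simp
      then have "y \<noteq> 0" using lc by auto
      then have y: "0 < y" using e by (simp add: y_def order_less_le)
      define p where "p = N0 (Suc j) / y" define q where "q = N1 j / x"
      define p' where "p' = N0 (Suc (Suc j)) / w" define q' where "q' = N1 (Suc j) / y"
      have N: "N0 (Suc j) = p * y" "N1 j = q * x" "N0 (Suc (Suc j)) = p' * w" "N1 (Suc j) = q' * y"
        using xw y by (simp_all add: p_def q_def p'_def q'_def)
      have "p \<le> p'" "q \<le> q'" "p \<le> q'"
        using IH(1)[of "Suc j"] IH(2)[of j] N01[of "Suc j"] xw y
        by (simp_all add: p_def q_def p'_def q'_def x_def y_def w_def field_simps)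
      then have "(w * x) * (q' - p) \<le> (y * y) * (q' - p)" "(w * x) * (q - p') \<le> (w * x) * (q' - p)"
        using lc xw by (auto intro!: mult_right_mono mult_left_mono)
      then show ?thesis
        unfolding N by (simp add: x_def y_def w_def algebra_simps)
    qed
    have "l * (N0 (Suc j) * e (Suc j) + N1 j * e (Suc (Suc j)))
        \<le> l * (N0 (Suc (Suc j)) * e j + N1 (Suc j) * e (Suc j))"
      using mixed l by (rule mult_left_mono)
    moreover have "(l * l) * (N1 j * e (Suc j)) \<le> (l * l) * (N1 (Suc j) * e j)"
      using IH(2) l by (intro mult_left_mono) auto
    ultimately show ?thesis
      using IH(1)[of "Suc j"] unfolding Suc eS NS by (simp add: algebra_simps)
  qed
qed

lemma level_mean_mono:
  assumes "finite A" "\<And>i. i \<in> A \<Longrightarrow> 0 < \<kappa> i" "mono_on (Pow A) F"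
    and "k \<le> k'" "k' \<le> card A"
  shows "level_sum \<kappa> F A k / esym \<kappa> A k \<le> level_sum \<kappa> F A k' / esym \<kappa> A k'"
  using assms(4,5)
proof (induction k' rule: dec_induct)
  case (step n)
  have pos: "0 < esym \<kappa> A n" "0 < esym \<kappa> A (Suc n)"
    using assms(1,2) step.prems by (auto intro!: esym_pos)
  have "level_sum \<kappa> F A n * esym \<kappa> A (Suc n) \<le> level_sum \<kappa> F A (Suc n) * esym \<kappa> A n"
    using assms(1-3) by (intro level_sum_mean_step) (auto intro: less_imp_le)
  then have "level_sum \<kappa> F A n / esym \<kappa> A n \<le> level_sum \<kappa> F A (Suc n) / esym \<kappa> A (Suc n)"
    using pos by (simp add: field_simps)
  with step show ?case by simp
qed simp

subsection \<open>Negative association of weights\<close>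

definition NA_weight :: "nat set \<Rightarrow> (nat set \<Rightarrow> real) \<Rightarrow> bool" where
  "NA_weight I w \<longleftrightarrow>
     (\<forall>F G A B. A \<subseteq> I \<and> B \<subseteq> I \<and> A \<inter> B = {}
        \<and> mono_on (Pow I) F \<and> mono_on (Pow I) G
        \<and> depends_only_on I F A \<and> depends_only_on I G B
      \<longrightarrow> (\<Sum>S\<in>Pow I. w S * (F S * G S)) * (\<Sum>S\<in>Pow I. w S)
            \<le> (\<Sum>S\<in>Pow I. w S * F S) * (\<Sum>S\<in>Pow I. w S * G S))"

lemma depends_only_onD:
  "depends_only_on I F A \<Longrightarrow> S \<subseteq> I \<Longrightarrow> T \<subseteq> I \<Longrightarrow> S \<inter> A = T \<inter> A \<Longrightarrow> F S = F T"
  unfolding depends_only_on_def by blast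

lemma NA_weightD:
  assumes "NA_weight I w" "A \<subseteq> I" "B \<subseteq> I" "A \<inter> B = {}"
    "mono_on (Pow I) F" "mono_on (Pow I) G" "depends_only_on I F A" "depends_only_on I G B"
  shows "(\<Sum>S\<in>Pow I. w S * (F S * G S)) * (\<Sum>S\<in>Pow I. w S)
            \<le> (\<Sum>S\<in>Pow I. w S * F S) * (\<Sum>S\<in>Pow I. w S * G S)"
  using assms unfolding NA_weight_def by blast

lemma NA_weightI:
  assumes "\<And>F G A B. \<lbrakk>A \<subseteq> I; B \<subseteq> I; A \<inter> B = {}; mono_on (Pow I) F; mono_on (Pow I) G;
      depends_only_on I F A; depends_only_on I G B\<rbrakk>
    \<Longrightarrow> (\<Sum>S\<in>Pow I. w S * (F S * G S)) * (\<Sum>S\<in>Pow I. w S)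
            \<le> (\<Sum>S\<in>Pow I. w S * F S) * (\<Sum>S\<in>Pow I. w S * G S)"
  shows "NA_weight I w"
  using assms unfolding NA_weight_def by blast

text \<open>The inequality is symmetric in the two functions and \<open>A\<close>, \<open>B\<close>
  are disjoint, so exchanging the roles puts \<open>k\<close> outside \<open>B\<close>.\<close>

lemma NA_weightI_avoid:
  assumes "\<And>F G A B. \<lbrakk>A \<subseteq> I; B \<subseteq> I; A \<inter> B = {}; k \<notin> B; mono_on (Pow I) F; mono_on (Pow I) G;
      depends_only_on I F A; depends_only_on I G B\<rbrakk>
    \<Longrightarrow> (\<Sum>S\<in>Pow I. w S * (F S * G S)) * (\<Sum>S\<in>Pow I. w S)
            \<le> (\<Sum>S\<in>Pow I. w S * F S) * (\<Sum>S\<in>Pow I. w S * G S)"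
  shows "NA_weight I w"
proof (rule NA_weightI)
  fix F G A B
  assume *: "A \<subseteq> I" "B \<subseteq> I" "A \<inter> B = {}" "mono_on (Pow I) F" "mono_on (Pow I) G"
    "depends_only_on I F A" "depends_only_on I G B"
  show "(\<Sum>S\<in>Pow I. w S * (F S * G S)) * (\<Sum>S\<in>Pow I. w S)
            \<le> (\<Sum>S\<in>Pow I. w S * F S) * (\<Sum>S\<in>Pow I. w S * G S)"
  proof (cases "k \<in> B")
    case False
    then show ?thesis using * by (intro assms) 
  next
    case True
    then have "k \<notin> A" using * by blast
    moreover have "B \<inter> A = {}" using * by blast
    ultimately show ?thesis using assms[of B A G F] * by (simp add: mult.commute)
  qed
qed

lemma NA_weight_cong:
  assumes "\<And>S. S \<subseteq> I \<Longrightarrow> w S = w' S"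
  shows "NA_weight I w \<longleftrightarrow> NA_weight I w'"
proof -
  have "(\<Sum>S\<in>Pow I. w S * h S) = (\<Sum>S\<in>Pow I. w' S * h S)" "sum w (Pow I) = sum w' (Pow I)" for h
    using assms by (auto intro!: sum.cong)
  then show ?thesis by (simp add: NA_weight_def)
qed

lemma NA_weight_transfer:
  "NA_weight I w \<Longrightarrow> (\<And>S. S \<subseteq> I \<Longrightarrow> w' S = w S) \<Longrightarrow> NA_weight I w'"
  using NA_weight_cong[of I w' w] by blast

lemma NA_weight_scale:
  assumes "NA_weight I w"
  shows "NA_weight I (\<lambda>S. c * w S)"
proof (rule NA_weightI)
  fix F G A B
  assume "A \<subseteq> I" "B \<subseteq> I" "A \<inter> B = {}" "mono_on (Pow I) F" "mono_on (Pow I) G"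
    "depends_only_on I F A" "depends_only_on I G B"
  from NA_weightD[OF assms this]
  have "c^2 * ((\<Sum>S\<in>Pow I. w S * (F S * G S)) * (\<Sum>S\<in>Pow I. w S))
            \<le> c^2 * ((\<Sum>S\<in>Pow I. w S * F S) * (\<Sum>S\<in>Pow I. w S * G S))"
    by (intro mult_left_mono) auto
  then show "(\<Sum>S\<in>Pow I. c * w S * (F S * G S)) * (\<Sum>S\<in>Pow I. c * w S)
            \<le> (\<Sum>S\<in>Pow I. c * w S * F S) * (\<Sum>S\<in>Pow I. c * w S * G S)"
    by (simp add: mult.assoc power2_eq_square mult.left_commute flip: sum_distrib_left)
qed

lemma sum_Pow_Un:
  fixes h :: "'a set \<Rightarrow> real"
  assumes "X \<inter> Y = {}"
  shows "(\<Sum>S\<in>Pow (X \<union> Y). h S) = (\<Sum>U\<in>Pow X. \<Sum>V\<in>Pow Y. h (U \<union> V))"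
proof -
  have "(\<Sum>S\<in>Pow (X \<union> Y). h S) = (\<Sum>(U, V)\<in>Pow X \<times> Pow Y. h (U \<union> V))"
  proof (rule sum.reindex_bij_witness[where i = "\<lambda>(U, V). U \<union> V" and j = "\<lambda>S. (S \<inter> X, S \<inter> Y)"])
    fix S assume "S \<in> Pow (X \<union> Y)"
    then have "S \<inter> X \<union> S \<inter> Y = S" by blast
    then show "(case (S \<inter> X, S \<inter> Y) of (U, V) \<Rightarrow> U \<union> V) = S"
      "(case (S \<inter> X, S \<inter> Y) of (U, V) \<Rightarrow> h (U \<union> V)) = h S" by simp_all
  qed (use assms in auto)
  then show ?thesis by (simp add: sum.cartesian_product)
qed

text \<open>Increasing functions on \<open>Pow I\<close> pull back along intersection with
  \<open>I\<close> to increasing functions on \<open>Pow J\<close> that depend on the same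
  coordinates.\<close>

lemma NA_weight_projection:
  assumes J: "I \<subseteq> J" and NA: "NA_weight J w"
  shows "NA_weight I (\<lambda>S. \<Sum>V\<in>Pow (J - I). w (S \<union> V))"
proof (rule NA_weightI)
  fix F G :: "nat set \<Rightarrow> real" and A B
  assume *: "A \<subseteq> I" "B \<subseteq> I" "A \<inter> B = {}" "mono_on (Pow I) F" "mono_on (Pow I) G"
    "depends_only_on I F A" "depends_only_on I G B"
  have JI: "J = I \<union> (J - I)" using J by blast
  have eq: "(\<Sum>S\<in>Pow I. (\<Sum>V\<in>Pow (J - I). w (S \<union> V)) * h S) = (\<Sum>S\<in>Pow J. w S * h (S \<inter> I))" for h
  proof -
    have "(\<Sum>S\<in>Pow J. w S * h (S \<inter> I)) = (\<Sum>S\<in>Pow (I \<union> (J - I)). w S * h (S \<inter> I))"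
      using JI by simp
    also have "\<dots> = (\<Sum>S\<in>Pow I. \<Sum>V\<in>Pow (J - I). w (S \<union> V) * h ((S \<union> V) \<inter> I))"
      by (rule sum_Pow_Un) blast
    also have "\<dots> = (\<Sum>S\<in>Pow I. \<Sum>V\<in>Pow (J - I). w (S \<union> V) * h S)"
    proof (intro sum.cong refl)
      fix S V assume "S \<in> Pow I" "V \<in> Pow (J - I)"
      then have "(S \<union> V) \<inter> I = S" by blast
      then show "w (S \<union> V) * h ((S \<union> V) \<inter> I) = w (S \<union> V) * h S" by simp
    qed
    finally show ?thesis by (simp add: sum_distrib_right)
  qed
  have mono: "mono_on (Pow J) (\<lambda>S. h (S \<inter> I))" if "mono_on (Pow I) h" for h :: "nat set \<Rightarrow> real"
    using that by (intro mono_onI) (auto elim!: mono_onD)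
  have dep: "depends_only_on J (\<lambda>S. h (S \<inter> I)) X" if "depends_only_on I h X" "X \<subseteq> I" for h X
    unfolding depends_only_on_def
  proof (intro ballI impI)
    fix S T assume "S \<inter> X = T \<inter> X"
    then have "(S \<inter> I) \<inter> X = (T \<inter> I) \<inter> X" using that(2) by blast
    then show "h (S \<inter> I) = h (T \<inter> I)" using that(1) unfolding depends_only_on_def by blast
  qed
  have "(\<Sum>S\<in>Pow J. w S * (F (S \<inter> I) * G (S \<inter> I))) * (\<Sum>S\<in>Pow J. w S)
        \<le> (\<Sum>S\<in>Pow J. w S * F (S \<inter> I)) * (\<Sum>S\<in>Pow J. w S * G (S \<inter> I))"
    by (rule NA_weightD[OF NA, of A B]) (use * J in \<open>auto intro!: mono dep\<close>)
  then show "(\<Sum>S\<in>Pow I. (\<Sum>V\<in>Pow (J - I). w (S \<union> V)) * (F S * G S)) * (\<Sum>S\<in>Pow I. \<Sum>V\<in>Pow (J - I). w (S \<union> V))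
    \<le> (\<Sum>S\<in>Pow I. (\<Sum>V\<in>Pow (J - I). w (S \<union> V)) * F S) * (\<Sum>S\<in>Pow I. (\<Sum>V\<in>Pow (J - I). w (S \<union> V)) * G S)"
    using eq[of "\<lambda>_. 1"] by (simp add: eq)
qed

text \<open>Both sides are continuous in the values of the weight. This is what brings in external
  fields with zero entries.\<close>

lemma NA_weight_limit:
  assumes NA: "\<And>s. 0 < s \<Longrightarrow> NA_weight I (w s)"
    and lim: "\<And>S. S \<subseteq> I \<Longrightarrow> ((\<lambda>s :: real. w s S) \<longlongrightarrow> w0 S) (at_right 0)"
  shows "NA_weight I w0"
proof (rule NA_weightI)
  fix F G A B
  assume *: "A \<subseteq> I" "B \<subseteq> I" "A \<inter> B = {}" "mono_on (Pow I) F" "mono_on (Pow I) G"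
    "depends_only_on I F A" "depends_only_on I G B"
  let ?l = "\<lambda>w. (\<Sum>S\<in>Pow I. w S * (F S * G S)) * (\<Sum>S\<in>Pow I. w S)"
  let ?r = "\<lambda>w. (\<Sum>S\<in>Pow I. w S * F S) * (\<Sum>S\<in>Pow I. w S * G S)"
  show "?l w0 \<le> ?r w0"
  proof (rule tendsto_le)
    show "((\<lambda>s. ?r (w s)) \<longlongrightarrow> ?r w0) (at_right 0)" "((\<lambda>s. ?l (w s)) \<longlongrightarrow> ?l w0) (at_right 0)"
      by (intro tendsto_intros lim; simp)+
    show "\<forall>\<^sub>F s in at_right 0. ?l (w s) \<le> ?r (w s)"
      using NA_weightD[OF NA *] by (auto simp: eventually_at_right_field intro!: exI[of _ 1])
  qed simp
qed

section \<open>Negative association of two-row weights\<close>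

text \<open>Within the two groups of exchangeable coordinates the weight sees a set only through a
  product and a cardinality. All four sums therefore collapse to sums over level sizes, where the
  two-row inequality applies. Positive \<open>\<kappa>\<close> makes every level weight positive, so
  that the level means exist.\<close>

lemma NA_weight_two_row_pos:
  assumes fin: "finite I" and k: "k \<in> I" and \<kappa>: "\<And>i. i \<in> I - {k} \<Longrightarrow> 0 < \<kappa> i"
    and a: "\<And>j. 0 \<le> a j" and b: "\<And>j. 0 \<le> b j"
    and lc: "log_concave (\<lambda>j. a j + b j)"
    and ratio: "\<And>i r. b (i + r) * a i \<le> b i * a (i + r)"
  shows "NA_weight I (\<lambda>S. prod \<kappa> (S - {k}) * (if k \<in> S then b else a) (card (S - {k})))"
    (is "NA_weight I ?w")
proof (rule NA_weightI_avoid[where k = k])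
  fix F G :: "nat set \<Rightarrow> real" and A B
  assume *: "A \<subseteq> I" "B \<subseteq> I" "A \<inter> B = {}" and kB: "k \<notin> B"
    and mono: "mono_on (Pow I) F" "mono_on (Pow I) G"
    and dep: "depends_only_on I F A" "depends_only_on I G B"
  \<comment> \<open>Every coordinate outside \<open>B\<close> other than \<open>k\<close> goes to
    the side of \<open>F\<close>, even if \<open>F\<close> ignores it, so that \<open>A'\<close>,
    \<open>B\<close> and \<open>k\<close> exhaust \<open>I\<close>.\<close>
  define A' where "A' = I - B - {k}"
  have I: "I = {k} \<union> (A' \<union> B)" using * k by (auto simp: A'_def)
  have finAB: "finite A'" "finite B" and disj: "A' \<inter> B = {}" and kA: "k \<notin> A'"
    using fin * finite_subset by (auto simp: A'_def)
  have sub: "A' \<subseteq> I" "B \<subseteq> I" using * by (auto simp: A'_def)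
  define m where "m = card A'"
  define n where "n = card B"
  define F1 where "F1 U = F (insert k U)" for U
  have sumI: "(\<Sum>S\<in>Pow I. h S) = (\<Sum>U\<in>Pow A'. \<Sum>T\<in>Pow B. h (U \<union> T) + h (insert k (U \<union> T)))" for h :: "nat set \<Rightarrow> real"
  proof -
    have "(\<Sum>S\<in>Pow I. h S) = (\<Sum>V\<in>Pow {k}. \<Sum>S\<in>Pow (A' \<union> B). h (V \<union> S))"
      unfolding I using kA kB by (intro sum_Pow_Un) auto
    also have "\<dots> = (\<Sum>S\<in>Pow (A' \<union> B). h S + h (insert k S))"
      by (simp add: Pow_insert sum.distrib)
    also have "\<dots> = (\<Sum>U\<in>Pow A'. \<Sum>T\<in>Pow B. h (U \<union> T) + h (insert k (U \<union> T)))"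
      by (rule sum_Pow_Un[OF disj])
    finally show ?thesis .
  qed
  have parts: "F (U \<union> T) = F U" "F (insert k (U \<union> T)) = F1 U"
    "G (U \<union> T) = G T" "G (insert k (U \<union> T)) = G T"
    "?w (U \<union> T) = prod \<kappa> U * prod \<kappa> T * a (card U + card T)"
    "?w (insert k (U \<union> T)) = prod \<kappa> U * prod \<kappa> T * b (card U + card T)"
    if "U \<subseteq> A'" "T \<subseteq> B" for U T
  proof -
    have fUT: "finite U" "finite T" "U \<inter> T = {}" "k \<notin> U \<union> T"
      using that finAB finite_subset disj kA kB by (blast, blast, blast, blast)
    have "(U \<union> T) \<inter> A = U \<inter> A" "insert k (U \<union> T) \<inter> A = insert k U \<inter> A"
      using that * by blast+
    then show "F (U \<union> T) = F U" "F (insert k (U \<union> T)) = F1 U"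
      unfolding F1_def using that sub k by (auto intro!: depends_only_onD[OF dep(1)])
    have "(U \<union> T) \<inter> B = T \<inter> B" "insert k (U \<union> T) \<inter> B = T \<inter> B"
      using that kB disj by blast+
    then show "G (U \<union> T) = G T" "G (insert k (U \<union> T)) = G T"
      using that sub k by (auto intro!: depends_only_onD[OF dep(2)])
    have "prod \<kappa> (U \<union> T) = prod \<kappa> U * prod \<kappa> T" "card (U \<union> T) = card U + card T"
      using fUT by (simp_all add: prod.union_disjoint card_Un_disjoint)
    moreover have "U \<union> T - {k} = U \<union> T" "insert k (U \<union> T) - {k} = U \<union> T" using fUT by auto
    ultimately show "?w (U \<union> T) = prod \<kappa> U * prod \<kappa> T * a (card U + card T)"
      "?w (insert k (U \<union> T)) = prod \<kappa> U * prod \<kappa> T * b (card U + card T)"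
      using fUT by simp_all
  qed
  \<comment> \<open>One row at a time: \<open>c\<close> depends only on
    \<open>card U + card T\<close>, so the sum over pairs of sets factors through the level sums of
    \<open>X\<close> and \<open>Y\<close>.\<close>
  have one: "(\<Sum>U\<in>Pow A'. \<Sum>T\<in>Pow B. prod \<kappa> U * prod \<kappa> T * c (card U + card T) * (X U * Y T))
      = (\<Sum>i\<le>m. \<Sum>j\<le>n. level_sum \<kappa> X A' i * level_sum \<kappa> Y B j * c (i + j))" for c and X Y :: "nat set \<Rightarrow> real"
  proof -
    have "(\<Sum>T\<in>Pow B. prod \<kappa> U * prod \<kappa> T * c (card U + card T) * (X U * Y T))
        = prod \<kappa> U * X U * (\<Sum>j\<le>n. level_sum \<kappa> Y B j * c (card U + j))" for U
      unfolding n_def sum_Pow_by_level[OF finAB(2), symmetric] sum_distrib_left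
      by (simp add: ac_simps)
    then have "(\<Sum>U\<in>Pow A'. \<Sum>T\<in>Pow B. prod \<kappa> U * prod \<kappa> T * c (card U + card T) * (X U * Y T))
        = (\<Sum>U\<in>Pow A'. prod \<kappa> U * X U * (\<Sum>j\<le>n. level_sum \<kappa> Y B j * c (card U + j)))"
      by simp
    also have "\<dots> = (\<Sum>i\<le>m. level_sum \<kappa> X A' i * (\<Sum>j\<le>n. level_sum \<kappa> Y B j * c (i + j)))"
      unfolding m_def by (rule sum_Pow_by_level[OF finAB(1)])
    finally show ?thesis by (simp add: sum_distrib_left mult.assoc)
  qed
  define e where "e = esym \<kappa> A'"
  define f where "f = esym \<kappa> B"
  define \<phi>0 where "\<phi>0 i = level_sum \<kappa> F A' i / e i" for i
  define \<phi>1 where "\<phi>1 i = level_sum \<kappa> F1 A' i / e i" for i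
  define \<gamma> where "\<gamma> j = level_sum \<kappa> G B j / f j" for j
  have \<kappa>AB: "0 < \<kappa> i" if "i \<in> A' \<or> i \<in> B" for i
    using that \<kappa> kA kB * by (auto simp: A'_def)
  have epos: "0 < e i" if "i \<le> m" for i
    using finAB \<kappa>AB that by (simp add: e_def m_def esym_pos)
  have fpos: "0 < f j" if "j \<le> n" for j
    using finAB \<kappa>AB that by (simp add: f_def n_def esym_pos)
  have lev: "level_sum \<kappa> F A' i = e i * \<phi>0 i" "level_sum \<kappa> F1 A' i = e i * \<phi>1 i" if "i \<le> m" for i
    using epos[OF that] by (simp_all add: \<phi>0_def \<phi>1_def)
  have levG: "level_sum \<kappa> G B j = f j * \<gamma> j" if "j \<le> n" for j
    using fpos[OF that] by (simp add: \<gamma>_def)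
  have monoF: "mono_on (Pow A') F" "mono_on (Pow A') F1" "mono_on (Pow B) G"
  proof -
    show "mono_on (Pow A') F" "mono_on (Pow B) G"
      using mono sub by (auto intro: mono_on_subset)
    show "mono_on (Pow A') F1"
    proof (rule mono_onI)
      fix U V assume "U \<in> Pow A'" "V \<in> Pow A'" "U \<subseteq> V"
      then show "F1 U \<le> F1 V"
        unfolding F1_def using sub k by (intro mono_onD[OF mono(1)]) auto
    qed
  qed
  define P where "P c i = e i * (\<Sum>j\<le>n. f j * c (i + j))" for c :: "nat \<Rightarrow> real" and i
  define M where "M c i = e i * (\<Sum>j\<le>n. f j * c (i + j) * \<gamma> j)" for c :: "nat \<Rightarrow> real" and i
  have main: "(\<Sum>i\<le>m. M a i * \<phi>0 i + M b i * \<phi>1 i) * (\<Sum>i\<le>m. P a i + P b i)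
       \<le> (\<Sum>i\<le>m. P a i * \<phi>0 i + P b i * \<phi>1 i) * (\<Sum>i\<le>m. M a i + M b i)"
    unfolding P_def M_def
  proof (rule two_row_neg_correlation[OF a b lc ratio])
    show "0 \<le> e i" "0 \<le> f i" for i
      using \<kappa>AB by (auto simp: e_def f_def less_imp_le intro!: esym_nonneg)
    show "log_concave e"
      unfolding e_def using finAB(1) \<kappa>AB by (intro log_concave_esym) (auto simp: less_imp_le)
    show "\<phi>0 i \<le> \<phi>0 j" "\<phi>1 i \<le> \<phi>1 j" if "i \<le> j" "j \<le> m" for i j
      unfolding \<phi>0_def \<phi>1_def e_def using that finAB \<kappa>AB monoF
      by (auto simp: m_def intro!: level_mean_mono)
    show "\<gamma> i \<le> \<gamma> j" if "i \<le> j" "j \<le> n" for i j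
      unfolding \<gamma>_def f_def using that finAB \<kappa>AB monoF
      by (auto simp: n_def intro!: level_mean_mono)
    show "\<phi>0 i \<le> \<phi>1 i" if "i \<le> m" for i
    proof -
      have "level_sum \<kappa> F A' i \<le> level_sum \<kappa> F1 A' i"
      proof (rule level_sum_mono)
        show "F U \<le> F1 U" if "U \<subseteq> A'" for U
          unfolding F1_def by (rule mono_onD[OF mono(1)]) (use that sub k in auto)
      qed (use \<kappa>AB in \<open>auto simp: less_imp_le\<close>)
      then show ?thesis
        unfolding \<phi>0_def \<phi>1_def using epos[OF that] by (intro divide_right_mono) auto
    qed
  qed
  have s1: "(\<Sum>S\<in>Pow I. ?w S * (F S * G S)) = (\<Sum>i\<le>m. M a i * \<phi>0 i + M b i * \<phi>1 i)"
  proof -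
    have "(\<Sum>S\<in>Pow I. ?w S * (F S * G S)) = (\<Sum>U\<in>Pow A'. \<Sum>T\<in>Pow B.
        prod \<kappa> U * prod \<kappa> T * a (card U + card T) * (F U * G T)
        + prod \<kappa> U * prod \<kappa> T * b (card U + card T) * (F1 U * G T))"
      unfolding sumI by (intro sum.cong refl) (simp only: parts Pow_iff)
    also have "\<dots> = (\<Sum>i\<le>m. M a i * \<phi>0 i + M b i * \<phi>1 i)"
      unfolding sum.distrib one by (simp add: lev levG M_def sum_distrib_left sum_distrib_right ac_simps)
    finally show ?thesis .
  qed
  have s2: "(\<Sum>S\<in>Pow I. ?w S) = (\<Sum>i\<le>m. P a i + P b i)"
  proof -
    have "(\<Sum>S\<in>Pow I. ?w S) = (\<Sum>U\<in>Pow A'. \<Sum>T\<in>Pow B.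
        prod \<kappa> U * prod \<kappa> T * a (card U + card T) * (1 * 1)
        + prod \<kappa> U * prod \<kappa> T * b (card U + card T) * (1 * 1))"
      unfolding sumI by (intro sum.cong refl) (simp only: parts Pow_iff mult_1_right)
    also have "\<dots> = (\<Sum>i\<le>m. P a i + P b i)"
      unfolding sum.distrib one[of _ "\<lambda>_. 1" "\<lambda>_. 1"]
      by (simp add: P_def sum_distrib_left mult.assoc flip: e_def f_def)
    finally show ?thesis .
  qed
  have s3: "(\<Sum>S\<in>Pow I. ?w S * F S) = (\<Sum>i\<le>m. P a i * \<phi>0 i + P b i * \<phi>1 i)"
  proof -
    have "(\<Sum>S\<in>Pow I. ?w S * F S) = (\<Sum>U\<in>Pow A'. \<Sum>T\<in>Pow B.
        prod \<kappa> U * prod \<kappa> T * a (card U + card T) * (F U * 1)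
        + prod \<kappa> U * prod \<kappa> T * b (card U + card T) * (F1 U * 1))"
      unfolding sumI by (intro sum.cong refl) (simp only: parts Pow_iff mult_1_right)
    also have "\<dots> = (\<Sum>i\<le>m. P a i * \<phi>0 i + P b i * \<phi>1 i)"
      unfolding sum.distrib one[of _ _ "\<lambda>_. 1"]
      by (simp add: lev P_def sum_distrib_left sum_distrib_right ac_simps flip: f_def)
    finally show ?thesis .
  qed
  have s4: "(\<Sum>S\<in>Pow I. ?w S * G S) = (\<Sum>i\<le>m. M a i + M b i)"
  proof -
    have "(\<Sum>S\<in>Pow I. ?w S * G S) = (\<Sum>U\<in>Pow A'. \<Sum>T\<in>Pow B.
        prod \<kappa> U * prod \<kappa> T * a (card U + card T) * (1 * G T)
        + prod \<kappa> U * prod \<kappa> T * b (card U + card T) * (1 * G T))"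
      unfolding sumI by (intro sum.cong refl) (simp only: parts Pow_iff mult_1)
    also have "\<dots> = (\<Sum>i\<le>m. M a i + M b i)"
      unfolding sum.distrib one[of _ "\<lambda>_. 1"]
      by (simp add: levG M_def sum_distrib_left ac_simps flip: e_def)
    finally show ?thesis .
  qed
  show "(\<Sum>S\<in>Pow I. ?w S * (F S * G S)) * (\<Sum>S\<in>Pow I. ?w S)
        \<le> (\<Sum>S\<in>Pow I. ?w S * F S) * (\<Sum>S\<in>Pow I. ?w S * G S)"
    unfolding s1 s2 s3 s4 by (rule main)
qed

text \<open>Add \<open>s > 0\<close> to every entry of \<open>\<kappa>\<close> and let
  \<open>s\<close> tend to 0.\<close>

lemma NA_weight_two_row:
  assumes fin: "finite I" and k: "k \<in> I" and \<kappa>: "\<And>i. i \<in> I - {k} \<Longrightarrow> 0 \<le> \<kappa> i"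
    and a: "\<And>j. 0 \<le> a j" and b: "\<And>j. 0 \<le> b j"
    and lc: "log_concave (\<lambda>j. a j + b j)"
    and ratio: "\<And>i r. b (i + r) * a i \<le> b i * a (i + r)"
  shows "NA_weight I (\<lambda>S. prod \<kappa> (S - {k}) * (if k \<in> S then b else a) (card (S - {k})))"
proof (rule NA_weight_limit)
  fix s :: real assume "0 < s"
  then show "NA_weight I (\<lambda>S. prod (\<lambda>i. \<kappa> i + s) (S - {k}) * (if k \<in> S then b else a) (card (S - {k})))"
    using \<kappa> by (intro NA_weight_two_row_pos[OF fin k _ a b lc ratio]) (auto intro: add_nonneg_pos)
next
  fix S
  have "((\<lambda>s. prod (\<lambda>i. \<kappa> i + s) (S - {k})) \<longlongrightarrow> prod (\<lambda>i. \<kappa> i + 0) (S - {k})) (at_right 0)"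
    by (intro tendsto_prod tendsto_add tendsto_const tendsto_ident_at)
  then show "((\<lambda>s. prod (\<lambda>i. \<kappa> i + s) (S - {k}) * (if k \<in> S then b else a) (card (S - {k})))
      \<longlongrightarrow> prod \<kappa> (S - {k}) * (if k \<in> S then b else a) (card (S - {k}))) (at_right 0)"
    by (intro tendsto_mult_right) simp
qed

subsection \<open>Negative lattice condition for weights\<close>

definition NLC_weight :: "nat set \<Rightarrow> (nat set \<Rightarrow> real) \<Rightarrow> bool" where
  "NLC_weight I w \<longleftrightarrow> (\<forall>S T. S \<subseteq> I \<longrightarrow> T \<subseteq> I \<longrightarrow> w (S \<union> T) * w (S \<inter> T) \<le> w S * w T)"

definition h_NLC_weight :: "nat set \<Rightarrow> (nat set \<Rightarrow> real) \<Rightarrow> bool" where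
  "h_NLC_weight I w \<longleftrightarrow> (\<forall>A\<subseteq>I. NLC_weight A (\<lambda>U. \<Sum>V\<in>Pow (I - A). w (U \<union> V)))"

text \<open>Conditioning is plain substitution, without normalisation. A null event gives the zero
  weight, for which the inequality is trivial, so \<open>B\<close> ranges over all subsets of
  \<open>C\<close>.\<close>

definition CNA_weight :: "nat set \<Rightarrow> (nat set \<Rightarrow> real) \<Rightarrow> bool" where
  "CNA_weight I w \<longleftrightarrow> (\<forall>C B. C \<subseteq> I \<longrightarrow> B \<subseteq> C \<longrightarrow> NA_weight (I - C) (\<lambda>S. w (S \<union> B)))"

lemma NLC_weightD:
  "NLC_weight I w \<Longrightarrow> S \<subseteq> I \<Longrightarrow> T \<subseteq> I \<Longrightarrow> w (S \<union> T) * w (S \<inter> T) \<le> w S * w T"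
  by (simp add: NLC_weight_def)

lemma NLC_weight_cong:
  assumes "\<And>S. S \<subseteq> I \<Longrightarrow> w S = w' S"
  shows "NLC_weight I w \<longleftrightarrow> NLC_weight I w'"
proof -
  have "w (S \<union> T) = w' (S \<union> T)" "w (S \<inter> T) = w' (S \<inter> T)" "w S = w' S" if "S \<subseteq> I" "T \<subseteq> I" for S T
    using assms that by (simp_all add: le_infI1)
  then show ?thesis by (auto simp: NLC_weight_def)
qed

lemma NLC_weight_scale:
  assumes "c \<noteq> 0"
  shows "NLC_weight I (\<lambda>S. c * w S) \<longleftrightarrow> NLC_weight I w"
proof -
  have "0 < c * c" using assms by (simp add: zero_less_mult_iff) linarith
  then have "c * x * (c * y) \<le> c * z * (c * t) \<longleftrightarrow> x * y \<le> z * t" for x y z t :: real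
    using mult_le_cancel_left_pos[of "c * c" "x * y" "z * t"] by (simp add: ac_simps)
  then show ?thesis by (simp add: NLC_weight_def)
qed

lemma h_NLC_weight_scale:
  "c \<noteq> 0 \<Longrightarrow> h_NLC_weight I (\<lambda>S. c * w S) \<longleftrightarrow> h_NLC_weight I w"
  by (simp add: h_NLC_weight_def NLC_weight_scale flip: sum_distrib_left)

lemma CNA_weight_cong:
  assumes "\<And>S. S \<subseteq> I \<Longrightarrow> w S = w' S"
  shows "CNA_weight I w \<longleftrightarrow> CNA_weight I w'"
  unfolding CNA_weight_def
  by (intro all_cong1 imp_cong refl NA_weight_cong assms) auto

lemma CNA_weight_scale:
  assumes "CNA_weight I w"
  shows "CNA_weight I (\<lambda>S. c * w S)"
  using assms by (auto simp: CNA_weight_def intro: NA_weight_scale)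

lemma CNA_weight_projection:
  assumes A: "A \<subseteq> I" and CNA: "CNA_weight I w"
  shows "CNA_weight A (\<lambda>U. \<Sum>V\<in>Pow (I - A). w (U \<union> V))"
  unfolding CNA_weight_def
proof (intro allI impI)
  fix C B assume "C \<subseteq> A" "B \<subseteq> C"
  then have "NA_weight (I - C) (\<lambda>S. w (S \<union> B))"
    using CNA A by (auto simp: CNA_weight_def)
  then have "NA_weight (A - C) (\<lambda>S. \<Sum>V\<in>Pow (I - C - (A - C)). w (S \<union> V \<union> B))"
    using A by (intro NA_weight_projection[where w = "\<lambda>S. w (S \<union> B)"]) auto
  moreover have "I - C - (A - C) = I - A" using \<open>C \<subseteq> A\<close> by blast
  ultimately show "NA_weight (A - C) (\<lambda>S. \<Sum>V\<in>Pow (I - A). w (S \<union> B \<union> V))"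
    by (simp add: Un_ac)
qed

text \<open>The hypothesis on the support cannot be dropped: the local inequalities are multiplied
  together, and the intermediate values have to cancel.\<close>

lemma NLC_weight_if_local:
  assumes fin: "finite I" and nonneg: "\<And>S. S \<subseteq> I \<Longrightarrow> 0 \<le> w S"
    and supp: "\<And>P D E. P \<subseteq> I \<Longrightarrow> E \<subseteq> I \<Longrightarrow> P \<inter> E = {} \<Longrightarrow> D \<subseteq> E \<Longrightarrow> 0 < w P \<Longrightarrow> 0 < w (P \<union> E)
      \<Longrightarrow> 0 < w (P \<union> D)"
    and loc: "\<And>P i j. P \<subseteq> I \<Longrightarrow> i \<in> I - P \<Longrightarrow> j \<in> I - P \<Longrightarrow> i \<noteq> j \<Longrightarrow>
      w (insert i (insert j P)) * w P \<le> w (insert i P) * w (insert j P)"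
  shows "NLC_weight I w"
proof -
  \<comment> \<open>A single point is added against a set: the local inequality at
    \<open>P \<union> A\<close> is multiplied by the induction hypothesis, and
    \<open>w (P \<union> A) * w (P \<union> insert j A)\<close>, positive by \<open>supp\<close>, is
    cancelled. Then \<open>two\<close> adds the points of a second set one by one.\<close>
  have one: "w (P \<union> insert j A) * w P \<le> w (P \<union> A) * w (insert j P)"
    if "finite A" "P \<subseteq> I" "A \<subseteq> I" "j \<in> I" "j \<notin> P" "j \<notin> A" "P \<inter> A = {}" "0 < w P" "0 < w (P \<union> insert j A)"
    for P A j
    using that
  proof (induction A)
    case empty
    then show ?case by (simp add: mult.commute)
  next
    case (insert i A)
    have pos: "0 < w (P \<union> D)" if "D \<subseteq> insert j (insert i A)" for D
      using supp[of P "insert j (insert i A)" D] insert.prems that by auto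
    have p: "0 < w (P \<union> A)" "0 < w (P \<union> insert j A)"
      using pos[of A] pos[of "insert j A"] by auto
    have 1: "w (P \<union> insert j A) * w P \<le> w (P \<union> A) * w (insert j P)"
      using insert.prems p by (intro insert.IH) auto
    have 2: "w (insert i (insert j (P \<union> A))) * w (P \<union> A) \<le> w (insert i (P \<union> A)) * w (insert j (P \<union> A))"
      using insert.prems insert.hyps by (intro loc) auto
    define x where "x = w (P \<union> A)"
    define y where "y = w (P \<union> insert j A)"
    define z where "z = w (P \<union> insert j (insert i A))"
    define t where "t = w (P \<union> insert i A)"
    have 2: "z * x \<le> t * y" using 2 by (simp add: x_def y_def z_def t_def insert_commute)
    have 1: "y * w P \<le> x * w (insert j P)" using 1 by (simp add: x_def y_def)
    have xy: "0 < x" "0 < y" using p by (simp_all add: x_def y_def)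
    have "(z * x) * (y * w P) \<le> (t * y) * (x * w (insert j P))"
    proof (rule mult_mono[OF 2 1])
      show "0 \<le> t * y" using xy insert.prems by (auto simp: t_def intro!: mult_nonneg_nonneg nonneg)
      show "0 \<le> y * w P" using xy insert.prems by simp
    qed
    then have "(x * y) * (z * w P) \<le> (x * y) * (t * w (insert j P))" by (simp add: ac_simps)
    then have "z * w P \<le> t * w (insert j P)" using xy by (simp add: mult_le_cancel_left_pos)
    then show ?case by (simp add: z_def t_def)
  qed
  have two: "w (P \<union> A \<union> B) * w P \<le> w (P \<union> A) * w (P \<union> B)"
    if "finite B" "P \<subseteq> I" "A \<subseteq> I" "B \<subseteq> I" "P \<inter> A = {}" "P \<inter> B = {}" "A \<inter> B = {}"
      "0 < w P" "0 < w (P \<union> A \<union> B)" for P A B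
    using that
  proof (induction B)
    case (insert j B)
    have pos: "0 < w (P \<union> D)" if "D \<subseteq> A \<union> insert j B" for D
      using supp[of P "A \<union> insert j B" D] insert.prems that by (simp add: Un_assoc Int_Un_distrib)
    have p: "0 < w (P \<union> (A \<union> B))" "0 < w (P \<union> B)"
      using pos[of "A \<union> B"] pos[of B] by auto
    have 1: "w (P \<union> A \<union> B) * w P \<le> w (P \<union> A) * w (P \<union> B)"
      using insert.prems p by (intro insert.IH) (auto simp: Un_assoc)
    have e: "P \<union> B \<union> insert j A = P \<union> A \<union> insert j B" "P \<union> B \<union> A = P \<union> A \<union> B" "insert j (P \<union> B) = P \<union> insert j B"
      by blast+
    have "w (P \<union> B \<union> insert j A) * w (P \<union> B) \<le> w (P \<union> B \<union> A) * w (insert j (P \<union> B))"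
      using insert.prems insert.hyps p fin finite_subset[of A I] e(1) by (intro one) auto
    then have 2: "w (P \<union> A \<union> insert j B) * w (P \<union> B) \<le> w (P \<union> A \<union> B) * w (P \<union> insert j B)"
      unfolding e .
    define x where "x = w (P \<union> A \<union> B)"
    define y where "y = w (P \<union> B)"
    have xy: "0 < x" "0 < y" using p by (simp_all add: x_def y_def Un_assoc)
    have "(w (P \<union> A \<union> insert j B) * y) * (x * w P) \<le> (x * w (P \<union> insert j B)) * (w (P \<union> A) * y)"
    proof (rule mult_mono)
      show "w (P \<union> A \<union> insert j B) * y \<le> x * w (P \<union> insert j B)"
        using 2 by (simp add: x_def y_def)
      show "x * w P \<le> w (P \<union> A) * y"
        using 1 by (simp add: x_def y_def)
      show "0 \<le> x * w (P \<union> insert j B)"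
        using xy insert.prems by (auto intro!: mult_nonneg_nonneg nonneg)
      show "0 \<le> x * w P" using xy insert.prems by simp
    qed
    then have "(x * y) * (w (P \<union> A \<union> insert j B) * w P) \<le> (x * y) * (w (P \<union> A) * w (P \<union> insert j B))"
      by (simp add: ac_simps)
    then show ?case using xy by (simp add: mult_le_cancel_left_pos)
  qed (simp add: mult.commute)
  show ?thesis
    unfolding NLC_weight_def
  proof (intro allI impI)
    fix S T assume ST: "S \<subseteq> I" "T \<subseteq> I"
    show "w (S \<union> T) * w (S \<inter> T) \<le> w S * w T"
    proof (cases "w (S \<inter> T) = 0 \<or> w (S \<union> T) = 0")
      case True
      then show ?thesis using nonneg ST by auto
    next
      case False
      have "S \<inter> T \<subseteq> I" "S \<union> T \<subseteq> I" using ST by auto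
      then have "0 < w (S \<inter> T)" "0 < w (S \<union> T)"
        using False nonneg[of "S \<inter> T"] nonneg[of "S \<union> T"] by auto
      moreover have e: "S \<inter> T \<union> (S - T) \<union> (T - S) = S \<union> T" "S \<inter> T \<union> (S - T) = S" "S \<inter> T \<union> (T - S) = T"
        by blast+
      ultimately have "w (S \<inter> T \<union> (S - T) \<union> (T - S)) * w (S \<inter> T)
          \<le> w (S \<inter> T \<union> (S - T)) * w (S \<inter> T \<union> (T - S))"
        using ST fin finite_subset[of T I] by (intro two) auto
      then show ?thesis using e by simp
    qed
  qed
qed

section \<open>From negative association to the lattice condition\<close>

text \<open>Negative association is applied to the events that \<open>S\<close> contains
  \<open>D\<close> and that \<open>S\<close> meets \<open>E - D\<close>. Their 2 by 2 table
  satisfies \<open>x11 * x00 \<le> x10 * x01\<close>; the full set makes \<open>x11\<close> positive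
  and the empty set makes \<open>x00\<close> positive. The only set in the cell \<open>x10\<close>
  is \<open>D\<close> itself.\<close>

lemma NA_weight_support:
  assumes fin: "finite E" and nonneg: "\<And>S. S \<subseteq> E \<Longrightarrow> 0 \<le> v S" and NA: "NA_weight E v"
    and D: "D \<subseteq> E" and pos: "0 < v {}" "0 < v E"
  shows "0 < v D"
proof (cases "D = {} \<or> D = E")
  case False
  define F :: "nat set \<Rightarrow> real" where "F S = (if D \<subseteq> S then 1 else 0)" for S
  define G :: "nat set \<Rightarrow> real" where "G S = (if S \<inter> (E - D) \<noteq> {} then 1 else 0)" for S
  have finP: "finite (Pow E)" using fin by simp
  have FD: "F (S \<inter> D) = F S" for S by (auto simp: F_def)
  have GD: "G (S \<inter> (E - D)) = G S" for S by (simp add: G_def Int_assoc)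
  have dep: "depends_only_on E F D" "depends_only_on E G (E - D)"
    unfolding depends_only_on_def by (metis FD, metis GD)
  have mono: "mono_on (Pow E) F" "mono_on (Pow E) G"
    unfolding F_def G_def by (intro mono_onI; simp; blast)+
  have NA': "(\<Sum>S\<in>Pow E. v S * (F S * G S)) * sum v (Pow E)
      \<le> (\<Sum>S\<in>Pow E. v S * F S) * (\<Sum>S\<in>Pow E. v S * G S)"
    by (rule NA_weightD[OF NA D _ _ mono dep]) auto
  define x11 where "x11 = (\<Sum>S\<in>Pow E. v S * (F S * G S))"
  define x10 where "x10 = (\<Sum>S\<in>Pow E. v S * (F S * (1 - G S)))"
  define x01 where "x01 = (\<Sum>S\<in>Pow E. v S * ((1 - F S) * G S))"
  define x00 where "x00 = (\<Sum>S\<in>Pow E. v S * ((1 - F S) * (1 - G S)))"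
  have tot: "sum v (Pow E) = x11 + x10 + x01 + x00" "(\<Sum>S\<in>Pow E. v S * F S) = x11 + x10"
    "(\<Sum>S\<in>Pow E. v S * G S) = x11 + x01"
    by (simp_all add: x11_def x10_def x01_def x00_def algebra_simps flip: sum.distrib)
  have key: "x11 * x00 \<le> x10 * x01"
    using NA' unfolding tot x11_def[symmetric] by (simp add: algebra_simps)
  have "v E * (F E * G E) \<le> x11" "v {} * ((1 - F {}) * (1 - G {})) \<le> x00"
    unfolding x11_def x00_def using nonneg finP
    by (intro member_le_sum; auto simp: F_def G_def)+
  moreover have "F E = 1" "G E = 1" "F {} = 0" "G {} = 0"
    using D False by (auto simp: F_def G_def)
  ultimately have "0 < x11" "0 < x00" using pos by auto
  then have "0 < x10 * x01" using key by (meson less_le_trans mult_pos_pos)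
  then have "x10 \<noteq> 0" by auto
  moreover have "x10 = v D"
  proof -
    have "x10 = (\<Sum>S\<in>{D}. v S * (F S * (1 - G S)))"
      unfolding x10_def using D fin
      by (intro sum.mono_neutral_right) (auto simp: F_def G_def)
    also have "\<dots> = v D" by (auto simp: F_def G_def)
    finally show ?thesis .
  qed
  ultimately show ?thesis using nonneg[OF D] by simp
qed (use pos in auto)

lemma NA_weight_pair:
  assumes NA: "NA_weight {i, j} v" and "i \<noteq> j"
  shows "v {i, j} * v {} \<le> v {i} * v {j}"
proof -
  define F :: "nat \<Rightarrow> nat set \<Rightarrow> real" where "F x S = (if x \<in> S then 1 else 0)" for x S
  have P: "Pow {i, j} = {{}, {i}, {j}, {i, j}}" by auto
  have s: "sum h (Pow {i, j}) = h {} + h {i} + h {j} + h {i, j}" for h :: "nat set \<Rightarrow> real"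
    unfolding P using \<open>i \<noteq> j\<close> by (subst sum.insert; auto simp: doubleton_eq_iff)+
  have "mono_on (Pow {i, j}) (F x)" "depends_only_on {i, j} (F x) {x}" for x
    by (auto simp: F_def depends_only_on_def intro!: mono_onI)
  then have "(\<Sum>S\<in>Pow {i, j}. v S * (F i S * F j S)) * sum v (Pow {i, j})
      \<le> (\<Sum>S\<in>Pow {i, j}. v S * F i S) * (\<Sum>S\<in>Pow {i, j}. v S * F j S)"
    using \<open>i \<noteq> j\<close> by (intro NA_weightD[OF NA, of "{i}" "{j}"]) auto
  then show ?thesis
    unfolding s using \<open>i \<noteq> j\<close> by (simp add: F_def algebra_simps)
qed

text \<open>Conditional negative association supplies both inputs of the local criterion: the
  support condition by \<open>NA_weight_support\<close>, and the inequality for two points by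
  testing their indicators.\<close>

lemma CNA_weight_imp_NLC_weight:
  assumes fin: "finite I" and nonneg: "\<And>S. S \<subseteq> I \<Longrightarrow> 0 \<le> w S" and CNA: "CNA_weight I w"
  shows "NLC_weight I w"
proof -
  \<comment> \<open>All coordinates outside \<open>E\<close> are fixed, those in \<open>P\<close> to
    1 and the others to 0.\<close>
  have NA: "NA_weight E (\<lambda>S. w (S \<union> P))" if "P \<subseteq> I" "E \<subseteq> I" "P \<inter> E = {}" for P E
  proof -
    have "NA_weight (I - (I - E)) (\<lambda>S. w (S \<union> P))"
      using that by (intro CNA[unfolded CNA_weight_def, rule_format]) auto
    then show ?thesis using that by (simp add: double_diff)
  qed
  show ?thesis
  proof (rule NLC_weight_if_local[OF fin nonneg])
    fix P D E assume *: "P \<subseteq> I" "E \<subseteq> I" "P \<inter> E = {}" "D \<subseteq> E" "0 < w P" "0 < w (P \<union> E)"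
    have "0 < w (D \<union> P)"
    proof (rule NA_weight_support[where v = "\<lambda>S. w (S \<union> P)"])
      show "NA_weight E (\<lambda>S. w (S \<union> P))" using * by (intro NA)
      show "finite E" using * fin finite_subset by blast
    qed (use * nonneg in \<open>auto simp: Un_commute\<close>)
    then show "0 < w (P \<union> D)" by (simp add: Un_commute)
  next
    fix P i j assume *: "P \<subseteq> I" "i \<in> I - P" "j \<in> I - P" "i \<noteq> j"
    have "NA_weight {i, j} (\<lambda>S. w (S \<union> P))" using * by (intro NA) auto
    from NA_weight_pair[OF this \<open>i \<noteq> j\<close>]
    show "w (insert i (insert j P)) * w P \<le> w (insert i P) * w (insert j P)" by simp
  qed
qed

lemma CNA_weight_imp_h_NLC_weight:
  assumes "finite I" and nonneg: "\<And>S. S \<subseteq> I \<Longrightarrow> 0 \<le> w S" and CNA: "CNA_weight I w"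
  shows "h_NLC_weight I w"
  unfolding h_NLC_weight_def
proof (intro allI impI)
  fix A assume "A \<subseteq> I"
  then show "NLC_weight A (\<lambda>U. \<Sum>V\<in>Pow (I - A). w (U \<union> V))"
    using assms finite_subset[of A I]
    by (intro CNA_weight_imp_NLC_weight CNA_weight_projection sum_nonneg nonneg) auto
qed

section \<open>Conditional negative association of two-row weights\<close>

text \<open>Conditioning on exchangeable coordinates only shifts and rescales the rows, which
  preserves the hypotheses. Once \<open>k\<close> itself is fixed a single row remains, and its own
  log-concavity takes over.\<close>

lemma CNA_weight_two_row:
  assumes fin: "finite I" and \<kappa>: "\<And>i. i \<in> I \<Longrightarrow> 0 \<le> \<kappa> i" and \<kappa>k: "0 \<le> \<kappa> k"
    and a: "\<And>j. 0 \<le> a j" and b: "\<And>j. 0 \<le> b j"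
    and lca: "log_concave a" and lcb: "log_concave b" and lc: "log_concave (\<lambda>j. a j + \<kappa> k * b j)"
    and ratio: "\<And>i r. b (i + r) * a i \<le> b i * a (i + r)"
  shows "CNA_weight I (\<lambda>S. prod \<kappa> S * (if k \<in> S then b else a) (card (S - {k})))"
    (is "CNA_weight I ?w")
  unfolding CNA_weight_def
proof (intro allI impI)
  fix C B assume CB: "C \<subseteq> I" "B \<subseteq> C"
  have finB: "finite B" using CB fin by (meson finite_subset)
  have B0: "0 \<le> prod \<kappa> B" using CB \<kappa> by (intro prod_nonneg) auto
  define p where "p = prod \<kappa> B"
  show "NA_weight (I - C) (\<lambda>S. ?w (S \<union> B))"
  proof (cases "k \<in> I - C")
    case True
    define d where "d = card B"
    define a' where "a' j = p * a (j + d)" for j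
    define b' where "b' j = (p * \<kappa> k) * b (j + d)" for j
    have "NA_weight (I - C) (\<lambda>S. prod \<kappa> (S - {k}) * (if k \<in> S then b' else a') (card (S - {k})))"
    proof (rule NA_weight_two_row[OF _ True])
      show "log_concave (\<lambda>j. a' j + b' j)"
        using log_concave_shift_scale[OF lc, of p d] by (simp add: a'_def b'_def algebra_simps)
      show "b' (i + r) * a' i \<le> b' i * a' (i + r)" for i r
      proof -
        have "b (i + d + r) * a (i + d) \<le> b (i + d) * a (i + d + r)" by (rule ratio)
        then have "(p * \<kappa> k * p) * (b (i + d + r) * a (i + d)) \<le> (p * \<kappa> k * p) * (b (i + d) * a (i + d + r))"
          using B0 \<kappa>k by (intro mult_left_mono) (auto simp: p_def)
        then show ?thesis by (simp add: a'_def b'_def ac_simps)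
      qed
    qed (use fin \<kappa> a b B0 \<kappa>k in \<open>auto simp: a'_def b'_def p_def\<close>)
    moreover have "?w (S \<union> B) = prod \<kappa> (S - {k}) * (if k \<in> S then b' else a') (card (S - {k}))"
      if "S \<subseteq> I - C" for S
    proof -
      have S: "finite S" "S \<inter> B = {}" "k \<notin> B" using that fin finite_subset CB True by blast+
      have "prod \<kappa> (S \<union> B) = prod \<kappa> S * p" using S finB by (simp add: prod.union_disjoint p_def)
      moreover have "prod \<kappa> S = (if k \<in> S then \<kappa> k else 1) * prod \<kappa> (S - {k})"
        using S by (simp add: prod.remove)
      moreover have "S \<union> B - {k} = (S - {k}) \<union> B" using S by blast
      moreover have "card ((S - {k}) \<union> B) = card (S - {k}) + d"
        using S finB by (subst card_Un_disjoint) (auto simp: d_def)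
      ultimately show ?thesis using S by (simp add: a'_def b'_def)
    qed
    ultimately show ?thesis by (rule NA_weight_transfer)
  next
    case False
    define J where "J = I - C"
    have kJ: "k \<notin> J" using False by (simp add: J_def)
    define c where "c = (if k \<in> B then b else a)"
    define d where "d = card (B - {k})"
    define a' where "a' j = p * c (j + d)" for j
    have c: "0 \<le> c j" "log_concave c" for j using a b lca lcb by (auto simp: c_def)
    \<comment> \<open>The single row is treated as a pair whose other row is zero: \<open>k\<close>
      is adjoined as a dummy coordinate whose presence has weight 0, and is then projected away.
      This also covers \<open>k\<close> outside \<open>I\<close>.\<close>
    let ?v = "\<lambda>S. prod \<kappa> (S - {k}) * (if k \<in> S then \<lambda>_. 0 else a') (card (S - {k}))"
    have "NA_weight (insert k J) ?v"
    proof (rule NA_weight_two_row)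
      show "log_concave (\<lambda>j. a' j + 0)"
        using log_concave_shift_scale[OF c(2), of p d] by (simp add: a'_def)
    qed (use fin \<kappa> c B0 in \<open>auto simp: J_def a'_def p_def\<close>)
    then have "NA_weight J (\<lambda>S. \<Sum>V\<in>Pow (insert k J - J). ?v (S \<union> V))"
      by (intro NA_weight_projection) auto
    moreover have "?w (S \<union> B) = (\<Sum>V\<in>Pow (insert k J - J). ?v (S \<union> V))" if "S \<subseteq> J" for S
    proof -
      have S: "finite S" "S \<inter> B = {}" "k \<notin> S" using that fin finite_subset CB kJ by (auto simp: J_def)
      have "insert k J - J = {k}" using kJ by blast
      then have "(\<Sum>V\<in>Pow (insert k J - J). ?v (S \<union> V)) = prod \<kappa> S * a' (card S)"
        using S by (simp add: Pow_insert)
      moreover have "prod \<kappa> (S \<union> B) = prod \<kappa> S * p" using S finB by (simp add: prod.union_disjoint p_def)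
      moreover have "S \<union> B - {k} = S \<union> (B - {k})" using S by blast
      moreover have "card (S \<union> (B - {k})) = card S + d"
        using S finB by (subst card_Un_disjoint) (auto simp: d_def)
      ultimately show ?thesis using S by (simp add: a'_def c_def)
    qed
    ultimately have "NA_weight J (\<lambda>S. ?w (S \<union> B))"
      by (rule NA_weight_transfer)
    then show ?thesis by (simp only: J_def)
  qed
qed

section \<open>Sequence inequalities from the lattice condition\<close>

text \<open>Take disjoint sets \<open>P\<close>, \<open>Q\<close>, \<open>R\<close> of sizes
  \<open>i\<close>, \<open>r\<close>, \<open>s\<close> and compare \<open>P \<union> Q\<close> with
  \<open>P \<union> R\<close>. If they do not fit into \<open>J\<close>, the left side is 0.\<close>

lemma log_concave_if_NLC_weight:
  assumes fin: "finite J" and NLC: "NLC_weight J v" and v: "\<And>S. S \<subseteq> J \<Longrightarrow> v S = c (card S)"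
    and c: "\<And>j. 0 \<le> c j" "\<And>j. card J < j \<Longrightarrow> c j = 0"
  shows "log_concave c"
  unfolding log_concave_def
proof (intro allI)
  fix i r s
  show "c (i + r + s) * c i \<le> c (i + r) * c (i + s)"
  proof (cases "i + r + s \<le> card J")
    case True
    then have "i \<le> card J" by linarith
    then obtain P where P: "P \<subseteq> J" "card P = i" "finite P"
      by (rule obtain_subset_with_card_n)
    then have "card (J - P) = card J - i" by (simp add: card_Diff_subset)
    then have "r \<le> card (J - P)" using True by linarith
    then obtain Q where Q: "Q \<subseteq> J - P" "card Q = r" "finite Q"
      by (rule obtain_subset_with_card_n)
    have "card (J - P - Q) = card J - i - r"
      using \<open>card (J - P) = card J - i\<close> Q by (simp add: card_Diff_subset)
    then have "s \<le> card (J - P - Q)" using True by linarith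
    then obtain R where R: "R \<subseteq> J - P - Q" "card R = s" "finite R"
      by (rule obtain_subset_with_card_n)
    have "v ((P \<union> Q) \<union> (P \<union> R)) * v ((P \<union> Q) \<inter> (P \<union> R)) \<le> v (P \<union> Q) * v (P \<union> R)"
      using P Q R by (intro NLC_weightD[OF NLC]) auto
    moreover have "(P \<union> Q) \<union> (P \<union> R) = P \<union> Q \<union> R" "(P \<union> Q) \<inter> (P \<union> R) = P" using P Q R by blast+
    moreover have "v (P \<union> Q \<union> R) = c (card (P \<union> Q \<union> R))" "v (P \<union> Q) = c (card (P \<union> Q))"
      "v (P \<union> R) = c (card (P \<union> R))" "v P = c (card P)"
      using P Q R by (auto intro!: v)
    moreover have "P \<inter> Q = {}" "P \<inter> R = {}" using Q R by blast+
    then have "card (P \<union> Q) = i + r" "card (P \<union> R) = i + s"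
      using P Q R by (simp_all add: card_Un_disjoint)
    moreover note \<open>card (P \<union> Q) = i + r\<close> \<open>card (P \<union> R) = i + s\<close>
    moreover have "card (P \<union> Q \<union> R) = card (P \<union> Q) + s"
      using P Q R by (subst card_Un_disjoint) auto
    ultimately show ?thesis using P by simp
  next
    case False
    then show ?thesis using c by (simp add: mult_nonneg_nonneg)
  qed
qed

text \<open>The row \<open>a\<close> is read off from sets without \<open>k\<close>, the row
  \<open>b\<close> from sets with \<open>k\<close>, the sum \<open>a + b\<close> from the projection
  that forgets \<open>k\<close>, and the ratio from comparing \<open>insert k P\<close> with
  \<open>P \<union> Q\<close>. If \<open>k\<close> lies outside \<open>I\<close>, the row
  \<open>b\<close> is zero.\<close>

lemma h_NLC_weight_two_row:
  assumes fin: "finite I" and w: "\<And>S. S \<subseteq> I \<Longrightarrow> w S = (if k \<in> S then b else a) (card (S - {k}))"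
    and a: "\<And>j. 0 \<le> a j" "\<And>j. card (I - {k}) < j \<Longrightarrow> a j = 0"
    and b: "\<And>j. 0 \<le> b j" "\<And>j. card (I - {k}) < j \<Longrightarrow> b j = 0" "\<And>j. k \<notin> I \<Longrightarrow> b j = 0"
    and h: "h_NLC_weight I w"
  shows "log_concave a" "log_concave b" "log_concave (\<lambda>j. a j + b j)"
    "b (i + r) * a i \<le> b i * a (i + r)"
proof -
  define J where "J = I - {k}"
  have finJ: "finite J" and J: "J \<subseteq> I" "k \<notin> J" using fin by (auto simp: J_def)
  have NLC: "NLC_weight A (\<lambda>U. \<Sum>V\<in>Pow (I - A). w (U \<union> V))" if "A \<subseteq> I" for A
    using h that by (simp add: h_NLC_weight_def)
  have NLCI: "NLC_weight I w" using NLC[of I] by simp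
  have wa: "w S = a (card S)" if "S \<subseteq> J" for S
    using that J by (subst w) (auto simp: insert_absorb intro!: arg_cong[where f = a] arg_cong[where f = card])
  have wb: "w (insert k S) = b (card S)" if "S \<subseteq> J" "k \<in> I" for S
  proof -
    have "insert k S - {k} = S" using that J by blast
    then show ?thesis using that J by (subst w) auto
  qed
  have "NLC_weight J w"
    unfolding NLC_weight_def using NLC_weightD[OF NLCI] J by blast
  then show lca: "log_concave a"
    using a wa by (intro log_concave_if_NLC_weight[OF finJ, of w]) (auto simp: J_def)
  show "log_concave b"
  proof (cases "k \<in> I")
    case True
    have "NLC_weight J (\<lambda>S. w (insert k S))"
      unfolding NLC_weight_def
    proof (intro allI impI)
      fix S T assume "S \<subseteq> J" "T \<subseteq> J"
      then have "w (insert k S \<union> insert k T) * w (insert k S \<inter> insert k T) \<le> w (insert k S) * w (insert k T)"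
        using J True by (intro NLC_weightD[OF NLCI]) auto
      then show "w (insert k (S \<union> T)) * w (insert k (S \<inter> T)) \<le> w (insert k S) * w (insert k T)" by simp
    qed
    then show ?thesis
      using b wb True by (intro log_concave_if_NLC_weight[OF finJ, of "\<lambda>S. w (insert k S)"]) (auto simp: J_def)
  qed (simp add: b(3) log_concave_def)
  show "log_concave (\<lambda>j. a j + b j)"
  proof (cases "k \<in> I")
    case True
    then have "I - J = {k}" by (auto simp: J_def)
    then have "NLC_weight J (\<lambda>S. w S + w (insert k S))"
      using NLC[OF J(1)] by (simp add: Pow_insert add.commute)
    then show ?thesis
      using a b wa wb True
      by (intro log_concave_if_NLC_weight[OF finJ, of "\<lambda>S. w S + w (insert k S)"]) (auto simp: J_def)
  qed (simp add: b(3) lca)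
  show "b (i + r) * a i \<le> b i * a (i + r)"
  proof (cases "i + r \<le> card J \<and> k \<in> I")
    case True
    then have "i \<le> card J" by linarith
    then obtain P where P: "P \<subseteq> J" "card P = i" "finite P"
      by (rule obtain_subset_with_card_n)
    then have "card (J - P) = card J - i" by (simp add: card_Diff_subset)
    then have "r \<le> card (J - P)" using True by linarith
    then obtain Q where Q: "Q \<subseteq> J - P" "card Q = r" "finite Q"
      by (rule obtain_subset_with_card_n)
    have PQ: "card (P \<union> Q) = i + r" using P Q by (subst card_Un_disjoint) auto
    have "w (insert k P \<union> (P \<union> Q)) * w (insert k P \<inter> (P \<union> Q)) \<le> w (insert k P) * w (P \<union> Q)"
      using P Q J True by (intro NLC_weightD[OF NLCI]) auto
    moreover have "insert k P \<union> (P \<union> Q) = insert k (P \<union> Q)" "insert k P \<inter> (P \<union> Q) = P"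
      using P Q J by auto
    moreover have "w (insert k (P \<union> Q)) = b (i + r)" "w P = a i" "w (insert k P) = b i" "w (P \<union> Q) = a (i + r)"
      using P Q PQ True wa[of "P \<union> Q"] wb[of "P \<union> Q"] wa[of P] wb[of P] by auto
    ultimately show ?thesis by simp
  next
    case False
    then have "card (I - {k}) < i + r \<or> k \<notin> I" by (simp add: J_def not_le)
    then have "b (i + r) = 0" using b(2,3) by blast
    then show ?thesis using a b by (simp add: mult_nonneg_nonneg)
  qed
qed

subsection \<open>From measures to weights\<close>

lemma pmf_eq_0_outside: "set_pmf \<mu> \<subseteq> Pow I \<Longrightarrow> \<not> S \<subseteq> I \<Longrightarrow> pmf \<mu> S = 0"
  by (auto simp: set_pmf_iff)

lemma pmf_projection:
  assumes "finite I" "set_pmf \<mu> \<subseteq> Pow I" "A \<subseteq> I" "U \<subseteq> A"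
  shows "pmf (projection A \<mu>) U = (\<Sum>V\<in>Pow (I - A). pmf \<mu> (U \<union> V))"
proof -
  have inj: "inj_on ((\<union>) U) (Pow (I - A))"
    using assms(4) by (intro inj_onI) blast
  have "pmf (projection A \<mu>) U = measure_pmf.prob \<mu> ((\<lambda>S. S \<inter> A) -` {U})"
    unfolding projection_def by (rule pmf_map)
  also have "\<dots> = measure_pmf.prob \<mu> ((\<union>) U ` Pow (I - A))"
  proof (rule measure_prob_cong_0)
    fix S assume "S \<in> (\<lambda>S. S \<inter> A) -` {U} - (\<union>) U ` Pow (I - A)"
    moreover from this have "S = U \<union> (S - A)" by blast
    ultimately have "\<not> S \<subseteq> I" by blast
    then show "pmf \<mu> S = 0" by (rule pmf_eq_0_outside[OF assms(2)])
  next
    fix S assume "S \<in> (\<union>) U ` Pow (I - A) - (\<lambda>S. S \<inter> A) -` {U}"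
    then show "pmf \<mu> S = 0" using assms(4) by auto
  qed
  also have "\<dots> = (\<Sum>S\<in>(\<union>) U ` Pow (I - A). pmf \<mu> S)"
    using assms(1) by (intro measure_measure_pmf_finite) auto
  also have "\<dots> = (\<Sum>V\<in>Pow (I - A). pmf \<mu> (U \<union> V))"
    by (simp add: sum.reindex[OF inj])
  finally show ?thesis .
qed

lemma set_pmf_projection: "set_pmf (projection A \<mu>) \<subseteq> Pow A"
  by (auto simp: projection_def)

lemma h_NLC_iff_weight:
  assumes "finite I" "set_pmf \<mu> \<subseteq> Pow I"
  shows "h_NLC I \<mu> \<longleftrightarrow> h_NLC_weight I (pmf \<mu>)"
proof -
  have "NLC A (projection A \<mu>) \<longleftrightarrow> NLC_weight A (\<lambda>U. \<Sum>V\<in>Pow (I - A). pmf \<mu> (U \<union> V))" if "A \<subseteq> I" for A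
  proof -
    have "NLC A (projection A \<mu>) \<longleftrightarrow> NLC_weight A (pmf (projection A \<mu>))"
      by (simp add: NLC_def NLC_weight_def Ball_def)
    also have "\<dots> \<longleftrightarrow> NLC_weight A (\<lambda>U. \<Sum>V\<in>Pow (I - A). pmf \<mu> (U \<union> V))"
      using assms that by (intro NLC_weight_cong pmf_projection)
    finally show ?thesis .
  qed
  then show ?thesis by (simp add: h_NLC_def h_NLC_weight_def)
qed

lemma NA_iff_weight:
  assumes "finite I" "set_pmf \<mu> \<subseteq> Pow I"
  shows "NA I \<mu> \<longleftrightarrow> NA_weight I (pmf \<mu>)"
proof -
  have E: "measure_pmf.expectation \<mu> h = (\<Sum>S\<in>Pow I. pmf \<mu> S * h S)" for h :: "nat set \<Rightarrow> real"
    using assms by (subst integral_measure_pmf_real[of "Pow I"]) (auto simp: mult.commute)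
  have "sum (pmf \<mu>) (Pow I) = 1"
    using assms by (intro sum_pmf_eq_1) auto
  then show ?thesis by (simp add: NA_def NA_weight_def E)
qed

lemma pmf_conditioning:
  assumes "set_pmf \<mu> \<subseteq> Pow I" "B \<subseteq> C" "S \<subseteq> I - C" "0 < measure_pmf.prob \<mu> (cond_event C B)"
  shows "pmf (conditioning C B \<mu>) S = pmf \<mu> (S \<union> B) / measure_pmf.prob \<mu> (cond_event C B)"
proof -
  let ?\<nu> = "cond_pmf \<mu> (cond_event C B)"
  have ne: "set_pmf \<mu> \<inter> cond_event C B \<noteq> {}"
    using assms(4) by (metis less_irrefl measure_pmf_zero_iff)
  have "pmf (conditioning C B \<mu>) S = measure_pmf.prob ?\<nu> ((\<lambda>S. S - C) -` {S})"
    unfolding conditioning_def by (rule pmf_map)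
  also have "\<dots> = measure_pmf.prob ?\<nu> {S \<union> B}"
  proof (rule measure_prob_cong_0)
    fix T assume "T \<in> (\<lambda>S. S - C) -` {S} - {S \<union> B}"
    then have "T \<notin> cond_event C B" using assms(2,3) by (auto simp: cond_event_def)
    then show "pmf ?\<nu> T = 0" by (simp add: pmf_cond[OF ne])
  qed (use assms(2,3) in auto)
  also have "\<dots> = pmf \<mu> (S \<union> B) / measure_pmf.prob \<mu> (cond_event C B)"
  proof -
    have "S \<union> B \<in> cond_event C B" using assms(2,3) by (auto simp: cond_event_def)
    then show ?thesis by (simp add: measure_pmf_single pmf_cond[OF ne])
  qed
  finally show ?thesis .
qed

lemma set_pmf_conditioning:
  assumes "set_pmf \<mu> \<subseteq> Pow I" "0 < measure_pmf.prob \<mu> (cond_event C B)"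
  shows "set_pmf (conditioning C B \<mu>) \<subseteq> Pow (I - C)"
proof -
  have ne: "set_pmf \<mu> \<inter> cond_event C B \<noteq> {}"
    using assms(2) by (metis less_irrefl measure_pmf_zero_iff)
  show ?thesis using assms(1) by (auto simp: conditioning_def set_cond_pmf[OF ne])
qed

lemma CNA_iff_weight:
  assumes "finite I" "set_pmf \<mu> \<subseteq> Pow I"
  shows "CNA I \<mu> \<longleftrightarrow> CNA_weight I (pmf \<mu>)"
proof -
  have *: "(0 < measure_pmf.prob \<mu> (cond_event C B) \<longrightarrow> NA (I - C) (conditioning C B \<mu>))
      \<longleftrightarrow> NA_weight (I - C) (\<lambda>S. pmf \<mu> (S \<union> B))" if "C \<subseteq> I" "B \<subseteq> C" for C B
  proof (cases "0 < measure_pmf.prob \<mu> (cond_event C B)")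
    case True
    define p where "p = measure_pmf.prob \<mu> (cond_event C B)"
    have p: "0 < p" using True by (simp add: p_def)
    have eq: "pmf (conditioning C B \<mu>) S = (1 / p) * pmf \<mu> (S \<union> B)" if "S \<subseteq> I - C" for S
      using pmf_conditioning[OF assms(2) \<open>B \<subseteq> C\<close> that True] by (simp add: p_def)
    have "NA (I - C) (conditioning C B \<mu>) \<longleftrightarrow> NA_weight (I - C) (pmf (conditioning C B \<mu>))"
      using assms True by (intro NA_iff_weight set_pmf_conditioning) auto
    also have "\<dots> \<longleftrightarrow> NA_weight (I - C) (\<lambda>S. (1 / p) * pmf \<mu> (S \<union> B))"
      by (rule NA_weight_cong) (rule eq)
    also have "\<dots> \<longleftrightarrow> NA_weight (I - C) (\<lambda>S. pmf \<mu> (S \<union> B))"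
    proof
      assume "NA_weight (I - C) (\<lambda>S. (1 / p) * pmf \<mu> (S \<union> B))"
      from NA_weight_scale[OF this, of p] show "NA_weight (I - C) (\<lambda>S. pmf \<mu> (S \<union> B))"
        using p by simp
    qed (rule NA_weight_scale)
    finally show ?thesis using True by simp
  next
    \<comment> \<open>A null event imposes nothing on the measure, and the corresponding weight is
      identically zero.\<close>
    case False
    then have z: "measure_pmf.prob \<mu> (cond_event C B) = 0"
      by (simp add: zero_less_measure_iff)
    have "NA_weight (I - C) (\<lambda>_. 0)" by (rule NA_weightI) simp
    moreover have "pmf \<mu> (S \<union> B) = 0" if "S \<subseteq> I - C" for S
    proof -
      have "S \<union> B \<in> cond_event C B" using that \<open>B \<subseteq> C\<close> by (auto simp: cond_event_def)
      then have "S \<union> B \<notin> set_pmf \<mu>" using z by (auto simp: measure_pmf_zero_iff)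
      then show ?thesis by (simp add: set_pmf_iff)
    qed
    ultimately have "NA_weight (I - C) (\<lambda>S. pmf \<mu> (S \<union> B))" by (rule NA_weight_transfer)
    then show ?thesis using False by simp
  qed
  have "(C \<subseteq> I \<and> B \<subseteq> C \<and> 0 < measure_pmf.prob \<mu> (cond_event C B) \<longrightarrow> NA (I - C) (conditioning C B \<mu>))
      \<longleftrightarrow> (C \<subseteq> I \<longrightarrow> B \<subseteq> C \<longrightarrow> NA_weight (I - C) (\<lambda>S. pmf \<mu> (S \<union> B)))" for C B
    using *[of C B] by argo
  then show ?thesis unfolding CNA_def CNA_weight_def by presburger
qed

section \<open>External fields and projections of measures\<close>

lemma gen_poly_pos:
  assumes "finite I" "set_pmf \<mu> \<subseteq> Pow I" "\<And>i. i \<in> I \<Longrightarrow> 0 < x i"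
  shows "0 < gen_poly I \<mu> x"
proof -
  obtain S where S: "S \<in> set_pmf \<mu>" using set_pmf_not_empty[of \<mu>] by blast
  have pos: "0 < prod x T" if "T \<subseteq> I" for T
    using assms(3) that by (intro prod_pos) auto
  show ?thesis
    unfolding gen_poly_def
  proof (rule sum_pos2)
    show "S \<in> Pow I" using S assms(2) by blast
    then show "0 < pmf \<mu> S * prod x S" using S pos[of S] by (simp add: pmf_positive)
    show "0 \<le> pmf \<mu> T * prod x T" if "T \<in> Pow I" for T
      using that pos[of T] by (simp add: less_imp_le)
  qed (use assms(1) in simp)
qed

lemma external_field_scaled:
  assumes "finite I" "set_pmf \<mu> \<subseteq> Pow I" "\<And>i. i \<in> I \<Longrightarrow> 0 \<le> a i" "gen_poly I \<mu> a \<noteq> 0"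
  obtains c where "c > 0" "\<And>S. pmf (external_field I a \<mu>) S = c * (pmf \<mu> S * prod a S)"
proof (rule that)
  have "0 \<le> gen_poly I \<mu> a"
    unfolding gen_poly_def using assms(3) by (intro sum_nonneg mult_nonneg_nonneg prod_nonneg) auto
  then show "0 < 1 / gen_poly I \<mu> a" using assms(4) by simp
  show "pmf (external_field I a \<mu>) S = 1 / gen_poly I \<mu> a * (pmf \<mu> S * prod a S)" for S
    using pmf_external_field[OF assms] by simp
qed

lemma set_pmf_external_field:
  assumes "finite I" "set_pmf \<mu> \<subseteq> Pow I" "\<And>i. i \<in> I \<Longrightarrow> 0 \<le> a i" "gen_poly I \<mu> a \<noteq> 0"
  shows "set_pmf (external_field I a \<mu>) \<subseteq> Pow I"
proof
  fix S assume "S \<in> set_pmf (external_field I a \<mu>)"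
  then have "pmf \<mu> S \<noteq> 0" using pmf_external_field[OF assms] by (auto simp: set_pmf_iff)
  then show "S \<in> Pow I" using assms(2) by (auto simp: set_pmf_iff)
qed

lemma h_NLC_external_field_iff:
  assumes "finite I" "set_pmf \<mu> \<subseteq> Pow I" "\<And>i. i \<in> I \<Longrightarrow> 0 \<le> a i" "gen_poly I \<mu> a \<noteq> 0"
  shows "h_NLC I (external_field I a \<mu>) \<longleftrightarrow> h_NLC_weight I (\<lambda>S. pmf \<mu> S * prod a S)"
proof -
  obtain c where c: "c > 0" "\<And>S. pmf (external_field I a \<mu>) S = c * (pmf \<mu> S * prod a S)"
    using external_field_scaled[OF assms] by blast
  have "h_NLC I (external_field I a \<mu>) \<longleftrightarrow> h_NLC_weight I (pmf (external_field I a \<mu>))"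
    using assms by (intro h_NLC_iff_weight set_pmf_external_field)
  also have "pmf (external_field I a \<mu>) = (\<lambda>S. c * (pmf \<mu> S * prod a S))"
    by (rule ext) (rule c)
  also have "h_NLC_weight I \<dots> \<longleftrightarrow> h_NLC_weight I (\<lambda>S. pmf \<mu> S * prod a S)"
    using c by (intro h_NLC_weight_scale) simp
  finally show ?thesis .
qed

text \<open>Normal form: fields and projections in any order amount, up to a constant, to one field
  on \<open>I\<close> followed by one projection. A field imposed after projecting onto
  \<open>J\<close> is extended by 1 to \<open>I - J\<close>, and sums over forgotten coordinates
  merge.\<close>

lemma field_proj_weight:
  assumes fin: "finite I" and sub: "set_pmf \<mu> \<subseteq> Pow I" and fp: "field_proj I \<mu> J \<nu>"
  shows "J \<subseteq> I \<and> set_pmf \<nu> \<subseteq> Pow J \<and> (\<exists>c a. (\<forall>i\<in>I. 0 \<le> a i) \<and>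
    (\<forall>U\<subseteq>J. pmf \<nu> U = c * (\<Sum>V\<in>Pow (I - J). pmf \<mu> (U \<union> V) * prod a (U \<union> V))))"
  using fp
proof induction
  case base
  have "pmf \<mu> U = 1 * (\<Sum>V\<in>Pow (I - I). pmf \<mu> (U \<union> V) * prod (\<lambda>_. 1) (U \<union> V))" for U
    by simp
  then show ?case using sub by (intro conjI exI[of _ 1] exI[of _ "\<lambda>_. 1"]) auto
next
  case (proj J \<nu> A)
  then obtain c a where a: "\<forall>i\<in>I. 0 \<le> a i"
    and \<nu>: "\<And>U. U \<subseteq> J \<Longrightarrow> pmf \<nu> U = c * (\<Sum>V\<in>Pow (I - J). pmf \<mu> (U \<union> V) * prod a (U \<union> V))"
    by blast
  have J: "J \<subseteq> I" "set_pmf \<nu> \<subseteq> Pow J" using proj by auto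
  have finJ: "finite J" using J fin finite_subset by blast
  have "pmf (projection A \<nu>) U = c * (\<Sum>V\<in>Pow (I - A). pmf \<mu> (U \<union> V) * prod a (U \<union> V))" if "U \<subseteq> A" for U
  proof -
    have "pmf (projection A \<nu>) U = (\<Sum>W\<in>Pow (J - A). pmf \<nu> (U \<union> W))"
      using finJ J proj.hyps that by (intro pmf_projection)
    also have "\<dots> = (\<Sum>W\<in>Pow (J - A). c * (\<Sum>V\<in>Pow (I - J). pmf \<mu> (U \<union> W \<union> V) * prod a (U \<union> W \<union> V)))"
      using that proj.hyps by (intro sum.cong refl \<nu>) auto
    also have "\<dots> = c * (\<Sum>W\<in>Pow (J - A). \<Sum>V\<in>Pow (I - J). pmf \<mu> (U \<union> (W \<union> V)) * prod a (U \<union> (W \<union> V)))"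
      by (simp add: sum_distrib_left Un_assoc)
    also have "\<dots> = c * (\<Sum>V\<in>Pow ((J - A) \<union> (I - J)). pmf \<mu> (U \<union> V) * prod a (U \<union> V))"
      by (subst sum_Pow_Un) auto
    also have "(J - A) \<union> (I - J) = I - A" using J proj.hyps by blast
    finally show ?thesis .
  qed
  with a have "\<exists>c a. (\<forall>i\<in>I. 0 \<le> a i) \<and> (\<forall>U\<subseteq>A. pmf (projection A \<nu>) U
      = c * (\<Sum>V\<in>Pow (I - A). pmf \<mu> (U \<union> V) * prod a (U \<union> V)))"
    by (intro exI[of _ c] exI[of _ a]) simp
  then show ?case using J proj.hyps set_pmf_projection[of A \<nu>] by (intro conjI) auto
next
  case (field J \<nu> x)
  then obtain c a where a: "\<forall>i\<in>I. 0 \<le> a i"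
    and \<nu>: "\<And>U. U \<subseteq> J \<Longrightarrow> pmf \<nu> U = c * (\<Sum>V\<in>Pow (I - J). pmf \<mu> (U \<union> V) * prod a (U \<union> V))"
    by blast
  have J: "J \<subseteq> I" "set_pmf \<nu> \<subseteq> Pow J" using field by auto
  have finJ: "finite J" using J fin finite_subset by blast
  obtain d where d: "\<And>S. pmf (external_field J x \<nu>) S = d * (pmf \<nu> S * prod x S)"
    using external_field_scaled[OF finJ J(2) field.hyps(2,3)] by blast
  define a' where "a' i = (if i \<in> J then a i * x i else a i)" for i
  have "pmf (external_field J x \<nu>) U = (d * c) * (\<Sum>V\<in>Pow (I - J). pmf \<mu> (U \<union> V) * prod a' (U \<union> V))"
    if U: "U \<subseteq> J" for U
  proof -
    have "prod a' (U \<union> V) = prod x U * prod a (U \<union> V)" if "V \<in> Pow (I - J)" for V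
    proof -
      have UV: "finite U" "finite V" "U \<inter> V = {}" using that U finJ fin finite_subset by blast+
      have "prod a' U = prod a U * prod x U"
        using U by (simp add: a'_def subset_iff flip: prod.distrib)
      moreover have "prod a' V = prod a V" using that by (intro prod.cong) (auto simp: a'_def)
      ultimately show ?thesis using UV by (simp add: prod.union_disjoint)
    qed
    then have "(\<Sum>V\<in>Pow (I - J). pmf \<mu> (U \<union> V) * prod a' (U \<union> V))
        = prod x U * (\<Sum>V\<in>Pow (I - J). pmf \<mu> (U \<union> V) * prod a (U \<union> V))"
      by (simp add: sum_distrib_left mult.left_commute)
    then show ?thesis using d \<nu>[OF U] by simp
  qed
  moreover have "\<forall>i\<in>I. 0 \<le> a' i" using a field.hyps(2) by (simp add: a'_def)
  ultimately have "\<exists>c a. (\<forall>i\<in>I. 0 \<le> a i) \<and> (\<forall>U\<subseteq>J. pmf (external_field J x \<nu>) U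
      = c * (\<Sum>V\<in>Pow (I - J). pmf \<mu> (U \<union> V) * prod a (U \<union> V)))"
    by (intro exI[of _ "d * c"] exI[of _ a']) simp
  then show ?case
    using J set_pmf_external_field[OF finJ J(2) field.hyps(2,3)] by (intro conjI)
qed

lemma CNA_plus_if_weight:
  assumes fin: "finite I" and sub: "set_pmf \<mu> \<subseteq> Pow I"
    and CNA: "\<And>a. (\<And>i. i \<in> I \<Longrightarrow> 0 \<le> a i) \<Longrightarrow> CNA_weight I (\<lambda>S. pmf \<mu> S * prod a S)"
  shows "CNA_plus I \<mu>"
  unfolding CNA_plus_def
proof (intro allI impI)
  fix J \<nu> assume "field_proj I \<mu> J \<nu>"
  from field_proj_weight[OF fin sub this] obtain c a where J: "J \<subseteq> I" "set_pmf \<nu> \<subseteq> Pow J"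
    and a: "\<forall>i\<in>I. 0 \<le> a i"
    and \<nu>: "\<And>U. U \<subseteq> J \<Longrightarrow> pmf \<nu> U = c * (\<Sum>V\<in>Pow (I - J). pmf \<mu> (U \<union> V) * prod a (U \<union> V))"
    by blast
  have "CNA_weight J (\<lambda>U. \<Sum>V\<in>Pow (I - J). pmf \<mu> (U \<union> V) * prod a (U \<union> V))"
    using a by (intro CNA_weight_projection[OF J(1)] CNA) auto
  then have "CNA_weight J (\<lambda>U. c * (\<Sum>V\<in>Pow (I - J). pmf \<mu> (U \<union> V) * prod a (U \<union> V)))"
    by (rule CNA_weight_scale)
  moreover have "CNA_weight J (pmf \<nu>)
      \<longleftrightarrow> CNA_weight J (\<lambda>U. c * (\<Sum>V\<in>Pow (I - J). pmf \<mu> (U \<union> V) * prod a (U \<union> V)))"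
    by (rule CNA_weight_cong) (rule \<nu>)
  ultimately have "CNA_weight J (pmf \<nu>)" by (rule iffD2[rotated])
  then show "CNA J \<nu>"
    using J fin by (subst CNA_iff_weight) (auto intro: finite_subset)
qed

lemma CNA_imp_h_NLC:
  assumes "finite I" "set_pmf \<mu> \<subseteq> Pow I" "CNA I \<mu>"
  shows "h_NLC I \<mu>"
  using assms by (simp add: CNA_iff_weight h_NLC_iff_weight CNA_weight_imp_h_NLC_weight)

lemma CNA_plus_imp_h_NLC_plus:
  assumes "finite I" "set_pmf \<mu> \<subseteq> Pow I" "CNA_plus I \<mu>"
  shows "h_NLC_plus I \<mu>"
  unfolding h_NLC_plus_def
proof (intro allI impI, elim conjE)
  fix a assume a: "\<forall>i\<in>I. 0 \<le> a i" "gen_poly I \<mu> a \<noteq> 0"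
  have "field_proj I \<mu> I (external_field I a \<mu>)"
    using a by (intro field_proj.field field_proj.base) auto
  then have "CNA I (external_field I a \<mu>)" using assms(3) by (simp add: CNA_plus_def)
  then show "h_NLC I (external_field I a \<mu>)"
    using assms a by (intro CNA_imp_h_NLC set_pmf_external_field) auto
qed

subsection \<open>The Rayleigh property\<close>

text \<open>For \<open>X \<subseteq> {i, j}\<close> this is the coefficient of the monomial of
  \<open>X\<close> when the generating polynomial is viewed as a polynomial in the two variables
  \<open>i\<close> and \<open>j\<close> alone, the others being evaluated at
  \<open>x\<close>.\<close>

definition pair_coeff :: "nat set \<Rightarrow> nat set pmf \<Rightarrow> nat \<Rightarrow> nat \<Rightarrow> nat set \<Rightarrow> (nat \<Rightarrow> real) \<Rightarrow> real" where
  "pair_coeff I \<mu> i j X x = (\<Sum>V\<in>Pow (I - {i, j}). pmf \<mu> (X \<union> V) * prod x V)"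

lemma pair_coeff_cong:
  assumes "\<And>l. l \<in> I - {i, j} \<Longrightarrow> x l = y l"
  shows "pair_coeff I \<mu> i j X x = pair_coeff I \<mu> i j X y"
proof -
  have "prod x V = prod y V" if "V \<subseteq> I - {i, j}" for V
    using assms that by (intro prod.cong) auto
  then show ?thesis by (simp add: pair_coeff_def)
qed

lemma pair_coeff_upd [simp]:
  "pair_coeff I \<mu> i j X (x(i := t)) = pair_coeff I \<mu> i j X x"
  "pair_coeff I \<mu> i j X (x(j := t)) = pair_coeff I \<mu> i j X x"
  by (rule pair_coeff_cong, auto)+

lemma sum_Pow_pair:
  fixes h :: "nat set \<Rightarrow> real"
  assumes "i \<noteq> j"
  shows "(\<Sum>X\<in>Pow {i, j}. h X) = h {} + h {i} + h {j} + h {i, j}"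
proof -
  have "Pow {i, j} = {{}, {i}, {j}, {i, j}}" by auto
  then show ?thesis using assms by (simp only:) (subst sum.insert; auto simp: doubleton_eq_iff)+
qed

lemma gen_poly_pair:
  assumes fin: "finite I" and ij: "i \<in> I" "j \<in> I" "i \<noteq> j"
  shows "gen_poly I \<mu> x = pair_coeff I \<mu> i j {} x + pair_coeff I \<mu> i j {i} x * x i
    + pair_coeff I \<mu> i j {j} x * x j + pair_coeff I \<mu> i j {i, j} x * (x i * x j)"
proof -
  have I: "I = {i, j} \<union> (I - {i, j})" using ij by blast
  have split: "prod x (X \<union> V) = prod x X * prod x V" if "X \<subseteq> {i, j}" "V \<subseteq> I - {i, j}" for X V
    using that fin by (intro prod.union_disjoint) (auto intro: finite_subset)
  have "gen_poly I \<mu> x = (\<Sum>X\<in>Pow {i, j}. \<Sum>V\<in>Pow (I - {i, j}). pmf \<mu> (X \<union> V) * prod x (X \<union> V))"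
    unfolding gen_poly_def by (subst I, rule sum_Pow_Un) blast
  also have "\<dots> = (\<Sum>X\<in>Pow {i, j}. pair_coeff I \<mu> i j X x * prod x X)"
    by (simp add: pair_coeff_def split sum_distrib_left sum_distrib_right ac_simps)
  finally show ?thesis using ij by (simp add: sum_Pow_pair)
qed

lemma partial_deriv_affine:
  assumes "\<And>t. f (x(i := t)) = p + q * t"
  shows "partial_deriv i f x = q"
proof -
  have "((\<lambda>t. f (x(i := t))) has_real_derivative q) (at (x i))"
    unfolding assms by (auto intro!: derivative_eq_intros)
  then show ?thesis unfolding partial_deriv_def by (rule DERIV_imp_deriv)
qed

lemma pair_coeff_swap: "pair_coeff I \<mu> j i X x = pair_coeff I \<mu> i j X x"
  by (simp add: pair_coeff_def insert_commute)

lemma partial_deriv_gen_poly: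
  assumes "finite I" "i \<in> I" "j \<in> I" "i \<noteq> j"
  shows "partial_deriv i (gen_poly I \<mu>) x = pair_coeff I \<mu> i j {i} x + pair_coeff I \<mu> i j {i, j} x * x j"
  by (rule partial_deriv_affine[where p = "pair_coeff I \<mu> i j {} x + pair_coeff I \<mu> i j {j} x * x j"])
    (use assms in \<open>simp add: gen_poly_pair[OF assms] algebra_simps\<close>)

lemma partial_deriv2_gen_poly:
  assumes "finite I" "i \<in> I" "j \<in> I" "i \<noteq> j"
  shows "partial_deriv i (partial_deriv j (gen_poly I \<mu>)) x = pair_coeff I \<mu> i j {i, j} x"
proof (rule partial_deriv_affine)
  fix t
  have "j \<noteq> i" using assms by simp
  from partial_deriv_gen_poly[OF assms(1,3,2) this, of \<mu> "x(i := t)"]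
  show "partial_deriv j (gen_poly I \<mu>) (x(i := t)) = pair_coeff I \<mu> i j {j} x + pair_coeff I \<mu> i j {i, j} x * t"
    by (simp add: pair_coeff_swap[of I \<mu> j i] insert_commute)
qed

lemma gen_poly_affine:
  assumes "finite I" "i \<in> I"
  shows "gen_poly I \<mu> (x(i := t)) = gen_poly (I - {i}) \<mu> x
    + (\<Sum>V\<in>Pow (I - {i}). pmf \<mu> (insert i V) * prod x V) * t"
proof -
  have I: "I = {i} \<union> (I - {i})" using assms by blast
  have 1: "prod (x(i := t)) V = prod x V" if "V \<subseteq> I - {i}" for V
    using that by (intro prod.cong) auto
  have 2: "prod (x(i := t)) (insert i V) = t * prod x V" if "V \<subseteq> I - {i}" for V
  proof -
    have "finite V" "i \<notin> V" using that assms(1) by (auto intro: finite_subset)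
    then show ?thesis using 1[OF that] by simp
  qed
  have "gen_poly I \<mu> (x(i := t)) = (\<Sum>X\<in>Pow {i}. \<Sum>V\<in>Pow (I - {i}). pmf \<mu> (X \<union> V) * prod (x(i := t)) (X \<union> V))"
    unfolding gen_poly_def by (subst I, rule sum_Pow_Un) blast
  also have "\<dots> = (\<Sum>V\<in>Pow (I - {i}). pmf \<mu> V * prod x V)
      + (\<Sum>V\<in>Pow (I - {i}). pmf \<mu> (insert i V) * (t * prod x V))"
    by (simp add: Pow_insert 1 2 del: fun_upd_apply)
  finally show ?thesis by (simp add: gen_poly_def sum_distrib_left sum_distrib_right ac_simps)
qed

text \<open>For \<open>i \<noteq> j\<close> all terms containing \<open>x i\<close> or
  \<open>x j\<close> cancel from the Rayleigh difference, leaving a 2 by 2 determinant of the four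
  coefficients. For \<open>i = j\<close> the second derivative vanishes, as the polynomial is affine
  in each variable, and the condition says that a square is nonnegative.\<close>

lemma Rayleigh_iff_pair_coeff:
  assumes fin: "finite I"
  shows "Rayleigh I \<mu> \<longleftrightarrow> (\<forall>x. (\<forall>i\<in>I. 0 < x i) \<longrightarrow> (\<forall>i\<in>I. \<forall>j\<in>I. i \<noteq> j \<longrightarrow>
    pair_coeff I \<mu> i j {i, j} x * pair_coeff I \<mu> i j {} x
      \<le> pair_coeff I \<mu> i j {i} x * pair_coeff I \<mu> i j {j} x))"
proof -
  let ?g = "gen_poly I \<mu>"
  have "partial_deriv i (partial_deriv j ?g) x * ?g x \<le> partial_deriv i ?g x * partial_deriv j ?g x
      \<longleftrightarrow> (i \<noteq> j \<longrightarrow> pair_coeff I \<mu> i j {i, j} x * pair_coeff I \<mu> i j {} x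
        \<le> pair_coeff I \<mu> i j {i} x * pair_coeff I \<mu> i j {j} x)" if ij: "i \<in> I" "j \<in> I" for i j x
  proof (cases "i = j")
    case True
    define q where "q x = (\<Sum>V\<in>Pow (I - {i}). pmf \<mu> (insert i V) * prod x V)" for x :: "nat \<Rightarrow> real"
    have "partial_deriv i ?g y = q y" for y
      unfolding q_def by (rule partial_deriv_affine) (rule gen_poly_affine[OF fin ij(1)])
    moreover have "q (y(i := t)) = q y" for y t
      unfolding q_def by (intro sum.cong refl arg_cong2[where f = "(*)"] prod.cong) auto
    ultimately have "partial_deriv i (partial_deriv i ?g) x = 0"
      by (intro partial_deriv_affine[where p = "q x" and q = 0]) simp
    then show ?thesis using True by simp
  next
    case False
    have "partial_deriv j ?g x = pair_coeff I \<mu> i j {j} x + pair_coeff I \<mu> i j {i, j} x * x i"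
      using partial_deriv_gen_poly[OF fin ij(2,1)] False
      by (simp add: pair_coeff_swap[of I \<mu> j i] insert_commute)
    then show ?thesis
      using False partial_deriv_gen_poly[OF fin ij False] partial_deriv2_gen_poly[OF fin ij False]
        gen_poly_pair[OF fin ij False]
      by (simp add: algebra_simps)
  qed
  then show ?thesis unfolding Rayleigh_def by (auto simp: Ball_def)
qed

text \<open>The difference of the two sides is \<open>(s - x i) * (t - x j)\<close> times the
  determinant of pair coefficients: the Rayleigh property in finite-difference form.\<close>

lemma Rayleigh_gen_poly_le:
  assumes fin: "finite I" and R: "Rayleigh I \<mu>" and x: "\<And>l. l \<in> I \<Longrightarrow> 0 < x l"
    and ij: "i \<in> I" "j \<in> I" "i \<noteq> j" and st: "x i \<le> s" "x j \<le> t"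
  shows "gen_poly I \<mu> (x(i := s, j := t)) * gen_poly I \<mu> x
    \<le> gen_poly I \<mu> (x(i := s)) * gen_poly I \<mu> (x(j := t))"
proof -
  have "pair_coeff I \<mu> i j {i, j} x * pair_coeff I \<mu> i j {} x
      \<le> pair_coeff I \<mu> i j {i} x * pair_coeff I \<mu> i j {j} x"
    using R x ij by (simp add: Rayleigh_iff_pair_coeff[OF fin])
  then have "0 \<le> ((s - x i) * (t - x j)) * (pair_coeff I \<mu> i j {i} x * pair_coeff I \<mu> i j {j} x
      - pair_coeff I \<mu> i j {i, j} x * pair_coeff I \<mu> i j {} x)"
    using st by simp
  then show ?thesis
    using ij by (simp add: gen_poly_pair[OF fin ij] algebra_simps)
qed

text \<open>With the coordinates in \<open>A\<close> divided by \<open>s\<close> on \<open>U\<close> and multiplied by \<open>s\<close> off \<open>U\<close>, the function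
  \<open>s ^ card U * g\<^sub>\<mu>\<close> of \<open>U\<close> tends to the projection onto \<open>A\<close> as \<open>s\<close> tends to \<open>0\<close>. For \<open>s > 0\<close> it is
  positive, so that the local inequalities suffice; \<open>s\<close> is also added to \<open>a\<close> because \<open>a\<close> may vanish.\<close>

lemma Rayleigh_imp_h_NLC_weight:
  assumes fin: "finite I" and sub: "set_pmf \<mu> \<subseteq> Pow I" and R: "Rayleigh I \<mu>"
    and a: "\<And>i. i \<in> I \<Longrightarrow> 0 \<le> a i"
  shows "h_NLC_weight I (\<lambda>S. pmf \<mu> S * prod a S)"
  unfolding h_NLC_weight_def
proof (intro allI impI)
  fix A assume A: "A \<subseteq> I"
  have finA: "finite A" using A fin finite_subset by blast
  define x where "x s U i = (if i \<in> A then if i \<in> U then (a i + s) / s else (a i + s) * s else a i + s)"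
    for s :: real and U i
  define f where "f s U = gen_poly I \<mu> (x s U)" for s U
  define h where "h s U = s ^ card U * f s U" for s U
  have xpos: "0 < x s U i" if "0 < s" "i \<in> I" for s U i
    using a[OF that(2)] that(1) by (simp add: x_def add_nonneg_pos)
  \<comment> \<open>For \<open>s < 1\<close>, putting a point \<open>l\<close> into \<open>U\<close>
    raises its coordinate from \<open>(a l + s) * s\<close> to \<open>(a l + s) / s\<close>, so the
    local inequalities are instances of the finite-difference form.\<close>
  have NLCf: "NLC_weight A (f s)" if s: "0 < s" "s < 1" for s
  proof (rule NLC_weight_if_local[OF finA])
    show "0 \<le> f s S" for S
      unfolding f_def by (intro less_imp_le gen_poly_pos[OF fin sub] xpos s)
    show "0 < f s S" for S
      unfolding f_def by (intro gen_poly_pos[OF fin sub] xpos s)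
    fix P i j assume P: "P \<subseteq> A" "i \<in> A - P" "j \<in> A - P" "i \<noteq> j"
    have le: "(a l + s) * s \<le> (a l + s) / s" if "l \<in> A" for l
    proof -
      have "s * s \<le> 1" using s mult_le_one[of s s] by simp
      then have "(a l + s) * (s * s) \<le> (a l + s) * 1"
        using a[of l] that A s by (intro mult_left_mono) auto
      then show ?thesis using s by (simp add: field_simps)
    qed
    have upd: "x s (insert l U) = (x s U)(l := (a l + s) / s)" if "l \<in> A" for l U
      using that by (auto simp: x_def fun_eq_iff)
    have val: "x s P l = (a l + s) * s" if "l \<in> A - P" for l
      using that by (simp add: x_def)
    have "f s (insert j (insert i P)) * f s P \<le> f s (insert i P) * f s (insert j P)"
      using P A le val unfolding f_def
      by (simp add: upd) (rule Rayleigh_gen_poly_le[OF fin R xpos[OF s(1)]]; auto)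
    then show "f s (insert i (insert j P)) * f s P \<le> f s (insert i P) * f s (insert j P)"
      by (simp add: insert_commute)
  qed
  have NLCh: "NLC_weight A (h s)" if s: "0 < s" "s < 1" for s
    unfolding NLC_weight_def
  proof (intro allI impI)
    fix S T assume ST: "S \<subseteq> A" "T \<subseteq> A"
    have "card (S \<union> T) + card (S \<inter> T) = card S + card T"
      using ST finA by (intro card_Un_Int[symmetric]) (auto intro: finite_subset)
    then have "s ^ card (S \<union> T) * s ^ card (S \<inter> T) = s ^ card S * s ^ card T"
      by (simp flip: power_add)
    then have "h s (S \<union> T) * h s (S \<inter> T) = (s ^ card S * s ^ card T) * (f s (S \<union> T) * f s (S \<inter> T))"
      by (simp add: h_def ac_simps)
    also have "\<dots> \<le> (s ^ card S * s ^ card T) * (f s S * f s T)"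
      using NLC_weightD[OF NLCf[OF s] ST] s by (intro mult_left_mono) auto
    finally show "h s (S \<union> T) * h s (S \<inter> T) \<le> h s S * h s T" by (simp add: h_def ac_simps)
  qed
  \<comment> \<open>\<open>y s U W i\<close> is what the point \<open>i\<close> contributes to
    \<open>s ^ card U * prod (x s U) W\<close>. The division by \<open>s\<close> has cancelled, so
    the limit at 0 can be taken factor by factor.\<close>
  define y where "y s U W i = (if i \<in> W then if i \<in> U then a i + s else (a i + s) * s else if i \<in> U then s else 1)"
    for s :: real and U W i
  have hy: "h s U = (\<Sum>W\<in>Pow A. \<Sum>V\<in>Pow (I - A). pmf \<mu> (W \<union> V) * (prod (\<lambda>i. a i + s) V * prod (y s U W) A))"
    if s: "0 < s" and U: "U \<subseteq> A" for s U
  proof -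
    have term_eq: "s ^ card U * (pmf \<mu> (W \<union> V) * prod (x s U) (W \<union> V))
        = pmf \<mu> (W \<union> V) * (prod (\<lambda>i. a i + s) V * prod (y s U W) A)"
      if W: "W \<subseteq> A" and V: "V \<subseteq> I - A" for W V
    proof -
      have WV: "finite W" "finite V" "W \<inter> V = {}"
        using W V finA fin by (auto intro: finite_subset)
      have "prod (x s U) V = prod (\<lambda>i. a i + s) V"
        using V by (intro prod.cong) (auto simp: x_def)
      moreover have "s ^ card U * prod (x s U) W = prod (y s U W) A"
      proof -
        have "s ^ card U = (\<Prod>i\<in>A. if i \<in> U then s else 1)"
          using U finA by (simp add: prod.If_cases Int_absorb1)
        moreover have "prod (x s U) W = (\<Prod>i\<in>A. if i \<in> W then x s U i else 1)"
          using W finA by (simp add: prod.If_cases Int_absorb1)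
        ultimately have "s ^ card U * prod (x s U) W
            = (\<Prod>i\<in>A. (if i \<in> U then s else 1) * (if i \<in> W then x s U i else 1))"
          by (simp add: prod.distrib)
        also have "\<dots> = prod (y s U W) A"
          using s by (intro prod.cong) (auto simp: x_def y_def)
        finally show ?thesis .
      qed
      ultimately show ?thesis using WV by (simp add: prod.union_disjoint ac_simps)
    qed
    have I: "I = A \<union> (I - A)" using A by blast
    have "h s U = (\<Sum>S\<in>Pow I. s ^ card U * (pmf \<mu> S * prod (x s U) S))"
      by (simp add: h_def f_def gen_poly_def sum_distrib_left)
    also have "\<dots> = (\<Sum>W\<in>Pow A. \<Sum>V\<in>Pow (I - A). s ^ card U * (pmf \<mu> (W \<union> V) * prod (x s U) (W \<union> V)))"
      by (subst I, rule sum_Pow_Un) blast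
    finally show ?thesis by (simp add: term_eq)
  qed
  define w where "w U = (\<Sum>V\<in>Pow (I - A). pmf \<mu> (U \<union> V) * prod a (U \<union> V))" for U
  have lim: "((\<lambda>s. h s U) \<longlongrightarrow> w U) (at_right 0)" if U: "U \<subseteq> A" for U
  proof -
    \<comment> \<open>The limiting factor is zero at each point of the symmetric difference of
      \<open>U\<close> and \<open>W\<close>, so only the term \<open>W = U\<close> survives.\<close>
    define y0 where "y0 W i = (if i \<in> W then if i \<in> U then a i + 0 else (a i + 0) * 0 else if i \<in> U then 0 else 1)"
      for W i
    have "((\<lambda>s. y s U W i) \<longlongrightarrow> y0 W i) (at_right 0)" for W i
      unfolding y_def y0_def by (auto intro!: tendsto_eq_intros)
    then have "((\<lambda>s. \<Sum>W\<in>Pow A. \<Sum>V\<in>Pow (I - A). pmf \<mu> (W \<union> V) * (prod (\<lambda>i. a i + s) V * prod (y s U W) A))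
        \<longlongrightarrow> (\<Sum>W\<in>Pow A. \<Sum>V\<in>Pow (I - A). pmf \<mu> (W \<union> V) * (prod (\<lambda>i. a i + 0) V * prod (y0 W) A))) (at_right 0)"
      by (intro tendsto_intros)
    moreover have "(\<Sum>W\<in>Pow A. \<Sum>V\<in>Pow (I - A). pmf \<mu> (W \<union> V) * (prod (\<lambda>i. a i + 0) V * prod (y0 W) A)) = w U"
    proof -
      have y0: "prod (y0 W) A = (if W = U then prod a U else 0)" if "W \<subseteq> A" for W
      proof (cases "W = U")
        case True
        then have "prod (y0 W) A = (\<Prod>i\<in>A. if i \<in> U then a i else 1)"
          by (intro prod.cong) (auto simp: y0_def)
        then show ?thesis using True U finA by (simp add: prod.If_cases Int_absorb1)
      next
        case False
        then obtain i where i: "(i \<in> W) \<noteq> (i \<in> U)" by blast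
        then have "i \<in> A" using U that by blast
        moreover have "y0 W i = 0" using i by (simp add: y0_def)
        ultimately have "prod (y0 W) A = 0" using finA by (intro prod_zero bexI)
        then show ?thesis using False by simp
      qed
      have "(\<Sum>W\<in>Pow A. \<Sum>V\<in>Pow (I - A). pmf \<mu> (W \<union> V) * (prod (\<lambda>i. a i + 0) V * prod (y0 W) A))
          = (\<Sum>W\<in>Pow A. if W = U then \<Sum>V\<in>Pow (I - A). pmf \<mu> (U \<union> V) * (prod a V * prod a U) else 0)"
        by (intro sum.cong refl) (auto simp: y0)
      also have "\<dots> = (\<Sum>V\<in>Pow (I - A). pmf \<mu> (U \<union> V) * (prod a V * prod a U))"
        using U finA by (simp add: sum.delta)
      also have "\<dots> = w U"
        unfolding w_def
      proof (intro sum.cong refl)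
        fix V assume "V \<in> Pow (I - A)"
        then have "finite U" "finite V" "U \<inter> V = {}"
          using U finA fin by (auto intro: finite_subset)
        then show "pmf \<mu> (U \<union> V) * (prod a V * prod a U) = pmf \<mu> (U \<union> V) * prod a (U \<union> V)"
          by (simp add: prod.union_disjoint mult.commute)
      qed
      finally show ?thesis .
    qed
    moreover have "\<forall>\<^sub>F s in at_right 0. h s U
        = (\<Sum>W\<in>Pow A. \<Sum>V\<in>Pow (I - A). pmf \<mu> (W \<union> V) * (prod (\<lambda>i. a i + s) V * prod (y s U W) A))"
      using hy[OF _ U] by (auto simp: eventually_at_right_field intro!: exI[of _ 1])
    ultimately show ?thesis by (simp add: tendsto_cong)
  qed
  have "NLC_weight A w"
    unfolding NLC_weight_def
  proof (intro allI impI)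
    fix S T assume ST: "S \<subseteq> A" "T \<subseteq> A"
    show "w (S \<union> T) * w (S \<inter> T) \<le> w S * w T"
    proof (rule tendsto_le)
      show "((\<lambda>s. h s S * h s T) \<longlongrightarrow> w S * w T) (at_right 0)"
        "((\<lambda>s. h s (S \<union> T) * h s (S \<inter> T)) \<longlongrightarrow> w (S \<union> T) * w (S \<inter> T)) (at_right 0)"
        using ST by (intro tendsto_mult lim; blast)+
      show "\<forall>\<^sub>F s in at_right 0. h s (S \<union> T) * h s (S \<inter> T) \<le> h s S * h s T"
        using NLC_weightD[OF NLCh ST] by (auto simp: eventually_at_right_field intro!: exI[of _ 1])
    qed simp
  qed
  then show "NLC_weight A (\<lambda>U. \<Sum>V\<in>Pow (I - A). pmf \<mu> (U \<union> V) * prod a (U \<union> V))"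
    by (simp add: w_def[abs_def])
qed

text \<open>From h-NLC+ to Rayleigh, impose the field \<open>x\<close> and project onto
  \<open>{i, j}\<close>: the lattice condition for the two singletons is the inequality of pair
  coefficients multiplied by \<open>x i * x j\<close>.\<close>

lemma h_NLC_plus_iff_Rayleigh:
  assumes fin: "finite I" and sub: "set_pmf \<mu> \<subseteq> Pow I"
  shows "h_NLC_plus I \<mu> \<longleftrightarrow> Rayleigh I \<mu>"
proof
  assume "Rayleigh I \<mu>"
  then show "h_NLC_plus I \<mu>"
    unfolding h_NLC_plus_def
    by (auto simp: h_NLC_external_field_iff[OF fin sub] intro!: Rayleigh_imp_h_NLC_weight[OF fin sub])
next
  assume h: "h_NLC_plus I \<mu>"
  have "pair_coeff I \<mu> i j {i, j} x * pair_coeff I \<mu> i j {} x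
      \<le> pair_coeff I \<mu> i j {i} x * pair_coeff I \<mu> i j {j} x"
    if x: "\<And>l. l \<in> I \<Longrightarrow> 0 < x l" and ij: "i \<in> I" "j \<in> I" "i \<noteq> j" for x i j
  proof -
    have xnn: "0 \<le> x l" if "l \<in> I" for l using x[OF that] by simp
    have "0 < gen_poly I \<mu> x" by (rule gen_poly_pos[OF fin sub]) (rule x)
    then have "h_NLC_weight I (\<lambda>S. pmf \<mu> S * prod x S)"
      using h xnn by (simp add: h_NLC_plus_def flip: h_NLC_external_field_iff[OF fin sub])
    then have NLC: "NLC_weight {i, j} (\<lambda>U. \<Sum>V\<in>Pow (I - {i, j}). pmf \<mu> (U \<union> V) * prod x (U \<union> V))"
      using ij by (simp add: h_NLC_weight_def)
    have "(\<Sum>V\<in>Pow (I - {i, j}). pmf \<mu> (U \<union> V) * prod x (U \<union> V)) = pair_coeff I \<mu> i j U x * prod x U"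
      if "U \<subseteq> {i, j}" for U
    proof -
      have "prod x (U \<union> V) = prod x V * prod x U" if "V \<in> Pow (I - {i, j})" for V
        using that fin \<open>U \<subseteq> {i, j}\<close>
        by (subst prod.union_disjoint) (auto intro: finite_subset simp: mult.commute)
      then show ?thesis by (simp add: pair_coeff_def sum_distrib_right mult.assoc)
    qed
    from NLC_weight_cong[OF this] NLC
    have "NLC_weight {i, j} (\<lambda>U. pair_coeff I \<mu> i j U x * prod x U)" by (rule iffD1)
    from NLC_weightD[OF this, of "{i}" "{j}"]
    have "(x i * x j) * (pair_coeff I \<mu> i j {i, j} x * pair_coeff I \<mu> i j {} x)
        \<le> (x i * x j) * (pair_coeff I \<mu> i j {i} x * pair_coeff I \<mu> i j {j} x)"
      using ij by (simp add: ac_simps insert_commute)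
    moreover have "0 < x i * x j" using x ij by simp
    ultimately show ?thesis by (simp only: mult_le_cancel_left_pos)
  qed
  then show "Rayleigh I \<mu>" by (simp add: Rayleigh_iff_pair_coeff[OF fin])
qed

subsection \<open>Almost symmetric measures\<close>

text \<open>At the indicator vector of \<open>V\<close> the generating polynomial is the total mass
  of the subsets of \<open>V\<close>. Invariance of these totals passes to single sets by induction
  over proper subsets, as in Moebius inversion.\<close>

lemma pmf_image_permutes:
  assumes fin: "finite I" and perm: "\<pi> permutes I"
    and sym: "\<And>z. gen_poly I \<mu> (z \<circ> \<pi>) = gen_poly I \<mu> z" and V: "V \<subseteq> I"
  shows "pmf \<mu> (\<pi> ` V) = pmf \<mu> V"
proof -
  have inj: "inj \<pi>" using perm by (rule permutes_inj)
  have g: "gen_poly I \<mu> (\<lambda>i. if i \<in> V then 1 else 0) = (\<Sum>S\<in>Pow V. pmf \<mu> S)" if "V \<subseteq> I" for V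
  proof -
    have "gen_poly I \<mu> (\<lambda>i. if i \<in> V then 1 else 0) = (\<Sum>S\<in>Pow I. if S \<subseteq> V then pmf \<mu> S else 0)"
      unfolding gen_poly_def
    proof (intro sum.cong refl)
      fix S assume "S \<in> Pow I"
      then have "finite S" using fin finite_subset by auto
      then show "pmf \<mu> S * (\<Prod>i\<in>S. if i \<in> V then 1 else 0) = (if S \<subseteq> V then pmf \<mu> S else 0)"
        by (auto intro!: prod.neutral prod_zero)
    qed
    also have "\<dots> = (\<Sum>S\<in>Pow V. pmf \<mu> S)"
      using that fin by (intro sum.mono_neutral_cong_right) auto
    finally show ?thesis .
  qed
  define d where "d S = pmf \<mu> (\<pi> ` S) - pmf \<mu> S" for S
  have sum_d: "sum d (Pow V) = 0" if "V \<subseteq> I" for V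
  proof -
    have "\<pi> ` V \<subseteq> I" using that perm permutes_image by blast
    have "(\<lambda>i. if i \<in> \<pi> ` V then 1 else 0) \<circ> \<pi> = (\<lambda>i. if i \<in> V then 1 else 0 :: real)"
      using inj by (auto simp: fun_eq_iff inj_image_mem_iff)
    then have "(\<Sum>S\<in>Pow (\<pi> ` V). pmf \<mu> S) = (\<Sum>S\<in>Pow V. pmf \<mu> S)"
      using sym[of "\<lambda>i. if i \<in> \<pi> ` V then 1 else 0"] g[OF that] g[OF \<open>\<pi> ` V \<subseteq> I\<close>] by simp
    moreover have "(\<Sum>S\<in>Pow (\<pi> ` V). pmf \<mu> S) = (\<Sum>S\<in>Pow V. pmf \<mu> (\<pi> ` S))"
    proof -
      have "Pow (\<pi> ` V) = (`) \<pi> ` Pow V" by (simp add: image_Pow_surj)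
      moreover have "inj_on ((`) \<pi>) (Pow V)" using inj by (intro inj_on_image_Pow) (rule inj_on_subset, auto)
      ultimately show ?thesis by (simp add: sum.reindex)
    qed
    ultimately show ?thesis by (simp add: d_def sum_subtractf)
  qed
  have "finite V" using V fin finite_subset by blast
  then have "V \<subseteq> I \<longrightarrow> d V = 0"
  proof (induction V rule: finite_psubset_induct)
    case (psubset V)
    show ?case
    proof
      assume VI: "V \<subseteq> I"
      have "sum d (Pow V) = d V + sum d (Pow V - {V})"
        using psubset.hyps by (intro sum.remove) auto
      moreover have "sum d (Pow V - {V}) = 0"
        using psubset.IH VI by (intro sum.neutral) auto
      ultimately show "d V = 0" using sum_d[OF VI] by simp
    qed
  qed
  then show ?thesis using V by (simp add: d_def)
qed

lemma permutes_mapping_subset: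
  assumes fin: "finite J" and ST: "S \<subseteq> J" "T \<subseteq> J" "card S = card T"
  obtains \<pi> where "\<pi> permutes J" "\<pi> ` S = T"
proof -
  have finS: "finite S" "finite T" using ST fin finite_subset by blast+
  obtain f where f: "bij_betw f S T" using finite_same_card_bij[OF finS ST(3)] by blast
  have "card (J - S) = card (J - T)" using ST finS by (simp add: card_Diff_subset)
  then obtain g where g: "bij_betw g (J - S) (J - T)"
    using finite_same_card_bij[of "J - S" "J - T"] fin by auto
  define \<pi> where "\<pi> x = (if x \<in> S then f x else if x \<in> J then g x else x)" for x
  have "bij_betw \<pi> S T" using f by (subst bij_betw_cong[where g = f]) (auto simp: \<pi>_def)
  moreover have "bij_betw \<pi> (J - S) (J - T)"
    using g by (subst bij_betw_cong[where g = g]) (auto simp: \<pi>_def)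
  ultimately have "bij_betw \<pi> (S \<union> (J - S)) (T \<union> (J - T))" by (rule bij_betw_combine) blast
  moreover have "S \<union> (J - S) = J" "T \<union> (J - T) = J" using ST by auto
  ultimately have "\<pi> permutes J"
    using ST by (intro bij_imp_permutes) (auto simp: \<pi>_def)
  moreover have "\<pi> ` S = T" using \<open>bij_betw \<pi> S T\<close> by (simp add: bij_betw_def)
  ultimately show ?thesis by (rule that)
qed

text \<open>Two sets of equal size off \<open>k\<close> that agree at \<open>k\<close> are exchanged
  by a permutation fixing \<open>k\<close>, so one representative \<open>R j\<close> of each size
  determines both rows. The rows are padded with zeros beyond the largest size.\<close>

lemma almost_symmetric_two_row:
  assumes fin: "finite I" and sub: "set_pmf \<mu> \<subseteq> Pow I" and sym: "almost_symmetric I \<mu>"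
  shows "\<exists>k a b. (\<forall>S\<subseteq>I. pmf \<mu> S = (if k \<in> S then b else a) (card (S - {k})))
    \<and> (\<forall>j. 0 \<le> a j \<and> 0 \<le> b j \<and> (card (I - {k}) < j \<longrightarrow> a j = 0 \<and> b j = 0) \<and> (k \<notin> I \<longrightarrow> b j = 0))"
proof -
  obtain k where k: "\<And>\<pi> z. \<pi> permutes (I - {k}) \<Longrightarrow> gen_poly I \<mu> (z \<circ> \<pi>) = gen_poly I \<mu> z"
    using sym unfolding almost_symmetric_def by blast
  define J where "J = I - {k}"
  have finJ: "finite J" and JI: "J \<subseteq> I" and kJ: "k \<notin> J" using fin by (auto simp: J_def)
  have inv: "pmf \<mu> (S \<union> K) = pmf \<mu> (T \<union> K)"
    if ST: "S \<subseteq> J" "T \<subseteq> J" "card S = card T" and K: "K \<subseteq> {k}" "K \<subseteq> I" for S T K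
  proof -
    obtain \<pi> where \<pi>: "\<pi> permutes J" "\<pi> ` S = T"
      using permutes_mapping_subset[OF finJ ST] by blast
    have "\<pi> k = k" using \<pi>(1) kJ by (rule permutes_not_in)
    then have "\<pi> ` K = K" using subset_singletonD[OF K(1)] by auto
    then have "\<pi> ` (S \<union> K) = T \<union> K" using \<pi>(2) by (simp add: image_Un)
    moreover have "pmf \<mu> (\<pi> ` (S \<union> K)) = pmf \<mu> (S \<union> K)"
    proof (rule pmf_image_permutes[OF fin])
      show "\<pi> permutes I" using \<pi>(1) JI by (rule permutes_subset)
      show "gen_poly I \<mu> (z \<circ> \<pi>) = gen_poly I \<mu> z" for z using k \<pi>(1) by (simp add: J_def)
    qed (use ST K JI in auto)
    ultimately show ?thesis by simp
  qed
  have "\<exists>R. j \<le> card J \<longrightarrow> R \<subseteq> J \<and> card R = j" for j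
    by (meson obtain_subset_with_card_n)
  then obtain R where R: "\<And>j. j \<le> card J \<Longrightarrow> R j \<subseteq> J \<and> card (R j) = j" by metis
  define a where "a j = (if j \<le> card J then pmf \<mu> (R j) else 0)" for j
  define b where "b j = (if j \<le> card J \<and> k \<in> I then pmf \<mu> (R j \<union> {k}) else 0)" for j
  have "pmf \<mu> S = (if k \<in> S then b else a) (card (S - {k}))" if S: "S \<subseteq> I" for S
  proof -
    define S' where "S' = S - {k}"
    have S': "S' \<subseteq> J" using S by (auto simp: S'_def J_def)
    then have le: "card S' \<le> card J" using finJ by (intro card_mono)
    have r: "R (card S') \<subseteq> J" "card S' = card (R (card S'))" using R[OF le] by auto
    show ?thesis
    proof (cases "k \<in> S")
      case True
      then have "S = S' \<union> {k}" by (auto simp: S'_def)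
      then have "pmf \<mu> S = pmf \<mu> (R (card S') \<union> {k})"
        using inv[OF S' r, of "{k}"] True S by auto
      then show ?thesis using True S le by (auto simp: b_def S'_def)
    next
      case False
      then have "S = S'" by (auto simp: S'_def)
      then have "pmf \<mu> S = pmf \<mu> (R (card S'))" using inv[OF S' r, of "{}"] by simp
      then show ?thesis using False le by (simp add: a_def S'_def)
    qed
  qed
  moreover have "0 \<le> a j \<and> 0 \<le> b j \<and> (card (I - {k}) < j \<longrightarrow> a j = 0 \<and> b j = 0) \<and> (k \<notin> I \<longrightarrow> b j = 0)" for j
    unfolding J_def[symmetric] by (simp add: a_def b_def)
  ultimately have "(\<forall>S\<subseteq>I. pmf \<mu> S = (if k \<in> S then b else a) (card (S - {k})))
    \<and> (\<forall>j. 0 \<le> a j \<and> 0 \<le> b j \<and> (card (I - {k}) < j \<longrightarrow> a j = 0 \<and> b j = 0) \<and> (k \<notin> I \<longrightarrow> b j = 0))"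
    by (rule conjI[OF allI[OF impI] allI])
  then show ?thesis by (intro exI)
qed

text \<open>The lattice condition yields the inequalities for the pair \<open>(a, b)\<close> itself,
  which is the case of the constant field 1 in \<open>CNA_weight_two_row\<close>.\<close>

lemma almost_symmetric_h_NLC_imp_CNA:
  assumes fin: "finite I" and sub: "set_pmf \<mu> \<subseteq> Pow I" and sym: "almost_symmetric I \<mu>"
    and h: "h_NLC I \<mu>"
  shows "CNA I \<mu>"
proof -
  obtain k a b where two_row: "(\<forall>S\<subseteq>I. pmf \<mu> S = (if k \<in> S then b else a) (card (S - {k})))
      \<and> (\<forall>j. 0 \<le> a j \<and> 0 \<le> b j \<and> (card (I - {k}) < j \<longrightarrow> a j = 0 \<and> b j = 0) \<and> (k \<notin> I \<longrightarrow> b j = 0))"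
    using almost_symmetric_two_row[OF fin sub sym] by (elim exE)
  have w: "pmf \<mu> S = (if k \<in> S then b else a) (card (S - {k}))" if "S \<subseteq> I" for S
    by (rule conjunct1[OF two_row, rule_format, OF that])
  have ab: "0 \<le> a j" "0 \<le> b j" "card (I - {k}) < j \<Longrightarrow> a j = 0"
    "card (I - {k}) < j \<Longrightarrow> b j = 0" "k \<notin> I \<Longrightarrow> b j = 0" for j
    using conjunct2[OF two_row, THEN spec, of j] by simp_all
  have "h_NLC_weight I (pmf \<mu>)" using h h_NLC_iff_weight[OF fin sub] by simp
  note lc = h_NLC_weight_two_row[OF fin w ab(1,3,2,4,5) this]
  have "CNA_weight I (\<lambda>S. prod (\<lambda>_. 1) S * (if k \<in> S then b else a) (card (S - {k})))"
    using lc by (intro CNA_weight_two_row[OF fin]) (simp_all add: ab)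
  then have "CNA_weight I (\<lambda>S. (if k \<in> S then b else a) (card (S - {k})))" by simp
  with CNA_weight_cong[OF w] have "CNA_weight I (pmf \<mu>)" by (rule iffD2)
  then show ?thesis using CNA_iff_weight[OF fin sub] by simp
qed

text \<open>An external field at the distinguished coordinate alone keeps \<open>\<mu>\<close> almost symmetric and turns
  the pair \<open>(a, b)\<close> into \<open>(a, z b)\<close>, so that \<open>a + z b\<close> is log-concave for every \<open>z > 0\<close>.\<close>

lemma almost_symmetric_h_NLC_plus_imp_CNA_plus:
  assumes fin: "finite I" and sub: "set_pmf \<mu> \<subseteq> Pow I" and sym: "almost_symmetric I \<mu>"
    and h: "h_NLC_plus I \<mu>"
  shows "CNA_plus I \<mu>"
proof (rule CNA_plus_if_weight[OF fin sub])
  fix y :: "nat \<Rightarrow> real" assume y: "\<And>i. i \<in> I \<Longrightarrow> 0 \<le> y i"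
  obtain k a b where two_row: "(\<forall>S\<subseteq>I. pmf \<mu> S = (if k \<in> S then b else a) (card (S - {k})))
      \<and> (\<forall>j. 0 \<le> a j \<and> 0 \<le> b j \<and> (card (I - {k}) < j \<longrightarrow> a j = 0 \<and> b j = 0) \<and> (k \<notin> I \<longrightarrow> b j = 0))"
    using almost_symmetric_two_row[OF fin sub sym] by (elim exE)
  have w: "pmf \<mu> S = (if k \<in> S then b else a) (card (S - {k}))" if "S \<subseteq> I" for S
    by (rule conjunct1[OF two_row, rule_format, OF that])
  have ab: "0 \<le> a j" "0 \<le> b j" "card (I - {k}) < j \<Longrightarrow> a j = 0"
    "card (I - {k}) < j \<Longrightarrow> b j = 0" "k \<notin> I \<Longrightarrow> b j = 0" for j
    using conjunct2[OF two_row, THEN spec, of j] by simp_all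
  have field: "log_concave a" "log_concave (\<lambda>j. z * b j)" "log_concave (\<lambda>j. a j + z * b j)"
    "(z * b (i + r)) * a i \<le> (z * b i) * a (i + r)" if z: "0 < z" for z i r
  proof -
    define x where "x i = (if i = k then z else 1)" for i
    have "0 < gen_poly I \<mu> x"
      by (rule gen_poly_pos[OF fin sub]) (simp add: x_def z)
    then have "gen_poly I \<mu> x \<noteq> 0" by simp
    then have "h_NLC I (external_field I x \<mu>)"
      using h z by (simp add: h_NLC_plus_def x_def)
    then have hw: "h_NLC_weight I (\<lambda>S. pmf \<mu> S * prod x S)"
      using \<open>gen_poly I \<mu> x \<noteq> 0\<close> z by (subst (asm) h_NLC_external_field_iff[OF fin sub]) (auto simp: x_def)
    have wx: "pmf \<mu> S * prod x S = (if k \<in> S then \<lambda>j. z * b j else a) (card (S - {k}))" if "S \<subseteq> I" for S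
    proof -
      have "finite S" using that fin finite_subset by blast
      then have "prod x S = (if k \<in> S then z else 1)" by (simp add: x_def)
      then show ?thesis by (simp add: w[OF that])
    qed
    have zb: "0 \<le> z * b j" "card (I - {k}) < j \<Longrightarrow> z * b j = 0" "k \<notin> I \<Longrightarrow> z * b j = 0" for j
      using ab z by simp_all
    note lc = h_NLC_weight_two_row[OF fin wx ab(1,3) zb hw]
    show "log_concave a" "log_concave (\<lambda>j. z * b j)" "log_concave (\<lambda>j. a j + z * b j)"
      "(z * b (i + r)) * a i \<le> (z * b i) * a (i + r)"
      by (rule lc; assumption)+
  qed
  \<comment> \<open>The index \<open>k\<close> may lie outside \<open>I\<close>, where nothing is
    known about \<open>y\<close>; the value 0 there keeps \<open>\<kappa> k\<close>
    nonnegative.\<close>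
  define \<kappa> where "\<kappa> i = (if i \<in> I then y i else 0)" for i
  have \<kappa>: "0 \<le> \<kappa> i" for i using y by (simp add: \<kappa>_def)
  have "CNA_weight I (\<lambda>S. prod \<kappa> S * (if k \<in> S then b else a) (card (S - {k})))"
  proof (rule CNA_weight_two_row[OF fin])
    show "log_concave a" "log_concave b" using field(1,2)[of 1] by simp_all
    \<comment> \<open>The inequalities in \<open>field\<close> are available for positive
      \<open>z\<close> only; at \<open>\<kappa> k = 0\<close> the sum is \<open>a\<close>
      itself.\<close>
    show "log_concave (\<lambda>j. a j + \<kappa> k * b j)"
      using field(1)[of 1] field(3)[of "\<kappa> k"] \<kappa>[of k] by (cases "\<kappa> k = 0") simp_all
    show "b (i + r) * a i \<le> b i * a (i + r)" for i r using field(4)[of 1] by simp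
  qed (use \<kappa> ab in auto)
  moreover have wy: "pmf \<mu> S * prod y S = prod \<kappa> S * (if k \<in> S then b else a) (card (S - {k}))" if "S \<subseteq> I" for S
  proof -
    have "prod \<kappa> S = prod y S" using that by (intro prod.cong) (auto simp: \<kappa>_def)
    then show ?thesis by (simp add: w[OF that] mult.commute)
  qed
  ultimately show "CNA_weight I (\<lambda>S. pmf \<mu> S * prod y S)"
    by (subst CNA_weight_cong[OF wy])
qed

theorem corollary6p6:
  fixes n :: nat and \<mu> :: "nat set pmf"
  assumes "set_pmf \<mu> \<subseteq> Pow {1..n}"
    and "almost_symmetric {1..n} \<mu>"
  shows "(Rayleigh {1..n} \<mu> \<longleftrightarrow> CNA_plus {1..n} \<mu>)
       \<and> (Rayleigh {1..n} \<mu> \<longleftrightarrow> h_NLC_plus {1..n} \<mu>)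
       \<and> (h_NLC {1..n} \<mu> \<longleftrightarrow> CNA {1..n} \<mu>)"
proof -
  have fin: "finite {1..n}" by simp
  have "h_NLC_plus {1..n} \<mu> \<longleftrightarrow> CNA_plus {1..n} \<mu>"
    using almost_symmetric_h_NLC_plus_imp_CNA_plus[OF fin assms]
      CNA_plus_imp_h_NLC_plus[OF fin assms(1)] by blast
  moreover have "h_NLC {1..n} \<mu> \<longleftrightarrow> CNA {1..n} \<mu>"
    using almost_symmetric_h_NLC_imp_CNA[OF fin assms] CNA_imp_h_NLC[OF fin assms(1)] by blast
  ultimately show ?thesis using h_NLC_plus_iff_Rayleigh[OF fin assms(1)] by blast
qed

end
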